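(* Let $n\ge3$. Let $t_m$, $t_{m,k}$, $h_k$, $c_{m,k}=t_{m,k}/h_k$ be as defined in the context. Consider the following randomized procedure, in which all random choices are independent, "uniformly random planar tanglegram of size $m$" for $m<n$ means a sample from the uniform distribution on planar tanglegrams of size $m$, and "uniformly random irreducible planar layout of size $k$" means a sample from the uniform distribution on the set of planar layouts of irreducible planar tanglegrams of size $k$: (1) Choose $k\in\{2,\dots,n\}$ with probability $\frac{h_kc_{n,k}}{t_n}$, and generate a uniformly random irreducible planar layout $\mathcal{L}$ of size $k$. (2a) If $k\ne2$, choose a composition $(a_1,\dots,a_k)$ of $n$ with probability $\frac{t_{a_1}\cdots t_{a_k}}{c_{n,k}}$, and independently generate uniformly random planar tanglegrams $\mathcal{T}_1,\dots,\mathcal{T}_k$ of sizes $a_1,\dots,a_k$. (2b) If $n$ is odd and $k=2$, choose a composition $(a_1,a_2)$ of $n$ with probability $\frac{t_{a_1}t_{a_2}}{2c_{n,2}}$ and independently generate uniformly random planar tanglegrams $\mathcal{T}_1,\mathcal{T}_2$ of sizes $a_1,a_2$. (2c) If $n$ is even and $k=2$: with probability $\frac{t_{n/2}}{2c_{n,2}}$ generate a single uniformly random planar tanglegram $\mathcal{T}_1$ of size $n/2$ and set $\mathcal{T}_2=\mathcal{T}_1$; otherwise choose a composition $(a_1,a_2)$ of $n$ with probability $\frac{t_{a_1}t_{a_2}}{\sum_{i=1}^{n-1}t_it_{n-i}}$ and independently generate uniformly random planar tanglegrams $\mathcal{T}_1,\mathcal{T}_2$ of sizes $a_1,a_2$.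 (3) Output the tanglegram obtained from $\mathcal{L}$ by replacing its matched leaf pairs, from top to bottom, by $\mathcal{T}_1,\dots,\mathcal{T}_k$. Then the output is a planar tanglegram of size $n$, and its distribution is uniform over all planar tanglegrams of size $n$.
   Context: A rooted binary tree is a finite tree with a distinguished root in which every vertex has zero or two children; children are unordered. A tanglegram $\mathcal{T}=(L,R,\sigma)$ consists of an ordered pair of rooted binary trees with the same number of leaves and a perfect matching $\sigma$ between the leaves of $L$ and those of $R$; its size $|\mathcal{T}|$ is the number of leaves of $L$. Tanglegrams are considered up to isomorphism (graph isomorphisms of trees plus matching edges mapping $L$ to $L'$ and $R$ to $R'$). A layout draws $L$ left of the line $x=0$ with leaves on $x=0$, $R$ right of $x=1$ with leaves on $x=1$, matching edges as straight segments; $\mathcal{T}$ is planar if some layout has no two crossing matching segments, and such a layout is a planar layout. A planar layout is determined by the plane embeddings (left/right orders of children) of the two trees, the $i$-th leaf from the top of $L$ being matched to the $i$-th leaf from the top of $R$. If $u\in L$, $v\in R$ are internal non-root vertices such that $\sigma$ matches the leaf descendants of $u$ exactly with those of $v$, the subtrees rooted at $u,v$ with the induced matching form a proper subtanglegram; $\mathcal{T}$ is irreducible if it has none. $\mathrm{irr}(\mathcal{T})$ is obtained by contracting each maximal proper subtanglegram to a single pair of matched leaves. Notation: $t_m$ is the number of planar tanglegrams of size $m$; $t_{m,k}$ the number of planar tanglegrams $\mathcal{T}$ of size $m$ with $|\mathrm{irr}(\mathcal{T})|=k$; $h_k=t_{k,k}$ the number of irreducible planar tanglegrams of size $k$; $c_{m,k}=t_{m,k}/h_k$.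 Replacing the $i$-th matched leaf pair $(\ell_i,r_i)$ (from the top) of a layout by a tanglegram $\mathcal{T}_i=(L_i,R_i,\sigma_i)$ means identifying $\ell_i$ with the root of $L_i$ and $r_i$ with the root of $R_i$ and replacing the matching edge $\ell_ir_i$ by $\sigma_i$. A composition of $n$ is an ordered sequence of positive integers summing to $n$. *)

theory Defs
  imports "HOL-Probability.Probability" "HOL-Library.Uprod"
begin

text \<open>
  The two children of an internal vertex form an unordered pair.  In a well-formed tree the leaf
  labels are pairwise distinct, so that a vertex can be identified with the subtree rooted at it and
  a rooted-tree isomorphism with the bijection that it induces on leaf labels.
\<close>

datatype (leaves: 'a) btree = Leaf 'a | Node "'a btree uprod"

inductive wf_btree :: "'a btree \<Rightarrow> bool" where
  "wf_btree (Leaf a)"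
| "wf_btree s \<Longrightarrow> wf_btree t \<Longrightarrow> leaves s \<inter> leaves t = {} \<Longrightarrow> wf_btree (Node (Upair s t))"

primrec subtrees :: "'a btree \<Rightarrow> 'a btree set" where
  "subtrees (Leaf a) = {Leaf a}"
| "subtrees (Node p) = insert (Node p) (\<Union> (set_uprod (map_uprod subtrees p)))"

definition internal_nonroot :: "'a btree \<Rightarrow> 'a btree set" where
  "internal_nonroot t = {u \<in> subtrees t. u \<noteq> t \<and> (\<exists>p. u = Node p)}"


section \<open>Tanglegrams\<close>

text \<open>The matching is a function on leaf labels; only its values on the leaves of the left tree matter.\<close>

type_synonym 'a tgram = "'a btree \<times> 'a btree \<times> ('a \<Rightarrow> 'a)"

fun is_tanglegram :: "'a tgram \<Rightarrow> bool" where
  "is_tanglegram (L, R, \<sigma>) \<longleftrightarrow> wf_btree L \<and> wf_btree R \<and> bij_betw \<sigma> (leaves L) (leaves R)"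

fun tsize :: "'a tgram \<Rightarrow> nat" where
  "tsize (L, R, \<sigma>) = card (leaves L)"

fun iso_tgram :: "'a tgram \<Rightarrow> 'b tgram \<Rightarrow> bool" where
  "iso_tgram (L, R, \<sigma>) (L', R', \<sigma>') \<longleftrightarrow>
     (\<exists>f g. inj_on f (leaves L) \<and> map_btree f L = L' \<and>
            inj_on g (leaves R) \<and> map_btree g R = R' \<and>
            (\<forall>a\<in>leaves L. \<sigma>' (f a) = g (\<sigma> a)))"

text \<open>
  A tanglegram up to isomorphism is the set of all its copies with natural numbers as leaf labels.
\<close>

type_synonym tclass = "nat tgram set"

definition iso_class :: "'a tgram \<Rightarrow> tclass" where
  "iso_class T = {T'. is_tanglegram T' \<and> iso_tgram T T'}"


section \<open>Layouts and planarity\<close>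

text \<open>Plane trees; the left child is drawn above the right child.\<close>

datatype 'a ptree = PLeaf 'a | PNode "'a ptree" "'a ptree"

primrec forget :: "'a ptree \<Rightarrow> 'a btree" where
  "forget (PLeaf a) = Leaf a"
| "forget (PNode l r) = Node (Upair (forget l) (forget r))"

primrec leaf_list :: "'a ptree \<Rightarrow> 'a list" where
  "leaf_list (PLeaf a) = [a]"
| "leaf_list (PNode l r) = leaf_list l @ leaf_list r"

fun is_layout :: "'a tgram \<Rightarrow> 'a ptree \<times> 'a ptree \<Rightarrow> bool" where
  "is_layout (L, R, \<sigma>) (P, Q) \<longleftrightarrow> forget P = L \<and> forget Q = R"

text \<open>
  The matching segments starting in two leaves of the left tree cross iff their end points
  appear in the opposite vertical order on the right.
\<close>

definition crossing :: "('a \<Rightarrow> 'a) \<Rightarrow> 'a list \<Rightarrow> 'a list \<Rightarrow> bool" where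
  "crossing \<sigma> xs ys \<longleftrightarrow>
     (\<exists>i j p q. i < j \<and> j < length xs \<and> p < q \<and> q < length ys \<and>
                ys ! p = \<sigma> (xs ! j) \<and> ys ! q = \<sigma> (xs ! i))"

fun is_planar_layout :: "'a tgram \<Rightarrow> 'a ptree \<times> 'a ptree \<Rightarrow> bool" where
  "is_planar_layout (L, R, \<sigma>) (P, Q) \<longleftrightarrow>
     is_layout (L, R, \<sigma>) (P, Q) \<and> \<not> crossing \<sigma> (leaf_list P) (leaf_list Q)"

definition planar :: "'a tgram \<Rightarrow> bool" where
  "planar T \<longleftrightarrow> (\<exists>lay. is_planar_layout T lay)"

text \<open>
  A planar layout in itself consists of two plane trees without leaf labels: the \<open>i\<close>-th leaves from
  the top are matched with each other.
\<close>

type_synonym layout = "unit ptree \<times> unit ptree"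

definition shape :: "'a ptree \<Rightarrow> unit ptree" where
  "shape = map_ptree (\<lambda>_. ())"

definition planar_layouts :: "'a tgram \<Rightarrow> layout set" where
  "planar_layouts T = {(shape P, shape Q) | P Q. is_planar_layout T (P, Q)}"


section \<open>Proper subtanglegrams and irreducibility\<close>

fun proper_subs :: "'a tgram \<Rightarrow> ('a btree \<times> 'a btree) set" where
  "proper_subs (L, R, \<sigma>) =
     {(u, v). u \<in> internal_nonroot L \<and> v \<in> internal_nonroot R \<and> \<sigma> ` leaves u = leaves v}"

definition irreducible :: "'a tgram \<Rightarrow> bool" where
  "irreducible T \<longleftrightarrow> proper_subs T = {}"

definition maximal_subs :: "'a tgram \<Rightarrow> ('a btree \<times> 'a btree) set" where
  "maximal_subs T =
     {(u, v) \<in> proper_subs T. \<forall>(u', v') \<in> proper_subs T. u \<in> subtrees u' \<longrightarrow> u' = u}"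

text \<open>
  \<open>contract S t\<close> contracts the topmost vertices in \<open>S\<close> to leaves.  A leaf of the result
  is labelled by the set of all leaves of \<open>t\<close> that were contracted to it.
\<close>

primrec contract :: "'a btree set \<Rightarrow> 'a btree \<Rightarrow> 'a set btree" where
  "contract S (Leaf a) = Leaf {a}"
| "contract S (Node p) =
     (if Node p \<in> S then Leaf (leaves (Node p)) else Node (map_uprod (contract S) p))"

fun irr :: "'a tgram \<Rightarrow> 'a set tgram" where
  "irr (L, R, \<sigma>) =
     (contract (fst ` maximal_subs (L, R, \<sigma>)) L,
      contract (snd ` maximal_subs (L, R, \<sigma>)) R,
      image \<sigma>)"


section \<open>Counting\<close>

text \<open>
  In the usual notation, \<open>num_planar m\<close> is \<open>t\<^sub>m\<close>, \<open>num_planar_irr m k\<close> is \<open>t\<^sub>m\<^sub>,\<^sub>k\<close>,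
  \<open>num_irreducible k\<close> is \<open>h\<^sub>k\<close> and \<open>coeff_c m k\<close> is \<open>c\<^sub>m\<^sub>,\<^sub>k\<close>.
\<close>

definition planar_tanglegrams :: "nat \<Rightarrow> tclass set" where
  "planar_tanglegrams m =
     {iso_class T | T :: nat tgram. is_tanglegram T \<and> planar T \<and> tsize T = m}"

definition num_planar :: "nat \<Rightarrow> nat" where
  "num_planar m = card (planar_tanglegrams m)"

definition num_planar_irr :: "nat \<Rightarrow> nat \<Rightarrow> nat" where
  "num_planar_irr m k = card {iso_class T | T :: nat tgram.
                    is_tanglegram T \<and> planar T \<and> tsize T = m \<and> tsize (irr T) = k}"

definition num_irreducible :: "nat \<Rightarrow> nat" where
  "num_irreducible k = card {iso_class T | T :: nat tgram.
                 is_tanglegram T \<and> planar T \<and> tsize T = k \<and> irreducible T}"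

definition coeff_c :: "nat \<Rightarrow> nat \<Rightarrow> real" where
  "coeff_c m k = real (num_planar_irr m k) / real (num_irreducible k)"

definition irreducible_layouts :: "nat \<Rightarrow> layout set" where
  "irreducible_layouts k =
     (\<Union>T \<in> {T :: nat tgram. is_tanglegram T \<and> planar T \<and> irreducible T \<and> tsize T = k}. planar_layouts T)"


section \<open>Replacing matched leaf pairs by tanglegrams\<close>

primrec number_leaves :: "nat \<Rightarrow> 'a ptree \<Rightarrow> nat ptree" where
  "number_leaves i (PLeaf a) = PLeaf i"
| "number_leaves i (PNode l r) =
     PNode (number_leaves i l) (number_leaves (i + length (leaf_list l)) r)"

primrec subst_leaves :: "('a \<Rightarrow> 'b btree) \<Rightarrow> 'a btree \<Rightarrow> 'b btree" where
  "subst_leaves f (Leaf a) = f a"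
| "subst_leaves f (Node p) = Node (map_uprod (subst_leaves f) p)"

fun left_tree :: "'a tgram \<Rightarrow> 'a btree" where "left_tree (L, R, \<sigma>) = L"
fun right_tree :: "'a tgram \<Rightarrow> 'a btree" where "right_tree (L, R, \<sigma>) = R"
fun matching :: "'a tgram \<Rightarrow> 'a \<Rightarrow> 'a" where "matching (L, R, \<sigma>) = \<sigma>"

text \<open>
  Positions from the top are counted from 0.  The leaf \<open>x\<close> of the tanglegram inserted at position
  \<open>i\<close> is labelled \<open>(i, x)\<close>, which keeps the inserted tanglegrams disjoint.
\<close>

fun replace_pairs :: "layout \<Rightarrow> (nat \<Rightarrow> 'a tgram) \<Rightarrow> (nat \<times> 'a) tgram" where
  "replace_pairs (P, Q) Ts =
     (subst_leaves (\<lambda>i. map_btree (Pair i) (left_tree (Ts i))) (forget (number_leaves 0 P)),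
      subst_leaves (\<lambda>i. map_btree (Pair i) (right_tree (Ts i))) (forget (number_leaves 0 Q)),
      (\<lambda>(i, x). (i, matching (Ts i) x)))"

text \<open>The isomorphism class of the result does not depend on the representatives that are chosen.\<close>

definition replace_class :: "layout \<Rightarrow> (nat \<Rightarrow> tclass) \<Rightarrow> tclass" where
  "replace_class lay Cs = iso_class (replace_pairs lay (\<lambda>i. SOME T. T \<in> Cs i))"


section \<open>The random procedure\<close>

text \<open>
  Choosing an element of \<open>A\<close> with the given probabilities.  As \<^const>\<open>embed_pmf\<close> is only specified
  for nonnegative weights with sum 1, any statement about the outcome has to establish that the
  probabilities occurring in the procedure add up to 1.
\<close>

definition choose_with_prob :: "'a set \<Rightarrow> ('a \<Rightarrow> real) \<Rightarrow> 'a pmf" where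
  "choose_with_prob A w = embed_pmf (\<lambda>x. if x \<in> A then w x else 0)"

definition compositions :: "nat \<Rightarrow> nat \<Rightarrow> nat list set" where
  "compositions n k = {as. length as = k \<and> sum_list as = n \<and> (\<forall>a\<in>set as. 0 < a)}"

text \<open>Independent uniformly random planar tanglegrams of the given sizes; \<open>{}\<close> is a dummy
  for the positions beyond the length of the list.\<close>

definition random_tanglegrams :: "nat list \<Rightarrow> (nat \<Rightarrow> tclass) pmf" where
  "random_tanglegrams as =
     Pi_pmf {..<length as} {} (\<lambda>i. pmf_of_set (planar_tanglegrams (as ! i)))"

definition random_parts :: "nat \<Rightarrow> nat \<Rightarrow> (nat \<Rightarrow> tclass) pmf" where
  "random_parts n k =
     (if k \<noteq> 2 then
        do {
          as \<leftarrow> choose_with_prob (compositions n k) (\<lambda>as. (\<Prod>a\<leftarrow>as. real (num_planar a)) / coeff_c n k);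
          random_tanglegrams as
        }
      else if odd n then
        do {
          as \<leftarrow> choose_with_prob (compositions n 2) (\<lambda>as. (\<Prod>a\<leftarrow>as. real (num_planar a)) / (2 * coeff_c n 2));
          random_tanglegrams as
        }
      else
        do {
          same \<leftarrow> bernoulli_pmf (real (num_planar (n div 2)) / (2 * coeff_c n 2));
          if same then
            do {
              T \<leftarrow> pmf_of_set (planar_tanglegrams (n div 2));
              return_pmf (\<lambda>_. T)
            }
          else
            do {
              as \<leftarrow> choose_with_prob (compositions n 2)
                      (\<lambda>as. (\<Prod>a\<leftarrow>as. real (num_planar a)) / (\<Sum>i=1..n-1. real (num_planar i) * real (num_planar (n - i))));
              random_tanglegrams as
            }
        })"

definition random_planar_tanglegram :: "nat \<Rightarrow> tclass pmf" where
  "random_planar_tanglegram n =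
     do {
       k \<leftarrow> choose_with_prob {2..n} (\<lambda>k. real (num_irreducible k) * coeff_c n k / real (num_planar n));
       lay \<leftarrow> pmf_of_set (irreducible_layouts k);
       Ts \<leftarrow> random_parts n k;
       return_pmf (replace_class lay Ts)
     }"

end

theory Submission
  imports Defs
begin

text \<open>
  A planar layout is a pair of plane trees with the same number of leaves. Contracting its maximal
  proper common clusters turns it into an irreducible layout of some size \<open>k\<close>, so that every planar
  tanglegram is assembled from an irreducible layout of size \<open>k\<close> and \<open>k\<close> smaller planar tanglegrams.
  Such a configuration is determined by the result up to reflection: if two layouts of an irreducible
  tanglegram are not mirror images of each other, they may be assumed to agree on the order of the
  outermost leaves; among the pairs of leaves that they order differently, one at maximal distance
  then spans a proper common cluster. For \<open>k \<ge> 3\<close> the reflection has no fixed points, because the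
  upper half of a symmetric layout would be a common cluster. All fibres of the assembly map thus
  have two elements, and it transports the uniform distribution to the uniform distribution. For
  \<open>k = 2\<close> the fixed points are the pairs with \<open>T\<^sub>1 = T\<^sub>2\<close>, and the first alternative of step (2c) gives
  the tanglegrams obtained from these the weight that their one-element fibres lack.
\<close>

section \<open>Binary trees and isomorphisms of tanglegrams\<close>

text \<open>The relevant data are leaf sets. Along the matching the labels of both trees can be
  identified, and in a crossing-free drawing they can be taken to be the positions from the top. A
  proper subtanglegram is then a common cluster of both trees, and the tree \<open>irr T\<close> is
  hardly ever handled itself: all that matters is its size, the number of maximal common clusters,
  which is invariant under isomorphism. The constants of the procedure come from counting fibres.
  For k \<ge> 3, the number of irreducible layouts times the number of k-tuples of planar
  tanglegrams of total size n is 2 * \<open>num_planar_irr n k\<close>. For n = k the only tuple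
  consists of single leaf pairs, so there are 2 * \<open>num_irreducible k\<close> layouts. If this
  is positive, \<open>coeff_c n k\<close> is the number of tuples, as (2a) requires. For k = 2 there
  is one layout, equal to its mirror image, and reflection merely exchanges the two tanglegrams. So
  2 * \<open>coeff_c n 2\<close> is the number of ordered pairs if n is odd; if n is even, it counts
  the pairs and once more the \<open>num_planar (n div 2)\<close> pairs with equal entries. This
  explains (2b) and (2c).\<close>

lemma btree_induct_Upair [case_names Leaf Node]:
  assumes "\<And>a. P (Leaf a)" and "\<And>s t. P s \<Longrightarrow> P t \<Longrightarrow> P (Node (Upair s t))"
  shows "P t"
proof (induction t)
  case (Node p)
  then show ?case by (cases p) (auto intro: assms(2))
qed (rule assms(1))

lemma btree_cases_Upair [case_names Leaf Node]:
  obtains a where "t = Leaf a" | s u where "t = Node (Upair s u)"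
  by (induction t rule: btree_induct_Upair) auto

lemma finite_leaves [simp]: "finite (leaves t)"
  by (induction t rule: btree_induct_Upair) auto

lemma leaves_nonempty [simp]: "leaves t \<noteq> {}"
  by (induction t rule: btree_induct_Upair) auto

lemma leaves_forget [simp]: "leaves (forget P) = set (leaf_list P)"
  by (induction P) auto

lemma forget_map_ptree [simp]: "forget (map_ptree f P) = map_btree f (forget P)"
  by (induction P) auto

lemma leaf_list_map_ptree [simp]: "leaf_list (map_ptree f P) = map f (leaf_list P)"
  by (induction P) auto

lemma leaf_list_nonempty [simp]: "leaf_list P \<noteq> []"
  by (induction P) auto

lemma wf_btree_Node [simp]:
  "wf_btree (Node (Upair s t)) \<longleftrightarrow> wf_btree s \<and> wf_btree t \<and> leaves s \<inter> leaves t = {}"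
  by (subst wf_btree.simps) auto

lemma wf_btree_Leaf [simp]: "wf_btree (Leaf a)"
  by (rule wf_btree.intros)

lemma wf_btree_map:
  assumes "wf_btree t" "inj_on f (leaves t)"
  shows "wf_btree (map_btree f t)"
  using assms
proof (induction t rule: btree_induct_Upair)
  case (Node s t)
  then have "f ` leaves s \<inter> f ` leaves t = {}"
    by (subst inj_on_image_Int[symmetric, where C = "leaves s \<union> leaves t"]) auto
  with Node show ?case by (auto simp: btree.set_map intro: inj_on_subset)
qed auto

lemma wf_btree_forget [simp]: "wf_btree (forget P) \<longleftrightarrow> distinct (leaf_list P)"
  by (induction P) auto

lemma map_btree_inv_into:
  assumes "inj_on f (leaves t)"
  shows "map_btree (inv_into (leaves t) f) (map_btree f t) = t"
proof -
  have "map_btree (inv_into (leaves t) f) (map_btree f t) = map_btree id t"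
    unfolding btree.map_comp by (rule btree.map_cong0) (simp add: assms)
  then show ?thesis by (simp add: btree.map_id)
qed

section \<open>Isomorphism as an equivalence relation, and isomorphism classes\<close>

lemma iso_tgram_trans:
  assumes "iso_tgram T T'" "iso_tgram T' T''"
  shows "iso_tgram T T''"
proof -
  obtain L R \<sigma> L' R' \<sigma>' L'' R'' \<sigma>'' where T: "T = (L, R, \<sigma>)" "T' = (L', R', \<sigma>')" "T'' = (L'', R'', \<sigma>'')"
    by (cases T, cases T', cases T'')
  obtain f g where fg: "inj_on f (leaves L)" "map_btree f L = L'" "inj_on g (leaves R)"
      "map_btree g R = R'" "\<forall>a\<in>leaves L. \<sigma>' (f a) = g (\<sigma> a)"
    using assms(1) unfolding T by auto
  obtain f' g' where fg': "inj_on f' (leaves L')" "map_btree f' L' = L''" "inj_on g' (leaves R')"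
      "map_btree g' R' = R''" "\<forall>a\<in>leaves L'. \<sigma>'' (f' a) = g' (\<sigma>' a)"
    using assms(2) unfolding T by auto
  have *: "leaves L' = f ` leaves L" "leaves R' = g ` leaves R"
    using fg by (auto simp: btree.set_map)
  show ?thesis unfolding T iso_tgram.simps
    using fg fg' unfolding *
    by (intro exI[of _ "f' \<circ> f"] exI[of _ "g' \<circ> g"])
       (auto simp: btree.map_comp[symmetric] comp_inj_on)
qed

text \<open>The inverse bijections on the leaves do it. That T is a tanglegram ensures \<sigma> a
  \<in> \<open>leaves R\<close>, so that \<open>inv_into (leaves R) g\<close> can be cancelled at g
  (\<sigma> a).\<close>

lemma iso_tgram_sym:
  assumes "is_tanglegram T" "iso_tgram T T'"
  shows "iso_tgram T' T"
proof -
  obtain L R \<sigma> L' R' \<sigma>' where T: "T = (L, R, \<sigma>)" "T' = (L', R', \<sigma>')"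
    by (cases T, cases T')
  obtain f g where fg: "inj_on f (leaves L)" "map_btree f L = L'" "inj_on g (leaves R)"
      "map_btree g R = R'" "\<forall>a\<in>leaves L. \<sigma>' (f a) = g (\<sigma> a)"
    using assms(2) unfolding T by auto
  have *: "leaves L' = f ` leaves L" "leaves R' = g ` leaves R"
    using fg by (auto simp: btree.set_map)
  have \<sigma>: "\<sigma> a \<in> leaves R" if "a \<in> leaves L" for a
    using assms(1) that unfolding T by (auto simp: bij_betw_def)
  show ?thesis unfolding T iso_tgram.simps *
  proof (intro exI conjI ballI)
    show "map_btree (inv_into (leaves L) f) L' = L" "map_btree (inv_into (leaves R) g) R' = R"
      using fg map_btree_inv_into by blast+
    fix b assume "b \<in> f ` leaves L"
    then show "\<sigma> (inv_into (leaves L) f b) = inv_into (leaves R) g (\<sigma>' b)"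
      using fg \<sigma> by auto
  qed (auto simp: inj_on_inv_into)
qed

lemma is_tanglegram_iso:
  assumes "is_tanglegram T" "iso_tgram T T'"
  shows "is_tanglegram T'"
proof -
  obtain L R \<sigma> L' R' \<sigma>' where T: "T = (L, R, \<sigma>)" "T' = (L', R', \<sigma>')"
    by (cases T, cases T')
  obtain f g where fg: "inj_on f (leaves L)" "map_btree f L = L'" "inj_on g (leaves R)"
      "map_btree g R = R'" "\<forall>a\<in>leaves L. \<sigma>' (f a) = g (\<sigma> a)"
    using assms(2) unfolding T by auto
  have *: "leaves L' = f ` leaves L" "leaves R' = g ` leaves R"
    using fg by (auto simp: btree.set_map)
  have "bij_betw f (leaves L) (leaves L')" "bij_betw g (leaves R) (leaves R')"
    using fg * by (auto simp: bij_betw_def)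
  moreover have "bij_betw \<sigma> (leaves L) (leaves R)" using assms(1) by (simp add: T)
  ultimately have "bij_betw (g \<circ> \<sigma> \<circ> inv_into (leaves L) f) (leaves L') (leaves R')"
    by (intro bij_betw_trans[where A = "leaves L'" and B = "leaves L"] bij_betw_inv_into
        bij_betw_trans[where A = "leaves L" and B = "leaves R"])
  moreover have "\<sigma>' b = (g \<circ> \<sigma> \<circ> inv_into (leaves L) f) b" if "b \<in> leaves L'" for b
    using that fg unfolding * by auto
  ultimately have "bij_betw \<sigma>' (leaves L') (leaves R')"
    by (subst bij_betw_cong)
  moreover have "wf_btree L'" "wf_btree R'"
    using assms(1) fg wf_btree_map unfolding T is_tanglegram.simps by blast+
  ultimately show ?thesis by (simp add: T)
qed

lemma tsize_iso: "iso_tgram T T' \<Longrightarrow> tsize T' = tsize T"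
  by (cases T, cases T') (auto simp: btree.set_map card_image)

lemma iso_class_cong:
  assumes "is_tanglegram T" "iso_tgram T T'"
  shows "iso_class T = iso_class T'"
proof -
  have "iso_tgram T U \<longleftrightarrow> iso_tgram T' U" for U :: "nat tgram"
    using iso_tgram_trans[OF iso_tgram_sym[OF assms]] iso_tgram_trans[OF assms(2)] by iprover
  then show ?thesis by (simp add: iso_class_def)
qed

text \<open>Leaf sets are finite, so the leaves of both trees, whatever their type, can be renamed
  by natural numbers. Hence the choice of a representative in \<open>replace_class\<close> is
  meaningful, and isomorphism of tanglegrams with different label types can be read off from their
  classes.\<close>

lemma iso_class_nonempty:
  assumes "is_tanglegram T"
  shows "iso_class T \<noteq> {}"
proof -
  obtain L R \<sigma> where T: "T = (L, R, \<sigma>)" by (cases T)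
  define f where "f = to_nat_on (leaves L)"
  define g where "g = to_nat_on (leaves R)"
  have f: "inj_on f (leaves L)" and g: "inj_on g (leaves R)"
    unfolding f_def g_def by (intro inj_on_to_nat_on countable_finite finite_leaves)+
  have iso: "iso_tgram T (map_btree f L, map_btree g R, g \<circ> \<sigma> \<circ> inv_into (leaves L) f)"
    unfolding T iso_tgram.simps using f g by (intro exI[of _ f] exI[of _ g]) simp
  then have "(map_btree f L, map_btree g R, g \<circ> \<sigma> \<circ> inv_into (leaves L) f) \<in> iso_class T"
    using is_tanglegram_iso[OF assms iso] by (simp only: iso_class_def mem_Collect_eq)
  then show ?thesis by blast
qed

lemma iso_class_memD:
  assumes "is_tanglegram T" "T' \<in> iso_class T"
  shows "is_tanglegram T'" "iso_tgram T T'" "iso_class T' = iso_class T"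
proof -
  show *: "is_tanglegram T'" "iso_tgram T T'"
    using assms(2) by (simp_all add: iso_class_def)
  show "iso_class T' = iso_class T"
    by (rule iso_class_cong[OF assms(1) *(2), symmetric])
qed

lemma iso_class_eq_iff:
  assumes "is_tanglegram T" "is_tanglegram T'"
  shows "iso_class T = iso_class T' \<longleftrightarrow> iso_tgram T T'"
proof
  assume eq: "iso_class T = iso_class T'"
  obtain U where "U \<in> iso_class T" using iso_class_nonempty[OF assms(1)] by blast
  then have "iso_tgram T U" "iso_tgram T' U"
    using eq by (auto simp: iso_class_def)
  then show "iso_tgram T T'"
    using iso_tgram_sym[OF assms(2)] iso_tgram_trans by blast
qed (rule iso_class_cong[OF assms(1)])

section \<open>Clusters\<close>

text \<open>Leaf sets take the place of the subtrees: two trees may have a cluster in common without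
  having a subtree in common, and an injective relabelling acts on clusters simply by images. In a
  well-formed tree nothing is lost, by \<open>subtree_eqI\<close>.\<close>

definition clusters :: "'a btree \<Rightarrow> 'a set set" where
  "clusters t = leaves ` subtrees t"

lemma clusters_simps [simp]:
  "clusters (Leaf a) = {{a}}"
  "clusters (Node (Upair s t)) = insert (leaves s \<union> leaves t) (clusters s \<union> clusters t)"
  by (auto simp: clusters_def)

lemma subtrees_refl [simp]: "t \<in> subtrees t"
  by (cases t rule: btree_cases_Upair) auto

lemma leaves_in_clusters [simp]: "leaves t \<in> clusters t"
  by (simp add: clusters_def)

lemma leaves_subtree: "u \<in> subtrees t \<Longrightarrow> leaves u \<subseteq> leaves t"
  by (induction t rule: btree_induct_Upair) auto

lemma clusters_subset: "C \<in> clusters t \<Longrightarrow> C \<subseteq> leaves t"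
  by (auto simp: clusters_def dest: leaves_subtree)

lemma clusters_nonempty: "C \<in> clusters t \<Longrightarrow> C \<noteq> {}"
  by (auto simp: clusters_def)

lemma singleton_in_clusters: "a \<in> leaves t \<Longrightarrow> {a} \<in> clusters t"
  by (induction t rule: btree_induct_Upair) auto

lemma clusters_map: "clusters (map_btree f t) = image f ` clusters t"
  by (induction t rule: btree_induct_Upair) (auto simp: btree.set_map image_Un)

lemma clusters_laminar:
  assumes "wf_btree t" "C \<in> clusters t" "D \<in> clusters t"
  shows "C \<subseteq> D \<or> D \<subseteq> C \<or> C \<inter> D = {}"
  using assms
proof (induction t rule: btree_induct_Upair)
  case (Node s t)
  have sub: "X \<in> clusters s \<Longrightarrow> X \<subseteq> leaves s" "X \<in> clusters t \<Longrightarrow> X \<subseteq> leaves t" for X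
    by (rule clusters_subset, assumption)+
  consider "C = leaves s \<union> leaves t" | "D = leaves s \<union> leaves t"
    | "C \<in> clusters s" "D \<in> clusters s" | "C \<in> clusters t" "D \<in> clusters t"
    | "C \<in> clusters s" "D \<in> clusters t" | "C \<in> clusters t" "D \<in> clusters s"
    using Node.prems by auto
  then show ?case
  proof cases
    case 1 then show ?thesis using Node.prems(3) clusters_subset[of D] by auto
  next
    case 2 then show ?thesis using Node.prems(2) clusters_subset[of C] by auto
  next
    case 3 then show ?thesis using Node by auto
  next
    case 4 then show ?thesis using Node by auto
  next
    case 5 then show ?thesis using sub(1)[of C] sub(2)[of D] Node.prems(1) by auto
  next
    case 6 then show ?thesis using sub(1)[of D] sub(2)[of C] Node.prems(1) by auto
  qed
qed auto

text \<open>The critical case is that u is the root and v lies below one of its children: the leaves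
  of the other child would have to occur below v too, although the children have disjoint leaf
  sets.\<close>

lemma subtree_iff_leaves_subset:
  assumes "wf_btree t" "u \<in> subtrees t" "v \<in> subtrees t"
  shows "u \<in> subtrees v \<longleftrightarrow> leaves u \<subseteq> leaves v"
proof
  show "u \<in> subtrees v \<Longrightarrow> leaves u \<subseteq> leaves v" by (rule leaves_subtree)
  assume "leaves u \<subseteq> leaves v"
  with assms show "u \<in> subtrees v"
  proof (induction t rule: btree_induct_Upair)
    case (Node s t)
    have "leaves u \<noteq> {}" by simp
    moreover have "x \<in> subtrees s \<Longrightarrow> leaves x \<subseteq> leaves s" "x \<in> subtrees t \<Longrightarrow> leaves x \<subseteq> leaves t" for x
      using leaves_subtree by blast+
    ultimately have "u \<in> subtrees s \<and> v \<in> subtrees s \<or> u \<in> subtrees t \<and> v \<in> subtrees t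
        \<or> v = Node (Upair s t) \<or> u = Node (Upair s t) \<and> v \<noteq> u"
      using Node.prems by (simp del: leaves_nonempty) blast
    then show ?case
    proof (elim disjE)
      assume *: "u = Node (Upair s t) \<and> v \<noteq> u"
      have "leaves v \<subseteq> leaves s \<or> leaves v \<subseteq> leaves t"
        using * Node.prems leaves_subtree[of v s] leaves_subtree[of v t] by auto
      moreover have "leaves s \<union> leaves t \<subseteq> leaves v" "leaves s \<inter> leaves t = {}"
        using * Node.prems by auto
      ultimately have "leaves s = {} \<or> leaves t = {}" by blast
      then show ?thesis by simp
    qed (use Node in auto)
  qed auto
qed

lemma finite_clusters [simp]: "finite (clusters t)"
  by (induction t rule: btree_induct_Upair) auto

section \<open>Rigidity of irreducible pairs of plane trees\<close>

primrec mirror :: "'a ptree \<Rightarrow> 'a ptree" where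
  "mirror (PLeaf a) = PLeaf a"
| "mirror (PNode l r) = PNode (mirror r) (mirror l)"

lemma mirror_mirror [simp]: "mirror (mirror P) = P"
  by (induction P) auto

lemma forget_mirror [simp]: "forget (mirror P) = forget P"
  by (induction P) auto

lemma leaf_list_mirror [simp]: "leaf_list (mirror P) = rev (leaf_list P)"
  by (induction P) auto

lemma forget_eq_imp_set_leaf_list_eq: "forget P = forget Q \<Longrightarrow> set (leaf_list P) = set (leaf_list Q)"
  using leaves_forget by metis

lemma forget_PNode_eqE:
  assumes "forget (PNode l r) = forget Q"
  obtains l' r' where "Q = PNode l' r'" "forget l = forget l'" "forget r = forget r'"
    | l' r' where "Q = PNode l' r'" "forget l = forget r'" "forget r = forget l'"
  using assms by (cases Q) auto

text \<open>The first leaf of the list belongs to the upper child in both plane trees, so the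
  children of the root cannot have been exchanged. Then the lists split at the same place and the
  induction hypothesis applies to both children.\<close>

lemma ptree_eqI:
  assumes "forget P = forget Q" "leaf_list P = leaf_list Q" "distinct (leaf_list P)"
  shows "P = Q"
  using assms
proof (induction P arbitrary: Q)
  case (PLeaf a)
  then show ?case by (cases Q) auto
next
  case (PNode l r)
  show ?case
    using PNode.prems(1)
  proof (cases rule: forget_PNode_eqE)
    case (1 l' r')
    have "length (leaf_list l) = length (leaf_list l')"
      using PNode.prems forget_eq_imp_set_leaf_list_eq[OF 1(2)]
      by (metis 1(1) distinct_append distinct_card leaf_list.simps(2))
    with PNode 1 show ?thesis by auto
  next
    case (2 l' r')
    have "hd (leaf_list (PNode l r)) \<in> set (leaf_list l)" "hd (leaf_list (PNode l' r')) \<in> set (leaf_list l')"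
      by simp_all
    then have "set (leaf_list l) \<inter> set (leaf_list l') \<noteq> {}"
      using PNode.prems(2) 2(1) by (metis disjoint_iff)
    then show ?thesis
      using PNode.prems(3) forget_eq_imp_set_leaf_list_eq[OF 2(3)] by simp
  qed
qed

text \<open>The comparison refers to the first occurrence of b. If b does not occur at all, it
  degenerates to a \<in> \<open>set xs\<close>; for a = b it is false. With these conventions the
  rules for \<open>Cons\<close> and append need no side conditions.\<close>

definition precedes :: "'a list \<Rightarrow> 'a \<Rightarrow> 'a \<Rightarrow> bool" where
  "precedes xs a b \<longleftrightarrow> a \<in> set (takeWhile (\<lambda>x. x \<noteq> b) xs)"

lemma precedes_Nil [simp]: "\<not> precedes [] a b"
  by (simp add: precedes_def)

lemma precedes_Cons [simp]: "precedes (x # xs) a b \<longleftrightarrow> x \<noteq> b \<and> (a = x \<or> precedes xs a b)"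
  by (cases "x = b") (simp_all add: precedes_def)

lemma precedes_append:
  "precedes (xs @ ys) a b \<longleftrightarrow> (if b \<in> set xs then precedes xs a b else a \<in> set xs \<or> precedes ys a b)"
proof (cases "b \<in> set xs")
  case False
  then have "takeWhile (\<lambda>x. x \<noteq> b) (xs @ ys) = xs @ takeWhile (\<lambda>x. x \<noteq> b) ys"
    by (intro takeWhile_append2) auto
  with False show ?thesis by (simp add: precedes_def)
qed (simp add: precedes_def)

lemma precedes_imp_mem: "precedes xs a b \<Longrightarrow> a \<in> set xs"
  by (auto simp: precedes_def dest: set_takeWhileD)

lemma precedes_rev:
  assumes "distinct xs" "a \<in> set xs" "b \<in> set xs" "a \<noteq> b"
  shows "precedes (rev xs) a b \<longleftrightarrow> \<not> precedes xs a b"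
  using assms
proof (induction xs)
  case (Cons x xs)
  then show ?case
    using precedes_imp_mem[of "rev xs" a b] by (auto simp: precedes_append)
qed auto

lemma sorted_if_precedes:
  fixes xs :: "'a :: linorder list"
  assumes "\<And>a b. a \<in> set xs \<Longrightarrow> b \<in> set xs \<Longrightarrow> a < b \<Longrightarrow> precedes xs a b" "distinct xs"
  shows "sorted xs"
  using assms
proof (induction xs)
  case (Cons x xs)
  have "x \<le> y" if "y \<in> set xs" for y
    using Cons.prems(1)[of y x] that by (cases "y < x") auto
  moreover have "sorted xs"
  proof (rule Cons.IH)
    fix a b assume "a \<in> set xs" "b \<in> set xs" "a < b"
    then show "precedes xs a b"
      using Cons.prems(1)[of a b] Cons.prems(2) by auto
  qed (use Cons in auto)
  ultimately show ?case by simp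
qed simp

lemma upt_append_split:
  assumes "xs @ ys = [m..<n]"
  obtains j where "xs = [m..<j]" "ys = [j..<n]"
proof
  have "xs = take (length xs) [m..<n]" using assms by (metis append_eq_conv_conj)
  also have "\<dots> = [m..<min n (m + length xs)]"
    by (cases "m + length xs \<le> n") (auto simp: min_def)
  finally show "xs = [m..<min n (m + length xs)]" .
  have "ys = drop (length xs) [m..<n]" using assms by (metis append_eq_conv_conj)
  also have "\<dots> = [min n (m + length xs)..<n]" by (auto simp: min_def)
  finally show "ys = [min n (m + length xs)..<n]" .
qed

text \<open>
  \<open>{a0..b0}\<close> is the cluster of the lowest common ancestor of \<open>a\<close> and \<open>b\<close>; exchanging the children
  of this vertex reverses the order of all pairs of leaves that it separates.
\<close>

lemma lca_cluster:
  assumes "forget A = forget A'" "leaf_list A = [m..<n]" "m \<le> a" "a < b" "b < n"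
  shows "\<exists>a0 b0. m \<le> a0 \<and> a0 \<le> a \<and> b \<le> b0 \<and> b0 < n \<and> {a0..b0} \<in> clusters (forget A) \<and>
           (precedes (leaf_list A') a0 b0 \<longleftrightarrow> precedes (leaf_list A') a b)"
  using assms
proof (induction A arbitrary: A' m n)
  case (PLeaf x)
  then have "length [m..<n] = 1" by (metis leaf_list.simps(1) length_Cons list.size(3) One_nat_def)
  then show ?case using PLeaf.prems by simp
next
  case (PNode l r)
  have "leaf_list l @ leaf_list r = [m..<n]" using PNode.prems(2) by simp
  then obtain j where j: "leaf_list l = [m..<j]" "leaf_list r = [j..<n]"
    by (rule upt_append_split)
  have mj: "m < j" "j < n"
    using leaf_list_nonempty[of l] leaf_list_nonempty[of r] unfolding j by (metis upt_eq_Nil_conv not_le)+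
  obtain l' r' where A': "A' = PNode l' r'" using PNode.prems(1) by (cases A') auto
  have *: "forget l = forget l' \<and> forget r = forget r' \<or> forget l = forget r' \<and> forget r = forget l'"
    using PNode.prems(1) by (auto simp: A')
  then have sets: "set (leaf_list l') = {m..<j} \<and> set (leaf_list r') = {j..<n} \<or>
      set (leaf_list r') = {m..<j} \<and> set (leaf_list l') = {j..<n}"
    using j forget_eq_imp_set_leaf_list_eq[of l] forget_eq_imp_set_leaf_list_eq[of r]
    by (metis set_upt)
  have not_pre: "x \<notin> set xs \<Longrightarrow> \<not> precedes xs x y" for x y :: nat and xs
    using precedes_imp_mem by metis
  consider "b < j" | "j \<le> a" | "a < j" "j \<le> b" by linarith
  then show ?case
  proof cases
    case 1
    obtain c where c: "forget l = forget c" "c = l' \<or> c = r'" using * by blast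
    obtain a0 b0 where ab: "m \<le> a0 \<and> a0 \<le> a \<and> b \<le> b0 \<and> b0 < j \<and> {a0..b0} \<in> clusters (forget l) \<and>
        precedes (leaf_list c) a0 b0 = precedes (leaf_list c) a b"
      using PNode.IH(1)[OF c(1) j(1)] PNode.prems 1 by blast
    have "set (leaf_list c) = {m..<j}" using c j forget_eq_imp_set_leaf_list_eq[of l c] by simp
    \<comment> \<open>Both leaves lie below the child c of A'. Whether c is the upper or the lower
      child, the leaves of the other one do not affect their comparison.\<close>
    then have "precedes (leaf_list A') x y = precedes (leaf_list c) x y" if "m \<le> x" "x < y" "y < j" for x y
      using that c(2) sets mj not_pre by (auto simp: A' precedes_append)
    then have "precedes (leaf_list A') a0 b0 = precedes (leaf_list c) a0 b0"
        "precedes (leaf_list A') a b = precedes (leaf_list c) a b"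
      using ab 1 PNode.prems by auto
    with ab mj show ?thesis
      by (intro exI[of _ a0] exI[of _ b0]) auto
  next
    case 2
    obtain c where c: "forget r = forget c" "c = l' \<or> c = r'" using * by blast
    obtain a0 b0 where ab: "j \<le> a0 \<and> a0 \<le> a \<and> b \<le> b0 \<and> b0 < n \<and> {a0..b0} \<in> clusters (forget r) \<and>
        precedes (leaf_list c) a0 b0 = precedes (leaf_list c) a b"
      using PNode.IH(2)[OF c(1) j(2)] PNode.prems 2 by blast
    have "set (leaf_list c) = {j..<n}" using c j forget_eq_imp_set_leaf_list_eq[of r c] by simp
    then have "precedes (leaf_list A') x y = precedes (leaf_list c) x y" if "j \<le> x" "x < y" "y < n" for x y
      using that c(2) sets mj not_pre by (auto simp: A' precedes_append)
    then have "precedes (leaf_list A') a0 b0 = precedes (leaf_list c) a0 b0"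
        "precedes (leaf_list A') a b = precedes (leaf_list c) a b"
      using ab 2 PNode.prems by auto
    with ab mj show ?thesis
      by (intro exI[of _ a0] exI[of _ b0]) auto
  next
    case 3
    \<comment> \<open>All pairs separated by the root have the same order in A', which depends only
      on whether the children were exchanged. So the extreme pair m, n - 1 can serve as witness: its
      interval is the cluster of the root.\<close>
    have "precedes (leaf_list A') x y \<longleftrightarrow> set (leaf_list l') = {m..<j}" if "m \<le> x" "x < j" "j \<le> y" "y < n" for x y
      using sets
    proof
      assume s: "set (leaf_list l') = {m..<j} \<and> set (leaf_list r') = {j..<n}"
      with that show ?thesis by (simp add: A' precedes_append)
    next
      assume s: "set (leaf_list r') = {m..<j} \<and> set (leaf_list l') = {j..<n}"
      then have "\<not> precedes (leaf_list A') x y"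
        using that not_pre[of x "leaf_list l'"] by (simp add: A' precedes_append)
      moreover have "m \<in> {m..<j}" "m \<notin> {j..<n}" using mj by auto
      ultimately show ?thesis using s by metis
    qed
    then have "precedes (leaf_list A') m (n - 1) = precedes (leaf_list A') a b"
      using 3 PNode.prems mj by auto
    moreover have "{m..<j} \<union> {j..<n} = {m..n-1}"
      using mj by auto
    then have "{m..n-1} \<in> clusters (forget (PNode l r))"
      by (simp add: j)
    moreover have "b \<le> n - 1" "n - 1 < n" "m \<le> m" "m \<le> a"
      using PNode.prems by auto
    ultimately show ?thesis by blast
  qed
qed

definition irreducible_pair :: "'a btree \<Rightarrow> 'a btree \<Rightarrow> bool" where
  "irreducible_pair L R \<longleftrightarrow> (\<forall>C \<in> clusters L \<inter> clusters R. C = leaves L \<or> card C = 1)"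

text \<open>
  A pair of leaves of maximal distance whose order is reversed spans a cluster of both trees.
\<close>

lemma irreducible_pair_rigid_aux:
  assumes "leaf_list A = [0..<k]" "leaf_list B = [0..<k]" "irreducible_pair (forget A) (forget B)"
    and "forget A = forget A'" "forget B = forget B'" "leaf_list A' = leaf_list B'"
    and "distinct (leaf_list A')"
    and "k > 1 \<Longrightarrow> precedes (leaf_list A') 0 (k - 1)"
  shows "A' = A \<and> B' = B"
proof -
  let ?inv = "\<lambda>(a, b). a < b \<and> b < k \<and> \<not> precedes (leaf_list A') a b"
  have no_inv: "\<not> ?inv p" for p
  proof
    assume p: "?inv p"
    have "\<exists>ab. ?inv ab \<and> (\<forall>q. ?inv q \<longrightarrow> snd q - fst q \<le> snd ab - fst ab)"
      using p by (rule ex_has_greatest_nat[where b = k]) auto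
    then obtain ab where ab: "?inv ab" "\<forall>q. ?inv q \<longrightarrow> snd q - fst q \<le> snd ab - fst ab"
      by blast
    obtain a b where [simp]: "ab = (a, b)" by (cases ab)
    have ab': "a < b" "b < k" "\<not> precedes (leaf_list A') a b" using ab by auto
    \<comment> \<open>\<open>lca_cluster\<close> encloses a and b in a cluster whose end points are
      reversed as well; maximality of the distance leaves no room for a larger interval. The
      argument works in both trees, as A' and B' list the leaves in the same order.\<close>
    have *: "{a..b} \<in> clusters (forget C)"
      if C: "forget C = forget C'" "leaf_list C = [0..<k]" "leaf_list C' = leaf_list A'" for C C'
    proof -
      obtain a0 b0 where "a0 \<le> a" "b \<le> b0" "b0 < k" "{a0..b0} \<in> clusters (forget C)"
           "precedes (leaf_list C') a0 b0 \<longleftrightarrow> precedes (leaf_list C') a b"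
        using lca_cluster[OF C(1,2), of a b] ab' by auto
      moreover from this have "b0 - a0 \<le> b - a"
        using ab(2)[rule_format, of "(a0, b0)"] ab' C(3) by auto
      ultimately show ?thesis
        using ab' by (cases "a0 = a"; cases "b0 = b") auto
    qed
    have "{a..b} \<in> clusters (forget A) \<inter> clusters (forget B)"
      using *[of A A'] *[of B B'] assms by auto
    moreover have "card {a..b} \<noteq> 1" using ab' by simp
    ultimately have "{a..b} = {0..<k}"
      using assms(1,3) by (auto simp: irreducible_pair_def)
    moreover have "0 \<in> {0..<k}" "k - 1 \<in> {0..<k}" using ab' by auto
    ultimately have "0 \<in> {a..b}" "k - 1 \<in> {a..b}" by simp_all
    then have "a = 0" "b = k - 1" using ab' by auto
    \<comment> \<open>The orientation of the outermost leaves is assumed in order to exclude this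
      case: a reversed pair that spans all leaves is no contradiction to irreducibility, as the
      mirror image shows.\<close>
    then show False using assms(8) ab' by auto
  qed
  have set: "set (leaf_list A') = {0..<k}"
    using forget_eq_imp_set_leaf_list_eq[OF assms(4)] assms(1) by simp
  have "sorted (leaf_list A')"
    using no_inv set by (intro sorted_if_precedes[OF _ assms(7)]) auto
  then have xs: "leaf_list A' = [0..<k]"
    using sorted_distinct_set_unique[of "leaf_list A'" "[0..<k]"] set assms(7) by simp
  show ?thesis
    using ptree_eqI[of A A'] ptree_eqI[of B B'] xs assms by auto
qed

text \<open>Equality of the leaf lists of A' and B' expresses that they form a planar drawing of the
  same two trees. If it has the outermost leaves in reversed order, its mirror image satisfies the
  orientation assumption of the auxiliary lemma.\<close>

lemma irreducible_pair_rigid: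
  assumes "leaf_list A = [0..<k]" "leaf_list B = [0..<k]" "irreducible_pair (forget A) (forget B)"
    and "forget A = forget A'" "forget B = forget B'" "leaf_list A' = leaf_list B'"
    and "distinct (leaf_list A')"
  shows "A' = A \<and> B' = B \<or> A' = mirror A \<and> B' = mirror B"
proof (cases "k > 1 \<longrightarrow> precedes (leaf_list A') 0 (k - 1)")
  case True
  then show ?thesis using irreducible_pair_rigid_aux[OF assms] by blast
next
  case False
  have "set (leaf_list A') = {0..<k}"
    using forget_eq_imp_set_leaf_list_eq[OF assms(4)] assms(1) by simp
  then have "precedes (rev (leaf_list A')) 0 (k - 1)"
    using False precedes_rev[OF assms(7), of 0 "k - 1"] by auto
  then have "mirror A' = A \<and> mirror B' = B"
    using assms by (intro irreducible_pair_rigid_aux[of A k B]) auto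
  then show ?thesis by (metis mirror_mirror)
qed

section \<open>Substitution and contraction\<close>

lemma leaves_subst: "leaves (subst_leaves F t) = (\<Union>i\<in>leaves t. leaves (F i))"
  by (induction t rule: btree_induct_Upair) auto

lemma subst_leaves_cong:
  "(\<And>i. i \<in> leaves t \<Longrightarrow> F i = G i) \<Longrightarrow> subst_leaves F t = subst_leaves G t"
  by (induction t rule: btree_induct_Upair) auto

lemma map_subst_leaves: "map_btree f (subst_leaves F t) = subst_leaves (\<lambda>i. map_btree f (F i)) t"
  by (induction t rule: btree_induct_Upair) auto

lemma subst_leaves_map: "subst_leaves F (map_btree h t) = subst_leaves (\<lambda>i. F (h i)) t"
  by (induction t rule: btree_induct_Upair) auto

text \<open>Both substitutions fill position i with a tree on the same block S i, and the blocks are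
  disjoint. Comparing from the root downwards, an inserted tree of one side can never face an
  internal vertex of the other outer tree, so the two outer trees end at the same places.\<close>

lemma subst_leaves_inject:
  assumes "wf_btree t" "wf_btree t'" "subst_leaves F t = subst_leaves F' t'"
    and "\<And>i. i \<in> leaves t \<Longrightarrow> leaves (F i) = S i" "\<And>i. i \<in> leaves t' \<Longrightarrow> leaves (F' i) = S i"
    and "\<And>i j. i \<in> leaves t \<union> leaves t' \<Longrightarrow> j \<in> leaves t \<union> leaves t' \<Longrightarrow> i \<noteq> j \<Longrightarrow> S i \<inter> S j = {}"
  shows "t = t' \<and> (\<forall>i\<in>leaves t. F i = F' i)"
proof -
  \<comment> \<open>A block that faces an internal vertex is the union of all blocks below it.
    Disjointness leaves only the index i for these, whereas the two children would need different
    leaves.\<close>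
  have leaf: False if Fi: "leaves (F i) = S i" "F i = subst_leaves F' (Node (Upair s t))"
      and wf: "wf_btree (Node (Upair s t))"
      and F': "\<And>j. j \<in> leaves (Node (Upair s t)) \<Longrightarrow> leaves (F' j) = S j"
      and disj: "\<And>j. j \<in> leaves (Node (Upair s t)) \<Longrightarrow> i \<noteq> j \<Longrightarrow> S i \<inter> S j = {}"
    for i s t and F F' :: "'a \<Rightarrow> 'b btree"
  proof -
    have "S i = (\<Union>j\<in>leaves (Node (Upair s t)). leaves (F' j))"
      using Fi leaves_subst[of F' "Node (Upair s t)"] by metis
    then have sub: "S j \<subseteq> S i" if "j \<in> leaves (Node (Upair s t))" for j using that F' by blast
    have "j = i" if j: "j \<in> leaves (Node (Upair s t))" for j
    proof (rule ccontr)
      assume "j \<noteq> i"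
      then have "S j = {}" using sub[OF j] disj[OF j] by blast
      moreover have "S j \<noteq> {}" using F'[OF j] leaves_nonempty by metis
      ultimately show False by blast
    qed
    then have "leaves s \<subseteq> {i}" "leaves t \<subseteq> {i}" by auto
    then have "leaves s = {i}" "leaves t = {i}" using leaves_nonempty[of s] leaves_nonempty[of t] by blast+
    with wf show False by simp
  qed
  show ?thesis
    using assms
  proof (induction t arbitrary: t' rule: btree_induct_Upair)
    case (Leaf i)
    show ?case
    proof (cases t' rule: btree_cases_Upair)
      case (Leaf j)
      with Leaf.prems have "F i = F' j" "S i = S j" by auto
      moreover have "S i \<noteq> {}" using Leaf.prems(4)[of i] leaves_nonempty[of "F i"] by simp
      ultimately have "i = j" using Leaf.prems(6)[of i j] Leaf by auto
      with Leaf Leaf.prems show ?thesis by auto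
    next
      case (Node s' u')
      then show ?thesis using leaf[of F i F' s' u'] Leaf.prems by auto
    qed
  next
    case (Node s u)
    show ?case
    proof (cases t' rule: btree_cases_Upair)
      case (Leaf j)
      have False
      proof (rule leaf[of F' j F s u])
        show "leaves (F' j) = S j" using Node.prems(5) by (simp add: Leaf)
        show "F' j = subst_leaves F (Node (Upair s u))" using Node.prems(3) by (simp add: Leaf)
        show "S j \<inter> S i = {}" if "i \<in> leaves (Node (Upair s u))" "j \<noteq> i" for i
          using that Node.prems(6)[of j i] by (simp add: Leaf)
      qed (fact Node.prems(1), fact Node.prems(4))
      then show ?thesis ..
    next
      case t': (Node s' u')
      have sub: "leaves s \<subseteq> leaves (Node (Upair s u))" "leaves u \<subseteq> leaves (Node (Upair s u))"
         "leaves s' \<subseteq> leaves t'" "leaves u' \<subseteq> leaves t'" by (auto simp: t')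
      have *: "x = x' \<and> (\<forall>i\<in>leaves x. F i = F' i)"
        if "x = s \<or> x = u" "x' = s' \<or> x' = u'" "subst_leaves F x = subst_leaves F' x'" for x x'
      proof -
        have "leaves x \<subseteq> leaves (Node (Upair s u))" "leaves x' \<subseteq> leaves t'" using that sub by auto
        then have **: "\<And>i j. i \<in> leaves x \<union> leaves x' \<Longrightarrow> j \<in> leaves x \<union> leaves x' \<Longrightarrow> i \<noteq> j \<Longrightarrow> S i \<inter> S j = {}"
             "\<And>i. i \<in> leaves x \<Longrightarrow> leaves (F i) = S i" "\<And>i. i \<in> leaves x' \<Longrightarrow> leaves (F' i) = S i"
          using Node.prems(4-6) by blast+
        have wf: "wf_btree x" "wf_btree x'" using that Node.prems(1,2) t' by auto
        from that(1) show ?thesis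
        proof
          assume "x = s" then show ?thesis using Node.IH(1)[of x'] that wf ** by blast
        next
          assume "x = u" then show ?thesis using Node.IH(2)[of x'] that wf ** by blast
        qed
      qed
      have "subst_leaves F s = subst_leaves F' s' \<and> subst_leaves F u = subst_leaves F' u' \<or>
            subst_leaves F s = subst_leaves F' u' \<and> subst_leaves F u = subst_leaves F' s'"
        using Node.prems(3) by (simp add: t')
      then show ?thesis
        using *[of s s'] *[of s u'] *[of u s'] *[of u u'] by (auto simp: t')
    qed
  qed
qed

lemma clusters_subst:
  "clusters (subst_leaves F t) =
     (\<Union>i\<in>leaves t. clusters (F i)) \<union> (\<lambda>C. \<Union>i\<in>C. leaves (F i)) ` clusters t"
  by (induction t rule: btree_induct_Upair) (auto simp: leaves_subst)

section \<open>Maximal sets, contraction and parts\<close>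

definition maximal_sets :: "'a set set \<Rightarrow> 'a set set" where
  "maximal_sets \<C> = {C \<in> \<C>. \<forall>D\<in>\<C>. C \<subseteq> D \<longrightarrow> D = C}"

lemma maximal_sets_Un:
  assumes "\<And>C D. C \<in> A \<Longrightarrow> D \<in> B \<Longrightarrow> \<not> C \<subseteq> D \<and> \<not> D \<subseteq> C"
  shows "maximal_sets (A \<union> B) = maximal_sets A \<union> maximal_sets B"
  using assms unfolding maximal_sets_def by blast

lemma maximal_sets_image:
  assumes "inj_on f A" "\<And>C. C \<in> \<C> \<Longrightarrow> C \<subseteq> A"
  shows "maximal_sets (image f ` \<C>) = image f ` maximal_sets \<C>"
proof -
  have sub: "f ` C \<subseteq> f ` D \<longleftrightarrow> C \<subseteq> D" if "C \<in> \<C>" "D \<in> \<C>" for C D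
    by (rule inj_on_image_subset_iff[OF assms(1) assms(2)[OF that(1)] assms(2)[OF that(2)]])
  have eq: "f ` C = f ` D \<longleftrightarrow> C = D" if "C \<in> \<C>" "D \<in> \<C>" for C D
    by (rule inj_on_image_eq_iff[OF assms(1) assms(2)[OF that(1)] assms(2)[OF that(2)]])
  show ?thesis
  proof (intro equalityI subsetI)
    fix X assume X: "X \<in> maximal_sets (image f ` \<C>)"
    then obtain C where C: "C \<in> \<C>" "X = f ` C" by (auto simp: maximal_sets_def)
    have "D = C" if "D \<in> \<C>" "C \<subseteq> D" for D
    proof -
      have "f ` D = X"
        using X that image_mono[OF that(2), of f] unfolding maximal_sets_def C(2) by simp
      then show ?thesis using eq[OF that(1) C(1)] C(2) by simp
    qed
    then show "X \<in> image f ` maximal_sets \<C>"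
      using C by (simp add: maximal_sets_def)
  next
    fix X assume "X \<in> image f ` maximal_sets \<C>"
    then obtain C where C: "C \<in> maximal_sets \<C>" "X = f ` C" by auto
    have "f ` D = f ` C" if "D \<in> \<C>" "f ` C \<subseteq> f ` D" for D
    proof -
      have "D = C" using C(1) that sub[of C D] by (simp add: maximal_sets_def)
      then show ?thesis by simp
    qed
    then show "X \<in> maximal_sets (image f ` \<C>)"
      using C by (simp add: maximal_sets_def)
  qed
qed

lemma maximal_sets_above:
  assumes "finite \<C>" "C \<in> \<C>"
  obtains D where "D \<in> maximal_sets \<C>" "C \<subseteq> D"
proof -
  obtain D where "D \<in> \<C>" "C \<subseteq> D" "\<forall>E\<in>\<C>. D \<subseteq> E \<longrightarrow> D = E"
    using finite_has_maximal2[OF assms] by auto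
  then show ?thesis by (intro that[of D]) (auto simp: maximal_sets_def)
qed

text \<open>Contraction stops at the topmost vertices that are in S or are leaves, and topmost means
  maximal leaf set. The induction works because sets below different children are incomparable,
  being nonempty and disjoint.\<close>

lemma leaves_contract:
  assumes "wf_btree t"
  shows "leaves (contract S t) = maximal_sets (leaves ` {u \<in> subtrees t. u \<in> S \<or> (\<exists>a. u = Leaf a)})"
    (is "_ = maximal_sets (?N t)")
proof -
  have N_sub: "C \<subseteq> leaves t" "C \<noteq> {}" if "C \<in> ?N t" for C and t :: "'a btree"
  proof -
    obtain u where "u \<in> subtrees t" "C = leaves u" using \<open>C \<in> ?N t\<close> by blast
    then show "C \<subseteq> leaves t" "C \<noteq> {}" using leaves_subtree[of u t] by simp_all
  qed
  show ?thesis
    using assms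
  proof (induction t rule: btree_induct_Upair)
    case (Leaf a)
    have "{u \<in> subtrees (Leaf a). u \<in> S \<or> (\<exists>b. u = Leaf b)} = {Leaf a}" by auto
    then show ?case by (auto simp: maximal_sets_def)
  next
    case (Node s t)
    show ?case
    proof (cases "Node (Upair s t) \<in> S")
      case True
      then have "leaves (Node (Upair s t)) \<in> ?N (Node (Upair s t))"
        by (intro imageI) simp
      moreover have "C \<subseteq> leaves (Node (Upair s t))" if "C \<in> ?N (Node (Upair s t))" for C
        using that by (rule N_sub)
      ultimately have "maximal_sets (?N (Node (Upair s t))) = {leaves (Node (Upair s t))}"
        unfolding maximal_sets_def by blast
      moreover have "leaves (contract S (Node (Upair s t))) = {leaves (Node (Upair s t))}"
        using True by simp
      ultimately show ?thesis by (simp only:)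
    next
      case False
      then have "{u \<in> subtrees (Node (Upair s t)). u \<in> S \<or> (\<exists>a. u = Leaf a)} =
          {u \<in> subtrees s. u \<in> S \<or> (\<exists>a. u = Leaf a)} \<union> {u \<in> subtrees t. u \<in> S \<or> (\<exists>a. u = Leaf a)}"
        by auto
      then have N: "?N (Node (Upair s t)) = ?N s \<union> ?N t" by (simp only: image_Un)
      have "\<not> C \<subseteq> D \<and> \<not> D \<subseteq> C" if "C \<in> ?N s" "D \<in> ?N t" for C D
      proof -
        have "leaves s \<inter> leaves t = {}" using Node.prems by simp
        then show ?thesis using N_sub[OF that(1)] N_sub[OF that(2)] by blast
      qed
      then have "maximal_sets (?N (Node (Upair s t))) = maximal_sets (?N s) \<union> maximal_sets (?N t)"
        unfolding N by (rule maximal_sets_Un)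
      moreover have "leaves (contract S (Node (Upair s t))) = leaves (contract S s) \<union> leaves (contract S t)"
        using False by simp
      moreover have "wf_btree s" "wf_btree t" using Node.prems by simp_all
      ultimately show ?thesis using Node.IH by (simp only:)
    qed
  qed
qed

text \<open>Only the left root is excluded explicitly; as \<sigma> is a bijection between the leaf
  sets of a tanglegram, this excludes the right root as well.\<close>

fun common_clusters :: "'a tgram \<Rightarrow> 'a set set" where
  "common_clusters (L, R, \<sigma>) = {C \<in> clusters L. C \<noteq> leaves L \<and> \<sigma> ` C \<in> clusters R}"

text \<open>Singletons are common clusters, so for size at least 2 the parts are the leaf labels of \<open>irr T\<close>.\<close>

definition parts :: "'a tgram \<Rightarrow> 'a set set" where
  "parts T = maximal_sets (common_clusters T)"

lemma finite_common_clusters [simp]: "finite (common_clusters T)"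
  by (cases T) simp

lemma common_clusters_iso:
  assumes "is_tanglegram (L, R, \<sigma>)" and "inj_on f (leaves L)" "inj_on g (leaves R)"
    and "\<And>a. a \<in> leaves L \<Longrightarrow> \<sigma>' (f a) = g (\<sigma> a)"
  shows "common_clusters (map_btree f L, map_btree g R, \<sigma>') = image f ` common_clusters (L, R, \<sigma>)"
proof -
  have "\<sigma>' ` f ` C \<in> image g ` clusters R \<longleftrightarrow> \<sigma> ` C \<in> clusters R" if "C \<in> clusters L" for C
  proof -
    have C: "C \<subseteq> leaves L" using that by (rule clusters_subset)
    then have "\<sigma> ` C \<subseteq> leaves R" using assms(1) by (auto simp: bij_betw_def)
    moreover have "\<sigma>' ` f ` C = g ` \<sigma> ` C"
      unfolding image_image using C assms(4) by (intro image_cong) auto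
    moreover have "(g ` X \<in> image g ` clusters R) = (X \<in> clusters R)" if "X \<subseteq> leaves R" for X
      using inj_on_image_eq_iff[OF assms(3) that clusters_subset[of _ R]] by (auto simp: image_iff)
    ultimately show ?thesis by simp
  qed
  moreover have "f ` C = f ` leaves L \<longleftrightarrow> C = leaves L" if "C \<in> clusters L" for C
    by (rule inj_on_image_eq_iff[OF assms(2) clusters_subset[OF that] subset_refl])
  ultimately have "{C \<in> clusters L. f ` C \<noteq> f ` leaves L \<and> \<sigma>' ` f ` C \<in> image g ` clusters R} =
      common_clusters (L, R, \<sigma>)"
    unfolding common_clusters.simps by (intro Collect_cong) metis
  moreover have "{X \<in> h ` A. P X} = h ` {x \<in> A. P (h x)}" for h :: "'a set \<Rightarrow> 'b set" and A P
    by auto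
  ultimately show ?thesis
    unfolding common_clusters.simps clusters_map btree.set_map by simp
qed

lemma common_clusters_isoE:
  assumes "is_tanglegram T" "iso_tgram T T'"
  obtains f where "inj_on f (leaves (left_tree T))" "common_clusters T' = image f ` common_clusters T"
proof -
  obtain L R \<sigma> L' R' \<sigma>' where T: "T = (L, R, \<sigma>)" "T' = (L', R', \<sigma>')"
    by (cases T, cases T')
  obtain f g where fg: "inj_on f (leaves L)" "map_btree f L = L'" "inj_on g (leaves R)"
      "map_btree g R = R'" "\<forall>a\<in>leaves L. \<sigma>' (f a) = g (\<sigma> a)"
    using assms(2) unfolding T by auto
  have "common_clusters T' = image f ` common_clusters T"
    using common_clusters_iso[of L R \<sigma> f g \<sigma>'] assms(1) fg unfolding T by auto
  with that fg(1) show ?thesis by (simp add: T)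
qed

lemma common_clusters_subset: "C \<in> common_clusters T \<Longrightarrow> C \<subseteq> leaves (left_tree T)"
  by (cases T) (auto dest: clusters_subset)

text \<open>Together with \<open>tsize_irr\<close>, this makes the size of the contracted tanglegram
  an isomorphism invariant without constructing an isomorphism between contracted trees.\<close>

lemma card_parts_iso:
  assumes "is_tanglegram T" "iso_tgram T T'"
  shows "card (parts T') = card (parts T)"
proof -
  obtain f where f: "inj_on f (leaves (left_tree T))" "common_clusters T' = image f ` common_clusters T"
    using common_clusters_isoE[OF assms] .
  have "parts T' = image f ` parts T"
    unfolding parts_def f(2) by (rule maximal_sets_image[OF f(1) common_clusters_subset])
  moreover have "inj_on (image f) (parts T)"
    by (intro inj_on_image_eq_iff[OF f(1) common_clusters_subset common_clusters_subset, THEN iffD1] inj_onI)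
       (simp_all add: parts_def maximal_sets_def)
  ultimately show ?thesis by (simp add: card_image)
qed

lemma singleton_in_common_clusters:
  assumes "is_tanglegram T" "tsize T \<ge> 2" "a \<in> leaves (left_tree T)"
  shows "{a} \<in> common_clusters T"
proof -
  obtain L R \<sigma> where T: "T = (L, R, \<sigma>)" by (cases T)
  have "\<sigma> a \<in> leaves R" using assms by (auto simp: T bij_betw_def)
  moreover have "{a} \<noteq> leaves L" using assms(2) by (auto simp: T dest: arg_cong[where f = card])
  ultimately show ?thesis
    using assms(3) singleton_in_clusters by (auto simp: T)
qed

section \<open>Proper subtanglegrams in terms of common clusters\<close>

lemma card_leaves_eq_1: "card (leaves t) = 1 \<Longrightarrow> wf_btree t \<Longrightarrow> \<exists>a. t = Leaf a"
proof (cases t rule: btree_cases_Upair)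
  case (Node s u)
  assume "card (leaves t) = 1" "wf_btree t"
  then have "card (leaves s) + card (leaves u) = 1"
    by (simp add: Node card_Un_disjoint)
  moreover have "card (leaves s) > 0" "card (leaves u) > 0"
    by (simp_all add: card_gt_0_iff)
  ultimately show ?thesis by linarith
qed auto

lemma wf_subtree: "wf_btree t \<Longrightarrow> u \<in> subtrees t \<Longrightarrow> wf_btree u"
  by (induction t rule: btree_induct_Upair) auto

lemma subtree_eqI:
  assumes "wf_btree t" "u \<in> subtrees t" "v \<in> subtrees t" "leaves u = leaves v"
  shows "u = v"
proof -
  have "u \<in> subtrees v"
    using subtree_iff_leaves_subset[OF assms(1)] assms by auto
  moreover have "wf_btree v" using assms wf_subtree by blast
  ultimately show ?thesis
    using assms(4)
  proof (cases v rule: btree_cases_Upair)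
    case (Node s t)
    have "\<not> leaves v \<subseteq> leaves x" if "x = s \<or> x = t" for x
      using that \<open>wf_btree v\<close> leaves_nonempty[of s] leaves_nonempty[of t] by (auto simp: Node simp del: leaves_nonempty)
    moreover have "u = v \<or> u \<in> subtrees s \<or> u \<in> subtrees t"
      using \<open>u \<in> subtrees v\<close> by (simp add: Node)
    ultimately show ?thesis
      using leaves_subtree[of u s] leaves_subtree[of u t] assms(4) by blast
  qed auto
qed

text \<open>A vertex is determined by its leaf set. Since \<sigma> preserves cardinalities, the
  vertices on both sides are either both internal or both leaves, and the latter contribute the
  singletons. Size at least 2 ensures that a singleton is not the full leaf set.\<close>

lemma proper_subs_clusters:
  assumes "is_tanglegram T" "tsize T \<ge> 2"
  shows "common_clusters T = (\<lambda>u. leaves u) ` fst ` proper_subs T \<union> (\<lambda>a. {a}) ` leaves (left_tree T)"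
proof -
  obtain L R \<sigma> where T: "T = (L, R, \<sigma>)" by (cases T)
  have wf: "wf_btree L" "wf_btree R" and bij: "bij_betw \<sigma> (leaves L) (leaves R)"
    using assms(1) by (auto simp: T)
  show ?thesis
  proof (intro equalityI subsetI)
    fix C assume C: "C \<in> common_clusters T"
    obtain u where u: "u \<in> subtrees L" "C = leaves u" and "C \<noteq> leaves L" and "\<sigma> ` C \<in> clusters R"
      using C by (auto simp: T clusters_def)
    then obtain v where v: "v \<in> subtrees R" "\<sigma> ` leaves u = leaves v"
      by (auto simp: clusters_def)
    have sub: "leaves u \<subseteq> leaves L" using u leaves_subtree by blast
    have inj: "inj_on \<sigma> (leaves L)" and im: "\<sigma> ` leaves L = leaves R" using bij by (auto simp: bij_betw_def)
    show "C \<in> (\<lambda>u. leaves u) ` fst ` proper_subs T \<union> (\<lambda>a. {a}) ` leaves (left_tree T)"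
    proof (cases "\<exists>a. u = Leaf a")
      case True
      then show ?thesis using u sub by (auto simp: T)
    next
      case False
      then have "card (leaves u) \<noteq> 1" using card_leaves_eq_1[of u] wf_subtree[OF wf(1) u(1)] by blast
      moreover have "card (leaves v) = card (leaves u)"
        using v(2) inj_on_subset[OF inj sub] card_image by metis
      ultimately have "\<not> (\<exists>a. v = Leaf a)" by auto
      then have vN: "\<exists>p. v = Node p" by (cases v) auto
      have uN: "\<exists>p. u = Node p" using False by (cases u) auto
      have "v \<noteq> R" using v(2) im inj sub u \<open>C \<noteq> leaves L\<close> by (metis inj_on_image_eq_iff subset_refl)
      then have "(u, v) \<in> proper_subs T"
        using u v uN vN \<open>C \<noteq> leaves L\<close> by (auto simp: T internal_nonroot_def)
      then show ?thesis unfolding u(2) by (force simp: image_iff)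
    qed
  next
    fix C assume "C \<in> (\<lambda>u. leaves u) ` fst ` proper_subs T \<union> (\<lambda>a. {a}) ` leaves (left_tree T)"
    then consider u v where "(u, v) \<in> proper_subs T" "C = leaves u" | a where "a \<in> leaves (left_tree T)" "C = {a}"
      by auto
    then show "C \<in> common_clusters T"
    proof cases
      case (1 u v)
      then have "u \<in> subtrees L" "u \<noteq> L" "v \<in> subtrees R" "\<sigma> ` leaves u = leaves v"
        by (auto simp: T internal_nonroot_def)
      then show ?thesis
        using subtree_eqI[OF wf(1), of u L] 1(2) by (auto simp: T clusters_def)
    qed (use singleton_in_common_clusters[OF assms] in auto)
  qed
qed

lemma irreducible_iff_common_clusters:
  assumes "is_tanglegram T" "tsize T \<ge> 2"
  shows "irreducible T \<longleftrightarrow> (\<forall>C\<in>common_clusters T. card C = 1)"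
proof -
  obtain L R \<sigma> where T: "T = (L, R, \<sigma>)" by (cases T)
  have card: "card (leaves u) \<noteq> 1" if uv: "(u, v) \<in> proper_subs T" for u v
  proof -
    have "u \<in> subtrees L" "\<exists>p. u = Node p"
      using uv by (auto simp: T internal_nonroot_def)
    moreover have "wf_btree L" using assms(1) by (simp add: T)
    ultimately show ?thesis using card_leaves_eq_1[of u] wf_subtree[of L u] by auto
  qed
  show ?thesis
  proof
    assume "irreducible T"
    then show "\<forall>C\<in>common_clusters T. card C = 1"
      unfolding proper_subs_clusters[OF assms] by (auto simp: irreducible_def)
  next
    assume all: "\<forall>C\<in>common_clusters T. card C = 1"
    have "(u, v) \<notin> proper_subs T" for u v
    proof
      assume uv: "(u, v) \<in> proper_subs T"
      then have "u \<in> fst ` proper_subs T" by (metis fst_conv imageI)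
      then have "leaves u \<in> common_clusters T"
        unfolding proper_subs_clusters[OF assms] by blast
      then show False using all card[OF uv] by blast
    qed
    then show "irreducible T" by (auto simp: irreducible_def)
  qed
qed

text \<open>The labels of the left tree of \<open>irr T\<close> are the maximal elements of the
  family \<open>?N\<close> of leaf sets at which contraction can stop. This family contains all
  parts and is contained in \<open>common_clusters T\<close>, hence has the same maximal elements as
  the latter.\<close>

lemma tsize_irr:
  assumes "is_tanglegram T" "tsize T \<ge> 2"
  shows "tsize (irr T) = card (parts T)"
proof -
  obtain L R \<sigma> where T: "T = (L, R, \<sigma>)" by (cases T)
  have wf: "wf_btree L" using assms(1) by (auto simp: T)
  let ?N = "leaves ` {u \<in> subtrees L. u \<in> fst ` maximal_subs T \<or> (\<exists>a. u = Leaf a)}"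
  have sub: "u \<in> subtrees L" if "(u, v) \<in> proper_subs T" for u v
    using that by (auto simp: T internal_nonroot_def)
  have NC: "?N \<subseteq> common_clusters T"
  proof
    fix C assume "C \<in> ?N"
    then obtain u where u: "u \<in> subtrees L" "C = leaves u" "u \<in> fst ` maximal_subs T \<or> (\<exists>a. u = Leaf a)"
      by auto
    from u(3) show "C \<in> common_clusters T"
    proof
      assume "u \<in> fst ` maximal_subs T"
      then have "u \<in> fst ` proper_subs T" by (auto simp: maximal_subs_def)
      then show ?thesis unfolding proper_subs_clusters[OF assms] u(2) by blast
    next
      assume "\<exists>a. u = Leaf a"
      then obtain a where "u = Leaf a" by blast
      then show ?thesis using singleton_in_common_clusters[OF assms, of a] leaves_subtree[OF u(1)] u(2) by (simp add: T)
    qed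
  qed
  have CN: "C \<in> ?N" if C: "C \<in> parts T" for C
  proof -
    have "C \<in> common_clusters T" using C by (simp add: parts_def maximal_sets_def)
    then consider u v where "(u, v) \<in> proper_subs T" "C = leaves u" | a where "a \<in> leaves L" "C = {a}"
      unfolding proper_subs_clusters[OF assms] by (auto simp: T)
    then show ?thesis
    proof cases
      case (1 u v)
      have "u' = u" if "(u', v') \<in> proper_subs T" "u \<in> subtrees u'" for u' v'
      proof -
        have "leaves u' \<in> common_clusters T"
          unfolding proper_subs_clusters[OF assms] using that(1) by force
        then have "leaves u' = leaves u"
          using C leaves_subtree[OF that(2)] by (auto simp: 1(2) parts_def maximal_sets_def)
        then show ?thesis using subtree_eqI[OF wf sub[OF that(1)] sub[OF 1(1)]] by blast
      qed
      then have "(u, v) \<in> maximal_subs T" using 1 by (auto simp: maximal_subs_def)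
      then show ?thesis using sub[OF 1(1)] 1(2) by force
    next
      case (2 a)
      then obtain w where "w \<in> subtrees L" "leaves w = {a}"
        using singleton_in_clusters[of a L] by (auto simp: clusters_def)
      moreover from this obtain b where "w = Leaf b"
        using card_leaves_eq_1[of w] wf_subtree[OF wf] by auto
      ultimately show ?thesis unfolding 2(2) by force
    qed
  qed
  have "maximal_sets ?N = parts T"
  proof (intro equalityI subsetI)
    fix C assume C: "C \<in> maximal_sets ?N"
    then have "C \<in> common_clusters T" using NC by (auto simp: maximal_sets_def)
    then obtain D where D: "D \<in> parts T" "C \<subseteq> D"
      unfolding parts_def by (rule maximal_sets_above[OF finite_common_clusters])
    then have "D = C" using CN[OF D(1)] C by (auto simp: maximal_sets_def)
    with D show "C \<in> parts T" by simp
  next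
    fix C assume C: "C \<in> parts T"
    then show "C \<in> maximal_sets ?N"
      using CN[OF C] NC by (auto simp: maximal_sets_def parts_def)
  qed
  then show ?thesis
    using leaves_contract[OF wf, of "fst ` maximal_subs T"] by (simp add: T)
qed

text \<open>A cluster of a substituted tree lies inside one block or is the union of the blocks over
  a cluster of the outer tree. If a common cluster lies in no block, both trees represent it in the
  second way, over the same set of positions; irreducibility of the outer pair then leaves only the
  full leaf set or a single block. So the blocks are the maximal common clusters.\<close>

lemma parts_subst:
  assumes "leaves a = leaves b" "irreducible_pair a b" "card (leaves a) \<ge> 2"
    and same: "\<And>i. i \<in> leaves a \<Longrightarrow> leaves (F i) = leaves (G i)"
    and disj: "\<And>i j. i \<in> leaves a \<Longrightarrow> j \<in> leaves a \<Longrightarrow> i \<noteq> j \<Longrightarrow> leaves (F i) \<inter> leaves (F j) = {}"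
  shows "parts (subst_leaves F a, subst_leaves G b, id) = (\<lambda>i. leaves (F i)) ` leaves a"
proof -
  let ?CC = "common_clusters (subst_leaves F a, subst_leaves G b, id)"
  let ?U = "\<lambda>C. \<Union>i\<in>C. leaves (F i)"
  have in_CC: "leaves (F i) \<in> ?CC" if i: "i \<in> leaves a" for i
  proof -
    \<comment> \<open>There is a second position, so that a block is not the full leaf set.\<close>
    have "\<not> leaves a \<subseteq> {i}"
      using assms(3) card_mono[of "{i}" "leaves a"] by auto
    then obtain j where j: "j \<in> leaves a" "j \<noteq> i" by blast
    then have "leaves (F j) \<subseteq> leaves (subst_leaves F a)" by (auto simp: leaves_subst)
    moreover have "leaves (F j) \<inter> leaves (F i) = {}" "leaves (F j) \<noteq> {}" using disj i j by auto
    ultimately have "leaves (F i) \<noteq> leaves (subst_leaves F a)" by blast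
    moreover have "leaves (F i) \<in> clusters (subst_leaves F a)"
      unfolding clusters_subst using i leaves_in_clusters by blast
    moreover have "leaves (F i) \<in> clusters (subst_leaves G b)"
      unfolding clusters_subst same[OF i] using i assms(1) leaves_in_clusters by blast
    ultimately show ?thesis by simp
  qed
  have CC: "\<exists>i\<in>leaves a. C \<subseteq> leaves (F i)" if "C \<in> ?CC" for C
  proof (rule ccontr)
    assume neg: "\<not> ?thesis"
    have C: "C \<in> clusters (subst_leaves F a)" "C \<in> clusters (subst_leaves G b)" "C \<noteq> ?U (leaves a)"
      using that by (auto simp: leaves_subst)
    have "C \<notin> clusters (F i)" if "i \<in> leaves a" for i
      using neg clusters_subset[of C "F i"] that by blast
    then obtain c where c: "c \<in> clusters a" "C = ?U c"
      using C(1) unfolding clusters_subst by blast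
    have "\<not> (\<exists>i\<in>leaves b. C \<in> clusters (G i))"
    proof
      assume "\<exists>i\<in>leaves b. C \<in> clusters (G i)"
      then obtain i where i: "i \<in> leaves b" "C \<in> clusters (G i)" by blast
      have "i \<in> leaves a" using i(1) assms(1) by simp
      moreover have "C \<subseteq> leaves (F i)"
        unfolding same[OF \<open>i \<in> leaves a\<close>] by (rule clusters_subset[OF i(2)])
      ultimately show False using neg by blast
    qed
    then obtain d where d: "d \<in> clusters b" "C = (\<Union>i\<in>d. leaves (G i))"
      using C(2) unfolding clusters_subst by auto
    have cd: "c \<subseteq> leaves a" "d \<subseteq> leaves a" 
      using clusters_subset[OF c(1)] clusters_subset[OF d(1)] assms(1) by simp_all
    then have "C = ?U d" unfolding d(2) using same by (intro SUP_cong) auto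
    \<comment> \<open>Blocks are nonempty and disjoint, so a union of blocks determines the set of
      positions over which it is taken.\<close>
    have sub: "x \<in> y" if xz: "x \<in> z" and U: "?U z \<subseteq> ?U y" and zy: "z \<subseteq> leaves a" "y \<subseteq> leaves a" for x y z
    proof -
      obtain e where e: "e \<in> leaves (F x)" using leaves_nonempty[of "F x"] by blast
      then obtain x' where x': "x' \<in> y" "e \<in> leaves (F x')" using xz U by blast
      have "x \<in> leaves a" "x' \<in> leaves a" using xz zy x' by blast+
      then have "x = x'" using disj[of x x'] e x'(2) by blast
      then show ?thesis using x'(1) by simp
    qed
    have U: "?U c \<subseteq> ?U d" "?U d \<subseteq> ?U c" using \<open>C = ?U d\<close> c(2) by simp_all
    have "c = d"
      using sub[OF _ U(1) cd] sub[OF _ U(2) cd(2) cd(1)] by (intro equalityI subsetI)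
    then have "c = leaves a \<or> card c = 1" using assms(2) c d by (auto simp: irreducible_pair_def)
    then show False
    proof
      assume "card c = 1"
      then obtain i where i: "c = {i}" by (rule card_1_singletonE)
      then have "C \<subseteq> leaves (F i)" "i \<in> leaves a" using c(2) cd by simp_all
      then show False using neg by blast
    qed (use C(3) c in auto)
  qed
  show ?thesis
  proof (intro equalityI subsetI)
    fix C assume C: "C \<in> parts (subst_leaves F a, subst_leaves G b, id)"
    then have "C \<in> ?CC" by (simp add: parts_def maximal_sets_def)
    then obtain i where i: "i \<in> leaves a" "C \<subseteq> leaves (F i)"
      using CC[of C] by blast
    then have "leaves (F i) = C"
      using C in_CC[OF i(1)] by (simp add: parts_def maximal_sets_def)
    then show "C \<in> (\<lambda>i. leaves (F i)) ` leaves a"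
      using i(1) by blast
  next
    fix C assume "C \<in> (\<lambda>i. leaves (F i)) ` leaves a"
    then obtain i where i: "i \<in> leaves a" "C = leaves (F i)" by auto
    have "D = C" if D: "D \<in> ?CC" "C \<subseteq> D" for D
    proof -
      obtain j where j: "j \<in> leaves a" "D \<subseteq> leaves (F j)" using CC[OF D(1)] by auto
      then have "i = j" using disj[of i j] i D(2) leaves_nonempty[of "F i"] by blast
      then show ?thesis using j i D by blast
    qed
    then show "C \<in> parts (subst_leaves F a, subst_leaves G b, id)"
      using in_CC[OF i(1)] i(2) by (simp add: parts_def maximal_sets_def)
  qed
qed

section \<open>Layouts\<close>

lemma leaf_list_number_leaves [simp]: "leaf_list (number_leaves m P) = [m..<m + length (leaf_list P)]"
proof (induction P arbitrary: m)
  case (PNode l r)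
  then show ?case
    using upt_add_eq_append[of m "m + length (leaf_list l)" "length (leaf_list r)"]
    by (simp add: add.assoc del: upt_Suc)
qed simp

lemma shape_simps [simp]:
  "shape (PLeaf a) = PLeaf ()" "shape (PNode l r) = PNode (shape l) (shape r)"
  by (simp_all add: shape_def)

lemma shape_unit [simp]: "shape (P :: unit ptree) = P"
  by (induction P) auto

lemma shape_number_leaves [simp]: "shape (number_leaves m P) = shape P"
  by (induction P arbitrary: m) auto

lemma shape_map_ptree [simp]: "shape (map_ptree f P) = shape P"
  by (induction P) auto

lemma shape_mirror: "shape (mirror P) = mirror (shape P)"
  by (induction P) auto

lemma length_leaf_list_shape [simp]: "length (leaf_list (shape P)) = length (leaf_list P)"
  by (induction P) auto

text \<open>Labels are a function of the position, so every plane tree is a relabelling of its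
  numbered shape. The offset m is there for the induction: the numbering of the lower child starts
  after the leaves of the upper one.\<close>

lemma map_number_leaves_shape:
  assumes "\<And>i. i < length (leaf_list P) \<Longrightarrow> f (m + i) = leaf_list P ! i"
  shows "map_ptree f (number_leaves m (shape P)) = P"
  using assms
proof (induction P arbitrary: m)
  case (PLeaf a)
  then show ?case using PLeaf[of 0] by simp
next
  case (PNode l r)
  have "map_ptree f (number_leaves m (shape l)) = l"
  proof (rule PNode.IH(1))
    fix i assume "i < length (leaf_list l)"
    then show "f (m + i) = leaf_list l ! i" using PNode.prems[of i] by (simp add: nth_append)
  qed
  moreover have "map_ptree f (number_leaves (m + length (leaf_list l)) (shape r)) = r"
  proof (rule PNode.IH(2))
    fix i assume "i < length (leaf_list r)"
    then show "f (m + length (leaf_list l) + i) = leaf_list r ! i"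
      using PNode.prems[of "length (leaf_list l) + i"] by (simp add: nth_append add.assoc)
  qed
  ultimately show ?case by simp
qed

lemma number_leaves_shape_eq:
  assumes "leaf_list P = [0..<n]"
  shows "number_leaves 0 (shape P) = P"
proof -
  have "map_ptree id (number_leaves 0 (shape P)) = P"
    by (rule map_number_leaves_shape) (simp add: assms)
  then show ?thesis by (simp add: ptree.map_id)
qed

lemma number_leaves_mirror:
  fixes P :: "unit ptree"
  assumes "length (leaf_list P) = k"
  shows "number_leaves 0 (mirror P) = map_ptree (\<lambda>i. k - 1 - i) (mirror (number_leaves 0 P))"
    (is "_ = ?P")
proof -
  have "leaf_list ?P = [0..<k]"
    using assms by (intro nth_equalityI) (auto simp: rev_nth)
  from number_leaves_shape_eq[OF this] show ?thesis by (simp add: shape_mirror)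
qed

text \<open>Normal form of a planar drawing: matched leaves carry the same label, so that the
  absence of crossings becomes equality of the two leaf lists (with distinct entries).\<close>

definition matched :: "'a ptree \<Rightarrow> 'a ptree \<Rightarrow> 'a tgram" where
  "matched P Q = (forget P, forget Q, id)"

definition valid_layouts :: "nat \<Rightarrow> layout set" where
  "valid_layouts n = {(A, B). length (leaf_list A) = n \<and> length (leaf_list B) = n}"

definition layout_tgram :: "layout \<Rightarrow> nat tgram" where
  "layout_tgram lay = matched (number_leaves 0 (fst lay)) (number_leaves 0 (snd lay))"

lemma is_tanglegram_matched:
  assumes "distinct (leaf_list P)" "leaf_list P = leaf_list Q"
  shows "is_tanglegram (matched P Q)"
  using assms by (simp add: matched_def)

lemma is_tanglegram_layout_tgram: "lay \<in> valid_layouts n \<Longrightarrow> is_tanglegram (layout_tgram lay)"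
  unfolding layout_tgram_def by (rule is_tanglegram_matched) (auto simp: valid_layouts_def)

lemma tsize_layout_tgram: "lay \<in> valid_layouts n \<Longrightarrow> tsize (layout_tgram lay) = n"
  by (auto simp: layout_tgram_def matched_def valid_layouts_def)

text \<open>Let \<pi> i be the position on the right of the partner of the i-th leaf on the left.
  Without crossings \<pi> is strictly increasing, and a strictly increasing map from {0..<n} to
  itself is the identity.\<close>

lemma noncrossing_imp_leaf_lists_eq:
  assumes "distinct xs" "distinct ys" "bij_betw \<sigma> (set xs) (set ys)" "\<not> crossing \<sigma> xs ys"
  shows "ys = map \<sigma> xs"
proof -
  define n where "n = length xs"
  have len: "length ys = n"
    using bij_betw_same_card[OF assms(3)] assms(1,2) by (simp add: distinct_card n_def)
  have "\<exists>p. p < n \<and> ys ! p = \<sigma> (xs ! i)" if "i < n" for i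
  proof -
    have "\<sigma> (xs ! i) \<in> set ys"
      using that assms(3) nth_mem[of i xs] by (auto simp: bij_betw_def n_def)
    then show ?thesis by (auto simp: in_set_conv_nth len)
  qed
  then obtain \<pi> where \<pi>: "\<And>i. i < n \<Longrightarrow> \<pi> i < n \<and> ys ! \<pi> i = \<sigma> (xs ! i)" by metis
  have mono: "\<pi> i < \<pi> j" if "i < j" "j < n" for i j
  proof (rule ccontr)
    assume "\<not> \<pi> i < \<pi> j"
    then consider "\<pi> j < \<pi> i" | "\<pi> i = \<pi> j" by linarith
    then show False
    proof cases
      case 1
      then have "crossing \<sigma> xs ys"
        unfolding crossing_def using that \<pi>[of i] \<pi>[of j] len
        by (intro exI[of _ i] exI[of _ j] exI[of _ "\<pi> j"] exI[of _ "\<pi> i"]) (simp add: n_def)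
      with assms(4) show False ..
    next
      case 2
      then have "\<sigma> (xs ! i) = \<sigma> (xs ! j)" using \<pi>[of i] \<pi>[of j] that by simp
      then have "xs ! i = xs ! j"
        using assms(3) that by (auto simp: bij_betw_def n_def dest!: inj_onD)
      then show False using assms(1) that by (simp add: nth_eq_iff_index_eq n_def)
    qed
  qed
  have d: "sorted_wrt (<) (map \<pi> [0..<n])"
    by (auto simp: sorted_wrt_iff_nth_less intro: mono)
  moreover have "set (map \<pi> [0..<n]) = {0..<n}"
  proof (rule card_subset_eq)
    show "card (set (map \<pi> [0..<n])) = card {0..<n}"
      using d by (subst distinct_card) (auto simp: strict_sorted_iff)
  qed (use \<pi> in auto)
  ultimately have "map \<pi> [0..<n] = [0..<n]"
    using strict_sorted_equal[of "map \<pi> [0..<n]" "[0..<n]"] by simp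
  then have "\<pi> i = i" if "i < n" for i
    using that by (metis add_0 length_upt minus_nat.diff_0 nth_map nth_upt)
  then show ?thesis
    using \<pi> len by (intro nth_equalityI) (auto simp: n_def)
qed

text \<open>The isomorphism sends position i to the i-th leaf on either side; it respects the
  matchings because the right leaf list is the image of the left one under \<sigma>.\<close>

lemma planar_layout_iso:
  assumes "is_tanglegram T" "is_planar_layout T (P, Q)"
  shows "(shape P, shape Q) \<in> valid_layouts (tsize T)"
    and "iso_tgram (layout_tgram (shape P, shape Q)) T"
proof -
  obtain L R \<sigma> where T: "T = (L, R, \<sigma>)" by (cases T)
  have PQ: "L = forget P" "R = forget Q" and "\<not> crossing \<sigma> (leaf_list P) (leaf_list Q)"
    using assms(2) by (auto simp: T)
  moreover have d: "distinct (leaf_list P)" "distinct (leaf_list Q)"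
      and "bij_betw \<sigma> (set (leaf_list P)) (set (leaf_list Q))"
    using assms(1) by (auto simp: T PQ)
  ultimately have eq: "leaf_list Q = map \<sigma> (leaf_list P)"
    by (intro noncrossing_imp_leaf_lists_eq)
  then have len: "length (leaf_list Q) = length (leaf_list P)" by simp
  show "(shape P, shape Q) \<in> valid_layouts (tsize T)"
    using d len by (simp add: valid_layouts_def T PQ distinct_card)
  have "map_ptree ((!) (leaf_list P)) (number_leaves 0 (shape P)) = P"
       "map_ptree ((!) (leaf_list Q)) (number_leaves 0 (shape Q)) = Q"
    by (rule map_number_leaves_shape, simp)+
  then have *: "map_btree ((!) (leaf_list P)) (forget (number_leaves 0 (shape P))) = forget P"
     "map_btree ((!) (leaf_list Q)) (forget (number_leaves 0 (shape Q))) = forget Q"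
    by (metis forget_map_ptree)+
  show "iso_tgram (layout_tgram (shape P, shape Q)) T"
    unfolding layout_tgram_def matched_def T PQ iso_tgram.simps fst_conv snd_conv
  proof (intro exI conjI ballI)
    show "inj_on ((!) (leaf_list P)) (leaves (forget (number_leaves 0 (shape P))))"
         "inj_on ((!) (leaf_list Q)) (leaves (forget (number_leaves 0 (shape Q))))"
      using d by (auto intro!: inj_on_nth)
    show "\<sigma> (leaf_list P ! i) = leaf_list Q ! id i" if "i \<in> leaves (forget (number_leaves 0 (shape P)))" for i
      using that by (simp add: eq)
  qed (rule *)+
qed

lemma is_planar_layout_matched:
  assumes "distinct (leaf_list P)" "leaf_list P = leaf_list Q"
  shows "is_planar_layout (matched P Q) (P, Q)"
proof -
  have "\<not> crossing id (leaf_list P) (leaf_list P)"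
    unfolding crossing_def using assms(1) by (auto simp: nth_eq_iff_index_eq)
  then show ?thesis using assms(2) by (simp add: matched_def)
qed

lemma matched_iso_layout_tgram:
  assumes "distinct (leaf_list P)" "leaf_list P = leaf_list Q"
  shows "(shape P, shape Q) \<in> valid_layouts (length (leaf_list P))"
    and "iso_tgram (layout_tgram (shape P, shape Q)) (matched P Q)"
  using planar_layout_iso[OF is_tanglegram_matched[OF assms] is_planar_layout_matched[OF assms]] assms
  by (simp_all add: matched_def distinct_card)

lemma is_planar_layout_layout_tgram:
  assumes "(A, B) \<in> valid_layouts n"
  shows "is_planar_layout (layout_tgram (A, B)) (number_leaves 0 A, number_leaves 0 B)"
  using assms unfolding layout_tgram_def fst_conv snd_conv
  by (intro is_planar_layout_matched) (auto simp: valid_layouts_def)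

lemma planar_layout_tgram: "lay \<in> valid_layouts n \<Longrightarrow> planar (layout_tgram lay)"
  using is_planar_layout_layout_tgram unfolding planar_def by (metis prod.exhaust)

section \<open>Isomorphism classes of layouts; irreducible layouts\<close>

definition layout_class :: "layout \<Rightarrow> tclass" where
  "layout_class lay = iso_class (layout_tgram lay)"

lemma planar_imp_layout_class:
  assumes "is_tanglegram T" "planar T" 
  obtains lay where "lay \<in> valid_layouts (tsize T)" "iso_tgram (layout_tgram lay) T" "iso_class T = layout_class lay"
proof -
  obtain P Q where "is_planar_layout T (P, Q)" using assms(2) by (auto simp: planar_def)
  note * = planar_layout_iso[OF assms(1) this]
  have "layout_class (shape P, shape Q) = iso_class T"
    unfolding layout_class_def by (rule iso_class_cong[OF is_tanglegram_layout_tgram[OF *(1)] *(2)])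
  from that[OF *(1) *(2) this[symmetric]] show ?thesis .
qed

text \<open>From here on, planar tanglegrams are accessed through unlabelled layouts. As these are
  finite in number for each size, so are the classes.\<close>

lemma planar_tanglegrams_eq: "planar_tanglegrams n = layout_class ` valid_layouts n"
proof (intro equalityI subsetI)
  fix c assume "c \<in> planar_tanglegrams n"
  then obtain T :: "nat tgram" where T: "c = iso_class T" "is_tanglegram T" "planar T" "tsize T = n"
    by (auto simp: planar_tanglegrams_def)
  obtain lay where "lay \<in> valid_layouts n" "iso_class T = layout_class lay"
    using planar_imp_layout_class[OF T(2,3)] T(4) by metis
  then show "c \<in> layout_class ` valid_layouts n" using T(1) by blast
next
  fix c assume "c \<in> layout_class ` valid_layouts n"
  then obtain lay where lay: "lay \<in> valid_layouts n" "c = layout_class lay" by blast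
  show "c \<in> planar_tanglegrams n"
    unfolding planar_tanglegrams_def lay(2) layout_class_def
    using is_tanglegram_layout_tgram[OF lay(1)] planar_layout_tgram[OF lay(1)] tsize_layout_tgram[OF lay(1)]
    by blast
qed

lemma irreducible_iso:
  assumes "is_tanglegram T" "iso_tgram T T'" "tsize T \<ge> 2"
  shows "irreducible T' \<longleftrightarrow> irreducible T"
proof -
  obtain f where f: "inj_on f (leaves (left_tree T))" "common_clusters T' = image f ` common_clusters T"
    using common_clusters_isoE[OF assms(1,2)] .
  have "card (f ` C) = card C" if "C \<in> common_clusters T" for C
    by (rule card_image[OF inj_on_subset[OF f(1) common_clusters_subset[OF that]]])
  moreover have "tsize T' \<ge> 2" using assms(3) tsize_iso[OF assms(2)] by simp
  ultimately show ?thesis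
    using irreducible_iff_common_clusters[OF assms(1,3)]
      irreducible_iff_common_clusters[OF is_tanglegram_iso[OF assms(1,2)]]
    by (simp add: f(2))
qed

lemma irreducible_matched_iff:
  assumes "distinct (leaf_list P)" "leaf_list P = leaf_list Q" "length (leaf_list P) \<ge> 2"
  shows "irreducible (matched P Q) \<longleftrightarrow> irreducible_pair (forget P) (forget Q)"
proof -
  have "tsize (matched P Q) \<ge> 2" using assms by (simp add: matched_def distinct_card)
  from irreducible_iff_common_clusters[OF is_tanglegram_matched[OF assms(1,2)] this]
  show ?thesis by (auto simp: matched_def irreducible_pair_def)
qed

lemma irreducible_layout_tgram_iff:
  assumes "(A, B) \<in> valid_layouts k" "k \<ge> 2"
  shows "irreducible (layout_tgram (A, B)) \<longleftrightarrow>
         irreducible_pair (forget (number_leaves 0 A)) (forget (number_leaves 0 B))"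
  using assms unfolding layout_tgram_def fst_conv snd_conv
  by (intro irreducible_matched_iff) (auto simp: valid_layouts_def)

text \<open>The defining union ranges over all labelled tanglegrams, but irreducibility is invariant
  under isomorphism and can be tested on the copy labelled by positions.\<close>

lemma irreducible_layouts_eq:
  assumes "k \<ge> 2"
  shows "irreducible_layouts k = {lay \<in> valid_layouts k. irreducible (layout_tgram lay)}"
proof (intro equalityI subsetI)
  fix lay assume "lay \<in> irreducible_layouts k"
  then obtain T :: "nat tgram" and P Q where T: "is_tanglegram T" "irreducible T" "tsize T = k"
      "is_planar_layout T (P, Q)" "lay = (shape P, shape Q)"
    by (auto simp: irreducible_layouts_def planar_layouts_def)
  note * = planar_layout_iso[OF T(1,4)]
  have "irreducible (layout_tgram lay)"
    using irreducible_iso[OF is_tanglegram_layout_tgram[OF *(1)] *(2)] T(2,3) assms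
      tsize_layout_tgram[OF *(1)] by (simp add: T(5))
  then show "lay \<in> {lay \<in> valid_layouts k. irreducible (layout_tgram lay)}"
    using *(1) T by simp
next
  fix lay assume "lay \<in> {lay \<in> valid_layouts k. irreducible (layout_tgram lay)}"
  then obtain A B where lay: "lay = (A, B)" "(A, B) \<in> valid_layouts k" "irreducible (layout_tgram (A, B))"
    by (cases lay) auto
  have "(shape (number_leaves 0 A), shape (number_leaves 0 B)) \<in> planar_layouts (layout_tgram (A, B))"
    unfolding planar_layouts_def using is_planar_layout_layout_tgram[OF lay(2)] by blast
  then have "lay \<in> planar_layouts (layout_tgram (A, B))" by (simp add: lay(1))
  then show "lay \<in> irreducible_layouts k"
    unfolding irreducible_layouts_def
    using lay(3) is_tanglegram_layout_tgram[OF lay(2)] planar_layout_tgram[OF lay(2)] tsize_layout_tgram[OF lay(2)]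
    by blast
qed

section \<open>Replacing matched leaf pairs\<close>

primrec subst_ptree :: "('a \<Rightarrow> 'b ptree) \<Rightarrow> 'a ptree \<Rightarrow> 'b ptree" where
  "subst_ptree F (PLeaf a) = F a"
| "subst_ptree F (PNode l r) = PNode (subst_ptree F l) (subst_ptree F r)"

lemma forget_subst_ptree: "forget (subst_ptree F P) = subst_leaves (\<lambda>i. forget (F i)) (forget P)"
  by (induction P) auto

lemma leaf_list_subst_ptree:
  "leaf_list (subst_ptree F P) = concat (map (\<lambda>i. leaf_list (F i)) (leaf_list P))"
  by (induction P) auto

lemma inj_on_blocks:
  assumes "\<And>i. i \<in> I \<Longrightarrow> inj_on (f i) (S i)"
  shows "inj_on (\<lambda>(i, x). (i, f i x)) (\<Union>i\<in>I. Pair i ` S i)"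
  using assms by (auto simp: inj_on_def)

lemma leaves_replace:
  "leaves (subst_leaves (\<lambda>i. map_btree (Pair i) (F i)) t) = (\<Union>i\<in>leaves t. Pair i ` leaves (F i))"
  by (simp add: leaves_subst btree.set_map)

text \<open>Isomorphisms of the pieces are glued to (i, x) \<mapsto> (i, f i x); the tag i keeps the
  map injective. Thus the representatives picked in \<open>replace_class\<close> may be exchanged
  for tanglegrams labelled by positions.\<close>

lemma replace_pairs_iso:
  assumes "lay \<in> valid_layouts k" "\<And>i. i < k \<Longrightarrow> iso_tgram (Ts i) (Ts' i)"
  shows "iso_tgram (replace_pairs lay Ts) (replace_pairs lay Ts')"
proof -
  obtain A B where lay: "lay = (A, B)" by (cases lay)
  have len: "length (leaf_list A) = k" "length (leaf_list B) = k"
    using assms(1) by (simp_all add: lay valid_layouts_def)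
  have "\<exists>f g. inj_on f (leaves (left_tree (Ts i))) \<and> map_btree f (left_tree (Ts i)) = left_tree (Ts' i) \<and>
      inj_on g (leaves (right_tree (Ts i))) \<and> map_btree g (right_tree (Ts i)) = right_tree (Ts' i) \<and>
      (\<forall>a\<in>leaves (left_tree (Ts i)). matching (Ts' i) (f a) = g (matching (Ts i) a))" if "i < k" for i
    using assms(2)[OF that] by (cases "Ts i"; cases "Ts' i") simp
  then obtain f g where fg: "\<And>i. i < k \<Longrightarrow> inj_on (f i) (leaves (left_tree (Ts i))) \<and>
      map_btree (f i) (left_tree (Ts i)) = left_tree (Ts' i) \<and>
      inj_on (g i) (leaves (right_tree (Ts i))) \<and> map_btree (g i) (right_tree (Ts i)) = right_tree (Ts' i) \<and>
      (\<forall>a\<in>leaves (left_tree (Ts i)). matching (Ts' i) (f i a) = g i (matching (Ts i) a))"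
    by metis
  have map_blocks: "map_btree (\<lambda>(i, x). (i, h i x)) (map_btree (Pair j) t) = map_btree (Pair j) (map_btree (h j) t)"
    for h :: "nat \<Rightarrow> 'a \<Rightarrow> 'b" and j t
    unfolding btree.map_comp by (simp add: comp_def)
  show ?thesis
    unfolding lay replace_pairs.simps iso_tgram.simps leaves_replace
  proof (rule exI[of _ "\<lambda>(i, x). (i, f i x)"], rule exI[of _ "\<lambda>(i, x). (i, g i x)"], intro conjI)
    show "inj_on (\<lambda>(i, x). (i, f i x)) (\<Union>i\<in>leaves (forget (number_leaves 0 A)). Pair i ` leaves (left_tree (Ts i)))"
         "inj_on (\<lambda>(i, x). (i, g i x)) (\<Union>i\<in>leaves (forget (number_leaves 0 B)). Pair i ` leaves (right_tree (Ts i)))"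
      by (rule inj_on_blocks; use fg len in simp)+
    show "map_btree (\<lambda>(i, x). (i, f i x)) (subst_leaves (\<lambda>i. map_btree (Pair i) (left_tree (Ts i))) (forget (number_leaves 0 A))) =
        subst_leaves (\<lambda>i. map_btree (Pair i) (left_tree (Ts' i))) (forget (number_leaves 0 A))"
      unfolding map_subst_leaves map_blocks by (rule subst_leaves_cong) (use fg len in simp)
    show "map_btree (\<lambda>(i, x). (i, g i x)) (subst_leaves (\<lambda>i. map_btree (Pair i) (right_tree (Ts i))) (forget (number_leaves 0 B))) =
        subst_leaves (\<lambda>i. map_btree (Pair i) (right_tree (Ts' i))) (forget (number_leaves 0 B))"
      unfolding map_subst_leaves map_blocks by (rule subst_leaves_cong) (use fg len in simp)
  qed (use fg len in auto)
qed

text \<open>One side of \<open>replace_pairs\<close> as a drawing: if the pieces are given by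
  layouts, the result inherits a layout from them.\<close>

definition replace_ptree :: "unit ptree \<Rightarrow> (nat \<Rightarrow> unit ptree) \<Rightarrow> (nat \<times> nat) ptree" where
  "replace_ptree A X = subst_ptree (\<lambda>i. map_ptree (Pair i) (number_leaves 0 (X i))) (number_leaves 0 A)"

lemma replace_pairs_layout_tgram:
  "replace_pairs (A, B) (\<lambda>i. layout_tgram (X i)) =
     matched (replace_ptree A (\<lambda>i. fst (X i))) (replace_ptree B (\<lambda>i. snd (X i)))"
  by (simp add: layout_tgram_def matched_def replace_ptree_def forget_subst_ptree fun_eq_iff)

lemma leaf_list_replace_ptree:
  "leaf_list (replace_ptree A X) =
     concat (map (\<lambda>i. map (Pair i) [0..<length (leaf_list (X i))]) [0..<length (leaf_list A)])"
  by (simp add: replace_ptree_def leaf_list_subst_ptree)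

lemma distinct_blocks: "distinct (concat (map (\<lambda>i. map (Pair i) [0..<a i]) [0..<k]))"
  by (induction k) (auto simp: distinct_map inj_on_def)

lemma length_blocks: "length (concat (map (\<lambda>i. map (Pair i) [0..<a i]) [0..<k])) = (\<Sum>i<k. a i)"
  by (induction k) auto

text \<open>On both sides the leaves are the pairs (i, x) with i < k and x < a i in lexicographic
  order, since the i-th pieces on the left and on the right have the same number a i of
  leaves.\<close>

lemma replace_layouts:
  assumes "(A, B) \<in> valid_layouts k" "\<And>i. i < k \<Longrightarrow> X i \<in> valid_layouts (a i)"
  shows "leaf_list (replace_ptree A (\<lambda>i. fst (X i))) = leaf_list (replace_ptree B (\<lambda>i. snd (X i)))"
    and "distinct (leaf_list (replace_ptree A (\<lambda>i. fst (X i))))"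
    and "length (leaf_list (replace_ptree A (\<lambda>i. fst (X i)))) = (\<Sum>i<k. a i)"
proof -
  have len: "length (leaf_list A) = k" "length (leaf_list B) = k"
    using assms(1) by (simp_all add: valid_layouts_def)
  have a: "length (leaf_list (fst (X i))) = a i" "length (leaf_list (snd (X i))) = a i" if "i < k" for i
    using assms(2)[OF that] by (auto simp: valid_layouts_def)
  have *: "leaf_list (replace_ptree A (\<lambda>i. fst (X i))) = concat (map (\<lambda>i. map (Pair i) [0..<a i]) [0..<k])"
    unfolding leaf_list_replace_ptree len by (intro arg_cong[where f = concat] map_cong refl) (simp add: a)
  have **: "leaf_list (replace_ptree B (\<lambda>i. snd (X i))) = concat (map (\<lambda>i. map (Pair i) [0..<a i]) [0..<k])"
    unfolding leaf_list_replace_ptree len by (intro arg_cong[where f = concat] map_cong refl) (simp add: a)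
  show "leaf_list (replace_ptree A (\<lambda>i. fst (X i))) = leaf_list (replace_ptree B (\<lambda>i. snd (X i)))"
    by (simp only: * **)
  show "distinct (leaf_list (replace_ptree A (\<lambda>i. fst (X i))))"
    unfolding * by (rule distinct_blocks)
  show "length (leaf_list (replace_ptree A (\<lambda>i. fst (X i)))) = (\<Sum>i<k. a i)"
    unfolding * by (rule length_blocks)
qed

lemma parts_replace:
  assumes lay: "(A, B) \<in> valid_layouts k" and X: "\<And>i. i < k \<Longrightarrow> X i \<in> valid_layouts (a i)"
    and irr: "irreducible (layout_tgram (A, B))" and k: "k \<ge> 2"
  shows "parts (replace_pairs (A, B) (\<lambda>i. layout_tgram (X i))) = (\<lambda>i. Pair i ` {..<a i}) ` {..<k}"
proof -
  have len: "length (leaf_list A) = k" "length (leaf_list B) = k"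
    using lay by (simp_all add: valid_layouts_def)
  have a: "length (leaf_list (fst (X i))) = a i" "length (leaf_list (snd (X i))) = a i" if "i < k" for i
    using X[OF that] by (auto simp: valid_layouts_def)
  have "parts (replace_pairs (A, B) (\<lambda>i. layout_tgram (X i))) =
    (\<lambda>i. leaves (forget (map_ptree (Pair i) (number_leaves 0 (fst (X i)))))) ` leaves (forget (number_leaves 0 A))"
    unfolding replace_pairs_layout_tgram matched_def replace_ptree_def forget_subst_ptree
  proof (rule parts_subst)
    show "irreducible_pair (forget (number_leaves 0 A)) (forget (number_leaves 0 B))"
      using irr irreducible_layout_tgram_iff[OF lay k] by blast
  qed (use len a k in \<open>auto simp: btree.set_map\<close>)
  also have "\<dots> = (\<lambda>i. Pair i ` {..<a i}) ` {..<k}"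
    using len a by (auto simp: image_iff atLeast0LessThan btree.set_map)
  finally show ?thesis .
qed

lemma is_tanglegram_replace:
  assumes "lay \<in> valid_layouts k" "\<And>i. i < k \<Longrightarrow> X i \<in> valid_layouts (a i)"
  shows "is_tanglegram (replace_pairs lay (\<lambda>i. layout_tgram (X i)))"
proof -
  obtain A B where lay: "lay = (A, B)" by (cases lay)
  show ?thesis
    unfolding lay replace_pairs_layout_tgram
    using replace_layouts[where X = X and a = a, OF assms(1)[unfolded lay] assms(2)] by (intro is_tanglegram_matched)
qed

lemma tsize_replace:
  assumes "lay \<in> valid_layouts k" "\<And>i. i < k \<Longrightarrow> X i \<in> valid_layouts (a i)"
  shows "tsize (replace_pairs lay (\<lambda>i. layout_tgram (X i))) = (\<Sum>i<k. a i)"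
proof -
  obtain A B where lay: "lay = (A, B)" by (cases lay)
  note * = replace_layouts[where X = X and a = a, OF assms(1)[unfolded lay] assms(2)]
  show ?thesis
    unfolding lay replace_pairs_layout_tgram using *(2,3) by (simp add: matched_def distinct_card)
qed

lemma replace_class_eq:
  assumes "lay \<in> valid_layouts k" "\<And>i. i < k \<Longrightarrow> X i \<in> valid_layouts (a i)"
    and "\<And>i. i < k \<Longrightarrow> Ts i = layout_class (X i)"
  shows "replace_class lay Ts = iso_class (replace_pairs lay (\<lambda>i. layout_tgram (X i)))"
proof -
  have "iso_tgram (layout_tgram (X i)) (SOME T. T \<in> Ts i)" if "i < k" for i
  proof -
    have tg: "is_tanglegram (layout_tgram (X i))"
      using is_tanglegram_layout_tgram[OF assms(2)[OF that]] .
    then have "(SOME T. T \<in> Ts i) \<in> iso_class (layout_tgram (X i))"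
      unfolding assms(3)[OF that] layout_class_def some_in_eq by (rule iso_class_nonempty)
    then show ?thesis by (rule iso_class_memD(2)[OF tg])
  qed
  from replace_pairs_iso[OF assms(1) this] show ?thesis
    unfolding replace_class_def
    by (intro iso_class_cong[symmetric] is_tanglegram_replace[where X = X and a = a, OF assms(1,2)])
qed

text \<open>The assembled drawing has no crossings, and passing to its shape yields a layout of the
  result. This is where planarity of the output comes from.\<close>

lemma replace_in_planar:
  assumes "lay \<in> valid_layouts k" "\<And>i. i < k \<Longrightarrow> X i \<in> valid_layouts (a i)"
  obtains lay' where "lay' \<in> valid_layouts (\<Sum>i<k. a i)"
    and "iso_tgram (layout_tgram lay') (replace_pairs lay (\<lambda>i. layout_tgram (X i)))"
    and "iso_class (replace_pairs lay (\<lambda>i. layout_tgram (X i))) = layout_class lay'"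
proof -
  obtain A B where lay: "lay = (A, B)" by (cases lay)
  note * = replace_layouts[where X = X and a = a, OF assms(1)[unfolded lay] assms(2)]
  note ** = matched_iso_layout_tgram[OF *(2) *(1)]
  show ?thesis
  proof (rule that)
    show "(shape (replace_ptree A (\<lambda>i. fst (X i))), shape (replace_ptree B (\<lambda>i. snd (X i)))) \<in> valid_layouts (\<Sum>i<k. a i)"
      using **(1) *(3) by simp
    then show "iso_class (replace_pairs lay (\<lambda>i. layout_tgram (X i))) =
        layout_class (shape (replace_ptree A (\<lambda>i. fst (X i))), shape (replace_ptree B (\<lambda>i. snd (X i))))"
      unfolding lay replace_pairs_layout_tgram layout_class_def
      by (intro iso_class_cong[symmetric] **(2) is_tanglegram_layout_tgram)
  qed (unfold lay replace_pairs_layout_tgram, rule **(2))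
qed

text \<open>The set counted by \<open>num_planar_irr n k\<close> for n \<ge> 2. The size of the
  contraction is expressed by the number of parts, and only layouts are taken as
  representatives.\<close>

definition planar_irr_classes :: "nat \<Rightarrow> nat \<Rightarrow> tclass set" where
  "planar_irr_classes n k = {layout_class lay | lay. lay \<in> valid_layouts n \<and> card (parts (layout_tgram lay)) = k}"

lemma planar_irr_classes_eq:
  assumes "n \<ge> 2"
  shows "{iso_class T | T :: nat tgram. is_tanglegram T \<and> planar T \<and> tsize T = n \<and> tsize (irr T) = k} =
         planar_irr_classes n k"
proof (intro equalityI subsetI)
  fix c assume "c \<in> {iso_class T | T :: nat tgram. is_tanglegram T \<and> planar T \<and> tsize T = n \<and> tsize (irr T) = k}"
  then obtain T :: "nat tgram" where T: "c = iso_class T" "is_tanglegram T" "planar T" "tsize T = n" "tsize (irr T) = k"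
    by blast
  obtain lay where lay: "lay \<in> valid_layouts n" "iso_tgram (layout_tgram lay) T" "iso_class T = layout_class lay"
    using planar_imp_layout_class[OF T(2,3)] T(4) by metis
  have "card (parts (layout_tgram lay)) = k"
    using card_parts_iso[OF is_tanglegram_layout_tgram[OF lay(1)] lay(2)] tsize_irr[OF T(2)] T(4,5) assms by simp
  then show "c \<in> planar_irr_classes n k"
    unfolding planar_irr_classes_def using lay T(1) by blast
next
  fix c assume "c \<in> planar_irr_classes n k"
  then obtain lay where lay: "c = layout_class lay" "lay \<in> valid_layouts n" "card (parts (layout_tgram lay)) = k"
    by (auto simp: planar_irr_classes_def)
  have "tsize (irr (layout_tgram lay)) = k"
    using tsize_irr[OF is_tanglegram_layout_tgram[OF lay(2)]] tsize_layout_tgram[OF lay(2)] lay(3) assms by simp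
  then show "c \<in> {iso_class T | T :: nat tgram. is_tanglegram T \<and> planar T \<and> tsize T = n \<and> tsize (irr T) = k}"
    unfolding lay(1) layout_class_def
    using is_tanglegram_layout_tgram[OF lay(2)] planar_layout_tgram[OF lay(2)] tsize_layout_tgram[OF lay(2)]
    by blast
qed

lemma planar_irr_classes_disjoint:
  assumes "c \<in> planar_irr_classes n k" "c \<in> planar_irr_classes n k'"
  shows "k = k'"
proof -
  obtain lay lay' where lay: "lay \<in> valid_layouts n" "c = layout_class lay" "card (parts (layout_tgram lay)) = k"
    and lay': "lay' \<in> valid_layouts n" "c = layout_class lay'" "card (parts (layout_tgram lay')) = k'"
    using assms by (auto simp: planar_irr_classes_def)
  have "iso_tgram (layout_tgram lay) (layout_tgram lay')"
    using iso_class_eq_iff[OF is_tanglegram_layout_tgram[OF lay(1)] is_tanglegram_layout_tgram[OF lay'(1)]] lay(2) lay'(2)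
    by (simp add: layout_class_def)
  then show ?thesis
    using card_parts_iso[OF is_tanglegram_layout_tgram[OF lay(1)]] lay(3) lay'(3) by metis
qed

lemma leaf_list_pos: "lay \<in> valid_layouts n \<Longrightarrow> n > 0"
  unfolding valid_layouts_def by auto

lemma replace_class_in_planar_irr_classes:
  assumes lay: "lay \<in> valid_layouts k" and irr: "irreducible (layout_tgram lay)" and k: "k \<ge> 2"
    and X: "\<And>i. i < k \<Longrightarrow> X i \<in> valid_layouts (a i)"
    and Ts: "\<And>i. i < k \<Longrightarrow> Ts i = layout_class (X i)"
  shows "replace_class lay Ts \<in> planar_irr_classes (\<Sum>i<k. a i) k"
proof -
  obtain lay' where lay': "lay' \<in> valid_layouts (\<Sum>i<k. a i)"
    "iso_tgram (layout_tgram lay') (replace_pairs lay (\<lambda>i. layout_tgram (X i)))"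
    "iso_class (replace_pairs lay (\<lambda>i. layout_tgram (X i))) = layout_class lay'"
    using replace_in_planar[where X = X and a = a, OF lay X] by blast
  have pos: "a i > 0" if "i < k" for i using leaf_list_pos[OF X[OF that]] .
  have "parts (replace_pairs lay (\<lambda>i. layout_tgram (X i))) = (\<lambda>i. Pair i ` {..<a i}) ` {..<k}"
    using parts_replace[of "fst lay" "snd lay" k X a] lay X irr k by simp
  \<comment> \<open>Every piece has a leaf, so the block at position i contains (i, 0); different
    positions therefore give different parts.\<close>
  moreover have "inj_on (\<lambda>i. Pair i ` {..<a i}) {..<k}"
  proof (rule inj_onI)
    fix i j assume ij: "i \<in> {..<k}" "j \<in> {..<k}" "Pair i ` {..<a i} = Pair j ` {..<a j}"
    have "(i, 0) \<in> Pair i ` {..<a i}" using pos ij by auto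
    then show "i = j" unfolding ij(3) by auto
  qed
  ultimately have "card (parts (replace_pairs lay (\<lambda>i. layout_tgram (X i)))) = k"
    by (simp add: card_image)
  then have "card (parts (layout_tgram lay')) = k"
    using card_parts_iso[OF is_tanglegram_layout_tgram[OF lay'(1)] lay'(2)] by simp
  moreover have "replace_class lay Ts = layout_class lay'"
    using replace_class_eq[where X = X and a = a, OF lay X Ts] lay'(3) by simp
  ultimately show ?thesis
    unfolding planar_irr_classes_def using lay'(1) by blast
qed

section \<open>Reflection of layouts and of families\<close>

definition mirror_layout :: "layout \<Rightarrow> layout" where
  "mirror_layout lay = (mirror (fst lay), mirror (snd lay))"

text \<open>Entries at positions k and above stay in place. This preserves the dummy entries and
  makes the map an involution on all functions.\<close>

definition rev_family :: "nat \<Rightarrow> (nat \<Rightarrow> 'a) \<Rightarrow> nat \<Rightarrow> 'a" where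
  "rev_family k Ts i = (if i < k then Ts (k - 1 - i) else Ts i)"

lemma mirror_layout_valid [simp]: "mirror_layout lay \<in> valid_layouts k \<longleftrightarrow> lay \<in> valid_layouts k"
  by (cases lay) (simp add: mirror_layout_def valid_layouts_def)

lemma rev_family_rev_family [simp]: "rev_family k (rev_family k Ts) = Ts"
  by (auto simp: rev_family_def fun_eq_iff)

text \<open>The isomorphism is (i, x) \<mapsto> (k - 1 - i, x). Only the outer drawing is reflected;
  the inserted tanglegrams are not drawn, so they just change places.\<close>

lemma replace_pairs_mirror:
  assumes "lay \<in> valid_layouts k"
  shows "iso_tgram (replace_pairs lay T) (replace_pairs (mirror_layout lay) (\<lambda>i. T (k - 1 - i)))"
proof -
  obtain A B where lay: "lay = (A, B)" by (cases lay)
  have len: "length (leaf_list A) = k" "length (leaf_list B) = k"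
    using assms by (simp_all add: lay valid_layouts_def)
  define f :: "nat \<times> 'a \<Rightarrow> nat \<times> 'a" where "f = (\<lambda>(i, x). (k - 1 - i, x))"
  have f_Pair: "map_btree f (map_btree (Pair i) t) = map_btree (Pair (k - 1 - i)) t" for i t
    unfolding btree.map_comp by (simp add: comp_def f_def)
  have map_f: "map_btree f (subst_leaves (\<lambda>i. map_btree (Pair i) (F i)) (forget (number_leaves 0 C))) =
      subst_leaves (\<lambda>i. map_btree (Pair i) (F (k - 1 - i))) (forget (number_leaves 0 (mirror C)))"
    if "length (leaf_list C) = k" for C :: "unit ptree" and F :: "nat \<Rightarrow> 'a btree"
    unfolding number_leaves_mirror[OF that] forget_map_ptree forget_mirror subst_leaves_map map_subst_leaves f_Pair
    by (rule subst_leaves_cong) (use that in auto)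
  have inj: "inj_on f (\<Union>i\<in>leaves (forget (number_leaves 0 C)). Pair i ` leaves (F i))"
    if "length (leaf_list C) = k" for C :: "unit ptree" and F :: "nat \<Rightarrow> 'a btree"
    using that by (auto simp: inj_on_def f_def)
  show ?thesis
    unfolding lay mirror_layout_def fst_conv snd_conv replace_pairs.simps iso_tgram.simps leaves_replace
  proof (intro exI[of _ f] conjI ballI)
    fix p assume "p \<in> (\<Union>i\<in>leaves (forget (number_leaves 0 A)). Pair i ` leaves (left_tree (T i)))"
    then show "(case f p of (i, x) \<Rightarrow> (i, matching (T (k - 1 - i)) x)) = f (case p of (i, x) \<Rightarrow> (i, matching (T i) x))"
      using len by (auto simp: f_def)
  qed (use inj map_f len in simp_all)
qed

lemma replace_class_mirror:
  assumes "lay \<in> valid_layouts k" "\<And>i. i < k \<Longrightarrow> X i \<in> valid_layouts (a i)"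
    and "\<And>i. i < k \<Longrightarrow> Ts i = layout_class (X i)"
  shows "replace_class (mirror_layout lay) (rev_family k Ts) = replace_class lay Ts"
proof -
  have "replace_class (mirror_layout lay) (rev_family k Ts) =
      iso_class (replace_pairs (mirror_layout lay) (\<lambda>i. layout_tgram (X (k - 1 - i))))"
    using assms by (intro replace_class_eq[where a = "\<lambda>i. a (k - 1 - i)" and k = k]) (auto simp: rev_family_def)
  also have "\<dots> = iso_class (replace_pairs lay (\<lambda>i. layout_tgram (X i)))"
    using replace_pairs_mirror[OF assms(1), of "\<lambda>i. layout_tgram (X i)"]
    by (intro iso_class_cong[symmetric] is_tanglegram_replace[where X = X and a = a, OF assms(1,2)])
  also have "\<dots> = replace_class lay Ts"
    using replace_class_eq[where X = X and a = a, OF assms] by simp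
  finally show ?thesis .
qed

text \<open>Both matchings are the identity, so the two bijections of an isomorphism agree on the
  leaves and one map serves both trees.\<close>

lemma matched_isoE:
  assumes "iso_tgram (matched P Q) (matched P' Q')" "leaf_list P = leaf_list Q"
  obtains f where "inj_on f (set (leaf_list P))" "map_btree f (forget P) = forget P'" "map_btree f (forget Q) = forget Q'"
proof -
  obtain f g where fg: "inj_on f (set (leaf_list P))" "map_btree f (forget P) = forget P'"
      "map_btree g (forget Q) = forget Q'" "\<And>a. a \<in> set (leaf_list P) \<Longrightarrow> f a = g a"
    using assms(1) by (auto simp: matched_def)
  have "map_btree f (forget Q) = map_btree g (forget Q)"
    using fg(4) assms(2) by (intro btree.map_cong0) simp
  with fg that show ?thesis by simp
qed

lemma map_upt_eq_upt: "map \<phi> [0..<k] = [0..<k] \<Longrightarrow> i < k \<Longrightarrow> \<phi> i = i"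
  by (metis add_0 length_upt minus_nat.diff_0 nth_map nth_upt)

lemma map_upt_eq_rev_upt:
  assumes "map \<phi> [0..<k] = rev [0..<k]" "i < k"
  shows "\<phi> i = k - 1 - i"
proof -
  have "map \<phi> [0..<k] ! i = rev [0..<k] ! i" using assms(1) by simp
  then show ?thesis using assms(2) by (simp add: rev_nth)
qed

text \<open>An isomorphism f maps parts to parts, that is, blocks to blocks, and so induces a
  permutation \<phi> of the k positions. On the outer trees \<phi> is an isomorphism, hence by
  rigidity the identity or the reversal; within each block f is an isomorphism of the inserted
  tanglegrams. The block sizes a and a' are not assumed to be related.\<close>

lemma replace_inject:
  assumes lay: "(A, B) \<in> valid_layouts k" "irreducible (layout_tgram (A, B))" "k \<ge> 2"
    and X: "\<And>i. i < k \<Longrightarrow> X i \<in> valid_layouts (a i)"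
    and lay': "(A', B') \<in> valid_layouts k" "irreducible (layout_tgram (A', B'))"
    and X': "\<And>i. i < k \<Longrightarrow> X' i \<in> valid_layouts (a' i)"
    and iso: "iso_tgram (replace_pairs (A, B) (\<lambda>i. layout_tgram (X i))) (replace_pairs (A', B') (\<lambda>i. layout_tgram (X' i)))"
  shows "(A', B') = (A, B) \<and> (\<forall>i<k. layout_class (X' i) = layout_class (X i)) \<or>
         (A', B') = mirror_layout (A, B) \<and> (\<forall>i<k. layout_class (X' i) = layout_class (X (k - 1 - i)))"
proof -
  let ?T = "replace_pairs (A, B) (\<lambda>i. layout_tgram (X i))"
  let ?T' = "replace_pairs (A', B') (\<lambda>i. layout_tgram (X' i))"
  let ?L = "\<lambda>A Y. subst_leaves (\<lambda>i. map_btree (Pair i) (forget (number_leaves 0 (Y i)))) (forget (number_leaves 0 A)) :: (nat \<times> nat) btree"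
  have len: "length (leaf_list A) = k" "length (leaf_list B) = k" "length (leaf_list A') = k" "length (leaf_list B') = k"
    using lay(1) lay'(1) by (simp_all add: valid_layouts_def)
  have a: "length (leaf_list (fst (X i))) = a i" "length (leaf_list (snd (X i))) = a i"
      "length (leaf_list (fst (X' i))) = a' i" "length (leaf_list (snd (X' i))) = a' i" if "i < k" for i
    using X[OF that] X'[OF that] by (auto simp: valid_layouts_def)
  have pos: "a i > 0" if "i < k" for i using leaf_list_pos[OF X[OF that]] .
  have L: "forget (replace_ptree C Y) = ?L C Y" for C Y
    by (simp add: replace_ptree_def forget_subst_ptree)
  obtain f where f: "inj_on f (set (leaf_list (replace_ptree A (\<lambda>i. fst (X i)))))"
      "map_btree f (?L A (\<lambda>i. fst (X i))) = ?L A' (\<lambda>i. fst (X' i))"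
      "map_btree f (?L B (\<lambda>i. snd (X i))) = ?L B' (\<lambda>i. snd (X' i))"
    using matched_isoE[OF iso[unfolded replace_pairs_layout_tgram] replace_layouts(1)[where X = X and a = a, OF lay(1) X]] unfolding L .
  have leaves: "leaves (?L C Y) = (\<Union>i<k. Pair i ` {..<b i})"
    if "length (leaf_list C) = k" "\<And>i. i < k \<Longrightarrow> length (leaf_list (Y i)) = b i" for C b and Y :: "nat \<Rightarrow> unit ptree"
    unfolding leaves_replace using that by (auto simp: atLeast0LessThan)
  have f_inj: "inj_on f (\<Union>i<k. Pair i ` {..<a i})"
    using f(1) unfolding leaves_forget[symmetric] L using leaves[of A "\<lambda>i. fst (X i)" a] len a by simp
  have "common_clusters ?T' = image f ` common_clusters ?T"
  proof -
    have "common_clusters (map_btree f (?L A (\<lambda>i. fst (X i))), map_btree f (?L B (\<lambda>i. snd (X i))), id) =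
        image f ` common_clusters (?L A (\<lambda>i. fst (X i)), ?L B (\<lambda>i. snd (X i)), id)"
    proof (rule common_clusters_iso)
      show "is_tanglegram (?L A (\<lambda>i. fst (X i)), ?L B (\<lambda>i. snd (X i)), id)"
        using is_tanglegram_replace[where X = X and a = a, OF lay(1) X] unfolding replace_pairs_layout_tgram matched_def L .
      show "inj_on f (leaves (?L A (\<lambda>i. fst (X i))))" "inj_on f (leaves (?L B (\<lambda>i. snd (X i))))"
        using f_inj leaves[of A "\<lambda>i. fst (X i)" a] leaves[of B "\<lambda>i. snd (X i)" a] len a by simp_all
    qed simp
    then show ?thesis unfolding f(2,3) replace_pairs_layout_tgram matched_def L .
  qed
  moreover have "maximal_sets (image f ` common_clusters ?T) = image f ` maximal_sets (common_clusters ?T)"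
  proof (rule maximal_sets_image)
    show "inj_on f (leaves (left_tree ?T))"
      unfolding replace_pairs_layout_tgram matched_def left_tree.simps leaves_forget by (rule f(1))
  qed (rule common_clusters_subset)
  ultimately have "parts ?T' = image f ` parts ?T"
    unfolding parts_def by (simp only:)
  moreover have "parts ?T = (\<lambda>i. Pair i ` {..<a i}) ` {..<k}"
    by (rule parts_replace[OF lay(1) X lay(2,3)])
  moreover have "parts ?T' = (\<lambda>j. Pair j ` {..<a' j}) ` {..<k}"
    by (rule parts_replace[OF lay'(1) X' lay'(2) lay(3)])
  ultimately have parts: "(\<lambda>j. Pair j ` {..<a' j}) ` {..<k} = image f ` (\<lambda>i. Pair i ` {..<a i}) ` {..<k}"
    by (simp only:)
  have "\<exists>j<k. f ` Pair i ` {..<a i} = Pair j ` {..<a' j}" if "i < k" for i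
  proof -
    have "f ` Pair i ` {..<a i} \<in> (\<lambda>j. Pair j ` {..<a' j}) ` {..<k}"
      unfolding parts using that by blast
    then show ?thesis by auto
  qed
  then obtain \<phi> where \<phi>: "\<And>i. i < k \<Longrightarrow> \<phi> i < k" "\<And>i. i < k \<Longrightarrow> f ` Pair i ` {..<a i} = Pair (\<phi> i) ` {..<a' (\<phi> i)}"
    by metis
  have \<phi>_inj: "inj_on \<phi> {..<k}"
  proof (rule inj_onI)
    fix i j assume ij: "i \<in> {..<k}" "j \<in> {..<k}" "\<phi> i = \<phi> j"
    have "f ` Pair i ` {..<a i} = f ` Pair j ` {..<a j}" using \<phi>(2)[of i] \<phi>(2)[of j] ij by simp
    then have eq: "Pair i ` {..<a i} = Pair j ` {..<a j}"
      using ij by (subst (asm) inj_on_image_eq_iff[OF f_inj]) auto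
    have "(i, 0) \<in> Pair i ` {..<a i}" using pos ij by auto
    then show "i = j" unfolding eq by auto
  qed
  then have \<phi>_im: "\<phi> ` {..<k} = {..<k}"
    using \<phi>(1) by (intro endo_inj_surj) auto
  \<comment> \<open>The inverse permutation indexes the pieces of the first family by positions of
    the second, so that in \<open>side\<close> both substitutions use the same blocks and
    \<open>subst_leaves_inject\<close> applies.\<close>
  define \<psi> where "\<psi> = inv_into {..<k} \<phi>"
  have \<psi>\<phi>: "\<psi> (\<phi> i) = i" if "i < k" for i using that \<phi>_inj by (simp add: \<psi>_def)
  have \<phi>\<psi>: "\<phi> (\<psi> i) = i" "\<psi> i < k" if "i < k" for i
  proof -
    have "i \<in> \<phi> ` {..<k}" using that \<phi>_im by simp
    then show "\<phi> (\<psi> i) = i" "\<psi> i < k"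
      using f_inv_into_f[of i \<phi> "{..<k}"] inv_into_into[of i \<phi> "{..<k}"] by (simp_all add: \<psi>_def)
  qed
  have side: "map_btree \<phi> (forget (number_leaves 0 C)) = forget (number_leaves 0 C') \<and>
      (\<forall>i<k. map_btree f (map_btree (Pair i) (forget (number_leaves 0 (Y i)))) =
             map_btree (Pair (\<phi> i)) (forget (number_leaves 0 (Y' (\<phi> i)))))"
    if C: "length (leaf_list C) = k" "length (leaf_list C') = k"
      and Y: "\<And>i. i < k \<Longrightarrow> length (leaf_list (Y i)) = a i" "\<And>i. i < k \<Longrightarrow> length (leaf_list (Y' i)) = a' i"
      and eq: "map_btree f (?L C Y) = ?L C' Y'" for C C' and Y Y' :: "nat \<Rightarrow> unit ptree"
  proof -
    define F where "F = (\<lambda>i. map_btree f (map_btree (Pair i) (forget (number_leaves 0 (Y i)))))"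
    define F' :: "nat \<Rightarrow> (nat \<times> nat) btree" where "F' = (\<lambda>i. map_btree (Pair i) (forget (number_leaves 0 (Y' i))))"
    have lv: "leaves (forget (number_leaves 0 C)) = {..<k}" "leaves (forget (number_leaves 0 C')) = {..<k}"
        "leaves (map_btree \<phi> (forget (number_leaves 0 C))) = {..<k}"
      using C \<phi>_im by (auto simp: btree.set_map atLeast0LessThan)
    have lvF: "leaves (F i) = Pair (\<phi> i) ` {..<a' (\<phi> i)}" "leaves (F' i) = Pair i ` {..<a' i}" if "i < k" for i
      using Y(1,2)[OF that] \<phi>(2)[OF that] by (simp_all add: F_def F'_def btree.set_map atLeast0LessThan)
    have "subst_leaves (\<lambda>i. F (\<psi> i)) (map_btree \<phi> (forget (number_leaves 0 C))) =
        subst_leaves F (forget (number_leaves 0 C))"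
      unfolding subst_leaves_map by (rule subst_leaves_cong) (use lv \<psi>\<phi> in auto)
    also have "\<dots> = subst_leaves F' (forget (number_leaves 0 C'))"
      using eq unfolding map_subst_leaves F_def F'_def .
    finally have "map_btree \<phi> (forget (number_leaves 0 C)) = forget (number_leaves 0 C') \<and>
        (\<forall>i\<in>leaves (map_btree \<phi> (forget (number_leaves 0 C))). F (\<psi> i) = F' i)"
    proof (rule subst_leaves_inject[where S = "\<lambda>i. Pair i ` {..<a' i}", rotated 2])
      show "wf_btree (map_btree \<phi> (forget (number_leaves 0 C)))"
        using \<phi>_inj lv(1) by (intro wf_btree_map) simp_all
    qed (use lv lvF \<phi>\<psi> in auto)
    moreover have "F i = F' (\<phi> i)" if "i < k" for i
      using calculation lv(3) \<phi>(1)[OF that] \<psi>\<phi>[OF that] by (metis lessThan_iff)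
    ultimately show ?thesis
      unfolding F_def F'_def by blast
  qed
  note left = side[of A A' "\<lambda>i. fst (X i)" "\<lambda>i. fst (X' i)", OF len(1,3) a(1,3) f(2)]
    and right = side[of B B' "\<lambda>i. snd (X i)" "\<lambda>i. snd (X' i)", OF len(2,4) a(2,4) f(3)]
  have classes: "layout_class (X' (\<phi> i)) = layout_class (X i)" if i: "i < k" for i
  proof -
    \<comment> \<open>The restriction of f to the i-th block, with the position tags
      removed.\<close>
    define h where "h = snd \<circ> f \<circ> Pair i"
    have "map_btree h t = t'" if "map_btree f (map_btree (Pair i) t) = map_btree (Pair (\<phi> i)) t'" for t t'
    proof -
      have "map_btree h t = map_btree snd (map_btree f (map_btree (Pair i) t))"
        by (simp add: btree.map_comp h_def comp_assoc)
      also have "\<dots> = map_btree (snd \<circ> Pair (\<phi> i)) t'" unfolding that by (simp add: btree.map_comp)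
      also have "snd \<circ> Pair (\<phi> i) = (id :: nat \<Rightarrow> nat)" by auto
      finally show ?thesis by (simp only: btree.map_id)
    qed
    then have "map_btree h (forget (number_leaves 0 (fst (X i)))) = forget (number_leaves 0 (fst (X' (\<phi> i))))"
       "map_btree h (forget (number_leaves 0 (snd (X i)))) = forget (number_leaves 0 (snd (X' (\<phi> i))))"
      using left right i by blast+
    moreover have "inj_on h {..<a i}"
    proof -
      have "inj_on f (Pair i ` {..<a i})" by (rule inj_on_subset[OF f_inj]) (use i in auto)
      then have "inj_on (f \<circ> Pair i) {..<a i}" by (intro comp_inj_on) (auto simp: inj_on_def)
      moreover have "inj_on snd ((f \<circ> Pair i) ` {..<a i})"
        using \<phi>(2)[OF i] by (auto simp: inj_on_def image_comp)
      ultimately show ?thesis unfolding h_def comp_assoc by (rule comp_inj_on)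
    qed
    ultimately have "iso_tgram (layout_tgram (X i)) (layout_tgram (X' (\<phi> i)))"
      unfolding layout_tgram_def matched_def iso_tgram.simps
      using a[OF i] by (intro exI[of _ h]) (simp add: atLeast0LessThan)
    then show ?thesis
      unfolding layout_class_def by (rule iso_class_cong[OF is_tanglegram_layout_tgram[OF X[OF i]], symmetric])
  qed
  \<comment> \<open>The second layout, numbered from the top, is the reference drawing; the first
    one, relabelled by \<phi>, is another crossing-free drawing of the same trees.\<close>
  have rigid: "map_ptree \<phi> (number_leaves 0 A) = number_leaves 0 A' \<and> map_ptree \<phi> (number_leaves 0 B) = number_leaves 0 B' \<or>
     map_ptree \<phi> (number_leaves 0 A) = mirror (number_leaves 0 A') \<and> map_ptree \<phi> (number_leaves 0 B) = mirror (number_leaves 0 B')"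
  proof (rule irreducible_pair_rigid)
    show "irreducible_pair (forget (number_leaves 0 A')) (forget (number_leaves 0 B'))"
      using irreducible_layout_tgram_iff[OF lay'(1) lay(3)] lay'(2) by simp
    show "distinct (leaf_list (map_ptree \<phi> (number_leaves 0 A)))"
      using \<phi>_inj len by (simp add: distinct_map atLeast0LessThan)
  qed (use left right len in simp_all)
  then show ?thesis
  proof
    assume *: "map_ptree \<phi> (number_leaves 0 A) = number_leaves 0 A' \<and> map_ptree \<phi> (number_leaves 0 B) = number_leaves 0 B'"
    then have "map \<phi> [0..<k] = [0..<k]" using len by (metis leaf_list_map_ptree leaf_list_number_leaves add_0)
    then have "\<phi> i = i" if "i < k" for i using that by (rule map_upt_eq_upt)
    moreover have "A' = A" "B' = B"
      using * by (metis shape_map_ptree shape_number_leaves shape_unit)+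
    ultimately show ?thesis using classes by auto
  next
    assume *: "map_ptree \<phi> (number_leaves 0 A) = mirror (number_leaves 0 A') \<and> map_ptree \<phi> (number_leaves 0 B) = mirror (number_leaves 0 B')"
    then have "map \<phi> [0..<k] = rev [0..<k]" using len by (metis leaf_list_map_ptree leaf_list_mirror leaf_list_number_leaves add_0)
    then have \<phi>_rev: "\<phi> i = k - 1 - i" if "i < k" for i using that by (rule map_upt_eq_rev_upt)
    have "mirror A' = A" "mirror B' = B"
      using * by (metis shape_map_ptree shape_number_leaves shape_unit shape_mirror)+
    then have "(A', B') = mirror_layout (A, B)" by (auto simp: mirror_layout_def)
    moreover have "layout_class (X' i) = layout_class (X (k - 1 - i))" if "i < k" for i
      using classes[of "k - 1 - i"] \<phi>_rev[of "k - 1 - i"] that by simp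
    ultimately show ?thesis by blast
  qed
qed

section \<open>Decomposition into an irreducible layout and its parts\<close>

lemma subst_ptree_cong:
  "(\<And>i. i \<in> set (leaf_list P) \<Longrightarrow> F i = G i) \<Longrightarrow> subst_ptree F P = subst_ptree G P"
  by (induction P) auto

lemma map_subst_ptree: "map_ptree f (subst_ptree F P) = subst_ptree (\<lambda>i. map_ptree f (F i)) P"
  by (induction P) auto

lemma subst_ptree_map: "subst_ptree F (map_ptree h P) = subst_ptree (\<lambda>i. F (h i)) P"
  by (induction P) auto

text \<open>Descend from the root until the current leaf set belongs to M. The covering hypothesis
  survives the step to a child, and at a single leaf a it forces {a} \<in> M, so the descent always
  stops. The cut places are labelled by the members of M themselves.\<close>

lemma ptree_cut:
  assumes "distinct (leaf_list P)" "\<And>a. a \<in> set (leaf_list P) \<Longrightarrow> \<exists>m\<in>M. a \<in> m \<and> m \<in> clusters (forget P)"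
  shows "\<exists>A F. P = subst_ptree F A \<and> set (leaf_list A) \<subseteq> M \<and> (\<forall>m\<in>set (leaf_list A). set (leaf_list (F m)) = m)"
  using assms
proof (induction P)
  case (PLeaf a)
  then have "{a} \<in> M" by auto
  then show ?case
    by (intro exI[of _ "PLeaf {a}"] exI[of _ "\<lambda>_. PLeaf a"]) simp
next
  case (PNode l r)
  show ?case
  proof (cases "set (leaf_list (PNode l r)) \<in> M")
    case True
    then show ?thesis
      by (intro exI[of _ "PLeaf (set (leaf_list (PNode l r)))"] exI[of _ "\<lambda>_. PNode l r"]) simp
  next
    case False
    have disj: "set (leaf_list l) \<inter> set (leaf_list r) = {}" using PNode.prems(1) by simp
    have sub: "m \<subseteq> set (leaf_list l)" if "m \<in> clusters (forget l)" for m
      using clusters_subset[OF that] by simp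
    have sub': "m \<subseteq> set (leaf_list r)" if "m \<in> clusters (forget r)" for m
      using clusters_subset[OF that] by simp
    have cov: "\<exists>m\<in>M. a \<in> m \<and> (m \<in> clusters (forget l) \<or> m \<in> clusters (forget r))"
      if a: "a \<in> set (leaf_list l) \<union> set (leaf_list r)" for a
    proof -
      have "a \<in> set (leaf_list (PNode l r))" using a by simp
      then obtain m where m: "m \<in> M" "a \<in> m" "m \<in> clusters (forget (PNode l r))"
        using PNode.prems(2) by blast
      have "m \<noteq> set (leaf_list (PNode l r))" using False m(1) by blast
      then have "m \<in> clusters (forget l) \<or> m \<in> clusters (forget r)" using m(3) by simp
      then show ?thesis using m(1,2) by blast
    qed
    have covl: "\<exists>m\<in>M. a \<in> m \<and> m \<in> clusters (forget l)" if a: "a \<in> set (leaf_list l)" for a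
    proof -
      obtain m where "m \<in> M" "a \<in> m" "m \<in> clusters (forget l) \<or> m \<in> clusters (forget r)"
        using cov[of a] a by blast
      then show ?thesis using sub'[of m] disj a by blast
    qed
    have "distinct (leaf_list l)" using PNode.prems(1) by simp
    then have "\<exists>A F. l = subst_ptree F A \<and> set (leaf_list A) \<subseteq> M \<and> (\<forall>m\<in>set (leaf_list A). set (leaf_list (F m)) = m)"
      using covl by (rule PNode.IH(1))
    then obtain A F where A: "l = subst_ptree F A" "set (leaf_list A) \<subseteq> M" "\<forall>m\<in>set (leaf_list A). set (leaf_list (F m)) = m"
      by blast
    have covr: "\<exists>m\<in>M. a \<in> m \<and> m \<in> clusters (forget r)" if a: "a \<in> set (leaf_list r)" for a
    proof -
      obtain m where "m \<in> M" "a \<in> m" "m \<in> clusters (forget l) \<or> m \<in> clusters (forget r)"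
        using cov[of a] a by blast
      then show ?thesis using sub[of m] disj a by blast
    qed
    have "distinct (leaf_list r)" using PNode.prems(1) by simp
    then have "\<exists>A F. r = subst_ptree F A \<and> set (leaf_list A) \<subseteq> M \<and> (\<forall>m\<in>set (leaf_list A). set (leaf_list (F m)) = m)"
      using covr by (rule PNode.IH(2))
    then obtain B G where B: "r = subst_ptree G B" "set (leaf_list B) \<subseteq> M" "\<forall>m\<in>set (leaf_list B). set (leaf_list (G m)) = m"
      by blast
    \<comment> \<open>A member of M cannot be cut out below both children, as their leaf sets are
      disjoint; hence F and G can be merged into one function on labels.\<close>
    have notin: "m \<notin> set (leaf_list A)" if m: "m \<in> set (leaf_list B)" for m
    proof
      assume mA: "m \<in> set (leaf_list A)"
      have "set (leaf_list (F m)) = m" "set (leaf_list (G m)) = m" using A(3) B(3) m mA by blast+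
      moreover have "set (leaf_list (F m)) \<subseteq> set (leaf_list (subst_ptree F A))"
          "set (leaf_list (G m)) \<subseteq> set (leaf_list (subst_ptree G B))"
        unfolding leaf_list_subst_ptree using m mA by auto
      then have "set (leaf_list (F m)) \<subseteq> set (leaf_list l)" "set (leaf_list (G m)) \<subseteq> set (leaf_list r)"
        unfolding A(1)[symmetric] B(1)[symmetric] .
      moreover have "hd (leaf_list (F m)) \<in> set (leaf_list (F m))" by simp
      ultimately have "hd (leaf_list (F m)) \<in> set (leaf_list l) \<inter> set (leaf_list r)" by auto
      then show False unfolding disj by simp
    qed
    let ?H = "\<lambda>m. if m \<in> set (leaf_list A) then F m else G m"
    have "subst_ptree ?H A = l" unfolding A(1) by (rule subst_ptree_cong) simp
    moreover have "subst_ptree ?H B = r" unfolding B(1) by (rule subst_ptree_cong) (simp add: notin)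
    ultimately have "PNode l r = subst_ptree ?H (PNode A B)" by simp
    moreover have "\<forall>m\<in>set (leaf_list (PNode A B)). set (leaf_list (?H m)) = m"
      using A(3) B(3) by auto
    moreover have "set (leaf_list (PNode A B)) \<subseteq> M" using A(2) B(2) by simp
    ultimately show ?thesis by (intro exI[of _ "PNode A B"] exI[of _ ?H] conjI)
  qed
qed

lemma distinct_if_distinct_concat_map:
  assumes "distinct (concat (map h xs))" "\<And>x. x \<in> set xs \<Longrightarrow> h x \<noteq> []"
  shows "distinct xs"
  using assms
proof (induction xs)
  case (Cons x xs)
  have "x \<notin> set xs"
  proof
    assume "x \<in> set xs"
    then have "set (h x) \<subseteq> set (concat (map h xs))" by auto
    moreover have "hd (h x) \<in> set (h x)" using Cons.prems(2)[of x] by simp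
    ultimately show False using Cons.prems(1) by (simp only: list.map concat.simps distinct_append) blast
  qed
  with Cons show ?case by auto
qed simp

lemma sorted_block:
  fixes h :: "'a \<Rightarrow> 'b :: linorder list"
  shows "sorted (concat (map h xs)) \<Longrightarrow> x \<in> set xs \<Longrightarrow> sorted (h x)"
  by (induction xs) (auto simp: sorted_append)

text \<open>Disjoint nonempty blocks: the head of the concatenation identifies the first block. In
  the decomposition this shows that the parts appear in the same order on both sides.\<close>

lemma concat_map_inject:
  assumes "concat (map h xs) = concat (map h ys)"
    and "\<And>x. x \<in> set xs \<union> set ys \<Longrightarrow> h x \<noteq> []"
    and "\<And>x y. x \<in> set xs \<union> set ys \<Longrightarrow> y \<in> set xs \<union> set ys \<Longrightarrow> x \<noteq> y \<Longrightarrow> set (h x) \<inter> set (h y) = {}"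
  shows "xs = ys"
  using assms
proof (induction xs arbitrary: ys)
  case Nil
  then show ?case by (cases ys) auto
next
  case (Cons x xs)
  show ?case
  proof (cases ys)
    case Nil
    then show ?thesis using Cons.prems(1) Cons.prems(2)[of x] by simp
  next
    case ys: (Cons y ys')
    have eq: "h x @ concat (map h xs) = h y @ concat (map h ys')" using Cons.prems(1) by (simp add: ys)
    have ne: "h x \<noteq> []" "h y \<noteq> []" using Cons.prems(2)[of x] Cons.prems(2)[of y] by (simp_all add: ys)
    have "hd (h x) = hd (h y)" using arg_cong[OF eq, of hd] ne by simp
    then have "set (h x) \<inter> set (h y) \<noteq> {}" using hd_in_set[OF ne(1)] hd_in_set[OF ne(2)] by auto
    then have "x = y" using Cons.prems(3)[of x y] by (auto simp: ys)
    moreover have "xs = ys'"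
    proof (rule Cons.IH)
      show "concat (map h xs) = concat (map h ys')" using eq \<open>x = y\<close> by simp
      show "h z \<noteq> []" if "z \<in> set xs \<union> set ys'" for z using that Cons.prems(2)[of z] by (auto simp: ys)
      show "set (h z) \<inter> set (h w) = {}" if "z \<in> set xs \<union> set ys'" "w \<in> set xs \<union> set ys'" "z \<noteq> w" for z w
        using that Cons.prems(3)[of z w] by (auto simp: ys)
    qed
    ultimately show ?thesis by (simp add: ys)
  qed
qed

lemma matched_isoI:
  assumes "map_ptree f P = P'" "map_ptree f Q = Q'" "distinct (leaf_list P')" "leaf_list P = leaf_list Q"
  shows "iso_tgram (matched P Q) (matched P' Q')"
proof -
  have "inj_on f (set (leaf_list P))"
    using assms(1,3) by (auto simp: distinct_map)
  moreover have "map_btree f (forget P) = forget P'" "map_btree f (forget Q) = forget Q'"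
    using assms(1,2) by auto
  ultimately show ?thesis
    unfolding matched_def iso_tgram.simps leaves_forget using assms(4) by (intro exI[of _ f]) simp
qed

lemma map_replace_ptree:
  assumes "\<And>i x. i < length (leaf_list A) \<Longrightarrow> x < length (leaf_list (F (leaf_list A ! i))) \<Longrightarrow>
      f (i, x) = leaf_list (F (leaf_list A ! i)) ! x"
  shows "map_ptree f (replace_ptree (shape A) (\<lambda>i. shape (F (leaf_list A ! i)))) = subst_ptree F A"
proof -
  have "map_ptree f (replace_ptree (shape A) (\<lambda>i. shape (F (leaf_list A ! i)))) =
      subst_ptree (\<lambda>i. map_ptree (\<lambda>x. f (i, x)) (number_leaves 0 (shape (F (leaf_list A ! i))))) (number_leaves 0 (shape A))"
    unfolding replace_ptree_def map_subst_ptree by (simp add: ptree.map_comp comp_def)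
  also have "\<dots> = subst_ptree (\<lambda>i. F (leaf_list A ! i)) (number_leaves 0 (shape A))"
    using assms by (intro subst_ptree_cong map_number_leaves_shape) simp
  also have "\<dots> = subst_ptree F (map_ptree ((!) (leaf_list A)) (number_leaves 0 (shape A)))"
    by (simp add: subst_ptree_map)
  also have "map_ptree ((!) (leaf_list A)) (number_leaves 0 (shape A)) = A"
    by (rule map_number_leaves_shape) simp
  finally show ?thesis .
qed

lemma disjoint_parts:
  assumes "is_tanglegram T" "m \<in> parts T" "m' \<in> parts T" "m \<noteq> m'"
  shows "m \<inter> m' = {}"
proof -
  obtain L R \<sigma> where T: "T = (L, R, \<sigma>)" by (cases T)
  have "m \<in> clusters L" "m' \<in> clusters L" using assms(2,3) by (auto simp: T parts_def maximal_sets_def)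
  then have "m \<subseteq> m' \<or> m' \<subseteq> m \<or> m \<inter> m' = {}"
    using assms(1) by (intro clusters_laminar[of L]) (simp_all add: T)
  moreover have "m = m'" if "m \<subseteq> m'" using assms(2,3) that by (simp add: parts_def maximal_sets_def)
  moreover have "m = m'" if "m' \<subseteq> m" using assms(2,3) that by (simp add: parts_def maximal_sets_def)
  ultimately show ?thesis using assms(4) by blast
qed

lemma parts_cover:
  assumes "is_tanglegram T" "tsize T \<ge> 2" "a \<in> leaves (left_tree T)"
  obtains m where "m \<in> parts T" "a \<in> m"
proof -
  obtain m where m: "m \<in> parts T" "{a} \<subseteq> m"
    unfolding parts_def
    by (rule maximal_sets_above[OF finite_common_clusters singleton_in_common_clusters[OF assms]])
  then have "a \<in> m" by simp
  with m(1) show ?thesis by (rule that)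
qed

text \<open>Both drawings are cut at the parts. As both leaf lists are [0..<n], the parts have the
  same inner order and the same mutual order on both sides, so the pieces and the outer trees are
  again layouts. A common cluster of the outer trees would yield a union of parts that is a common
  cluster of the original trees, so maximality of the parts makes the outer pair
  irreducible.\<close>

lemma decomposition:
  assumes "lay \<in> valid_layouts n" "n \<ge> 2"
  obtains k lay' X a where "k \<ge> 2" "lay' \<in> valid_layouts k" "irreducible (layout_tgram lay')"
    "\<And>i. i < k \<Longrightarrow> X i \<in> valid_layouts (a i)" "(\<Sum>i<k. a i) = n"
    "layout_class lay = iso_class (replace_pairs lay' (\<lambda>i. layout_tgram (X i)))"
proof -
  define P Q where "P = number_leaves 0 (fst lay)" and "Q = number_leaves 0 (snd lay)"
  have T: "layout_tgram lay = matched P Q" by (simp add: layout_tgram_def P_def Q_def)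
  have xs: "leaf_list P = [0..<n]" "leaf_list Q = [0..<n]"
    using assms(1) by (auto simp: P_def Q_def valid_layouts_def)
  have tg: "is_tanglegram (matched P Q)" using is_tanglegram_layout_tgram[OF assms(1)] by (simp add: T)
  have size: "tsize (matched P Q) \<ge> 2" using tsize_layout_tgram[OF assms(1)] assms(2) by (simp add: T)
  define M where "M = parts (matched P Q)"
  have M: "m \<in> clusters (forget P)" "m \<in> clusters (forget Q)" "m \<noteq> {0..<n}" if "m \<in> M" for m
    using that xs by (auto simp: M_def parts_def maximal_sets_def matched_def)
  have cover: "\<exists>m\<in>M. a \<in> m" if "a \<in> {0..<n}" for a
  proof -
    have "a \<in> leaves (left_tree (matched P Q))" using that xs by (simp add: matched_def)
    then obtain m where "m \<in> M" "a \<in> m" unfolding M_def by (rule parts_cover[OF tg size])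
    then show ?thesis by blast
  qed
  have disj: "m \<inter> m' = {}" if "m \<in> M" "m' \<in> M" "m \<noteq> m'" for m m'
    using that disjoint_parts[OF tg] by (simp add: M_def)
  have ne: "m \<noteq> {}" if "m \<in> M" for m by (rule clusters_nonempty[OF M(1)[OF that]])
  have distP: "distinct (leaf_list P)" using xs by simp
  have coverP: "\<exists>m\<in>M. a \<in> m \<and> m \<in> clusters (forget P)" if a: "a \<in> set (leaf_list P)" for a
  proof -
    have "a \<in> {0..<n}" using a xs by simp
    then obtain m where m: "m \<in> M" "a \<in> m" using cover by blast
    then show ?thesis using M(1)[OF m(1)] by blast
  qed
  have "\<exists>A F. P = subst_ptree F A \<and> set (leaf_list A) \<subseteq> M \<and> (\<forall>m\<in>set (leaf_list A). set (leaf_list (F m)) = m)"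
    using distP coverP by (rule ptree_cut)
  then obtain A F where A: "P = subst_ptree F A" "set (leaf_list A) \<subseteq> M"
      and F_leaves: "\<forall>m\<in>set (leaf_list A). set (leaf_list (F m)) = m"
    by (elim exE conjE)
  have distQ: "distinct (leaf_list Q)" using xs by simp
  have coverQ: "\<exists>m\<in>M. a \<in> m \<and> m \<in> clusters (forget Q)" if a: "a \<in> set (leaf_list Q)" for a
  proof -
    have "a \<in> {0..<n}" using a xs by simp
    then obtain m where m: "m \<in> M" "a \<in> m" using cover by blast
    then show ?thesis using M(2)[OF m(1)] by blast
  qed
  have "\<exists>A F. Q = subst_ptree F A \<and> set (leaf_list A) \<subseteq> M \<and> (\<forall>m\<in>set (leaf_list A). set (leaf_list (F m)) = m)"
    using distQ coverQ by (rule ptree_cut)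
  then obtain B G where B: "Q = subst_ptree G B" "set (leaf_list B) \<subseteq> M"
      and G_leaves: "\<forall>m\<in>set (leaf_list B). set (leaf_list (G m)) = m"
    by (elim exE conjE)
  have F_set: "set (leaf_list (F m)) = m" if "m \<in> set (leaf_list A)" for m
    using that F_leaves by blast
  have G_set: "set (leaf_list (G m)) = m" if "m \<in> set (leaf_list B)" for m
    using that G_leaves by blast
  have all: "set (leaf_list C) = M"
    if C: "set (leaf_list C) \<subseteq> M" "\<And>m. m \<in> set (leaf_list C) \<Longrightarrow> set (leaf_list (H m)) = m"
      "set (leaf_list (subst_ptree H C)) = {0..<n}" for C :: "nat set ptree" and H :: "nat set \<Rightarrow> nat ptree"
  proof (rule subset_antisym[OF C(1)], rule subsetI)
    fix m assume m: "m \<in> M"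
    obtain x where x: "x \<in> m" using ne[OF m] by blast
    then have "x \<in> {0..<n}" using clusters_subset[OF M(1)[OF m]] xs by auto
    then obtain m' where m': "m' \<in> set (leaf_list C)" "x \<in> set (leaf_list (H m'))"
      unfolding C(3)[symmetric] leaf_list_subst_ptree by auto
    then have "x \<in> m'" "m' \<in> M" using C by auto
    then have "m = m'" using disj[OF m, of m'] x by blast
    with m' show "m \<in> set (leaf_list C)" by simp
  qed
  have setA: "set (leaf_list A) = M" using all[OF A(2) F_set] xs A(1) by simp
  have setB: "set (leaf_list B) = M" using all[OF B(2) G_set] xs B(1) by simp
  have concatA: "concat (map (\<lambda>m. leaf_list (F m)) (leaf_list A)) = [0..<n]"
    using xs(1) unfolding A(1) leaf_list_subst_ptree .
  have concatB: "concat (map (\<lambda>m. leaf_list (G m)) (leaf_list B)) = [0..<n]"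
    using xs(2) unfolding B(1) leaf_list_subst_ptree .
  \<comment> \<open>As a segment of [0..<n], each block is listed in increasing order on either
    side, so its leaf set determines the list.\<close>
  have FG: "leaf_list (F m) = leaf_list (G m)" if m: "m \<in> M" for m
  proof (rule sorted_distinct_set_unique)
    show "sorted (leaf_list (F m))"
      using sorted_block[of "\<lambda>m. leaf_list (F m)" "leaf_list A" m] concatA m setA by simp
    show "sorted (leaf_list (G m))"
      using sorted_block[of "\<lambda>m. leaf_list (G m)" "leaf_list B" m] concatB m setB by simp
    have "distinct (concat (map (\<lambda>m. leaf_list (F m)) (leaf_list A)))" "distinct (concat (map (\<lambda>m. leaf_list (G m)) (leaf_list B)))"
      unfolding concatA concatB by simp_all
    then show "distinct (leaf_list (F m))" "distinct (leaf_list (G m))"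
      using m setA setB unfolding distinct_concat_iff by auto
    show "set (leaf_list (F m)) = set (leaf_list (G m))" using F_set G_set m setA setB by simp
  qed
  have AB: "leaf_list A = leaf_list B"
  proof (rule concat_map_inject)
    have "map (\<lambda>m. leaf_list (F m)) (leaf_list B) = map (\<lambda>m. leaf_list (G m)) (leaf_list B)"
      using FG setB by simp
    then show "concat (map (\<lambda>m. leaf_list (F m)) (leaf_list A)) = concat (map (\<lambda>m. leaf_list (F m)) (leaf_list B))"
      by (simp only: concatA concatB)
    show "set (leaf_list (F x)) \<inter> set (leaf_list (F y)) = {}"
      if "x \<in> set (leaf_list A) \<union> set (leaf_list B)" "y \<in> set (leaf_list A) \<union> set (leaf_list B)" "x \<noteq> y" for x y
      using that disj[of x y] F_set setA setB by simp
  qed simp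
  have distA: "distinct (leaf_list A)"
    using distinct_if_distinct_concat_map[of "\<lambda>m. leaf_list (F m)" "leaf_list A"] concatA by simp
  define k where "k = length (leaf_list A)"
  have nth_M: "leaf_list A ! i \<in> M" if "i < k" for i
    using that nth_mem[of i "leaf_list A"] setA by (simp add: k_def)
  \<comment> \<open>A single part would consist of all leaves, but parts are proper subsets of the
    leaf set.\<close>
  have "k \<noteq> 1"
  proof
    assume "k = 1"
    then obtain m where m: "leaf_list A = [m]" unfolding k_def by (metis One_nat_def length_0_conv length_Suc_conv)
    then have "leaf_list (F m) = [0..<n]" using concatA by simp
    then have "m = {0..<n}" using F_set[of m] m by simp
    moreover have "m \<in> M" unfolding setA[symmetric] m by simp
    ultimately show False using M(3) by blast
  qed
  moreover have "k \<noteq> 0" by (simp add: k_def)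
  ultimately have k: "k \<ge> 2" by linarith
  have pair: "irreducible_pair (forget A) (forget B)"
    unfolding irreducible_pair_def
  proof (intro ballI)
    fix C assume C: "C \<in> clusters (forget A) \<inter> clusters (forget B)"
    have CM: "C \<subseteq> M" using clusters_subset[of C "forget A"] C setA by simp
    \<comment> \<open>The labels of A and B are themselves sets of leaves; U is the set of leaves of
      the original trees below the vertex with cluster C.\<close>
    define U where "U = \<Union>C"
    have leaves_C: "leaves (forget (F i)) = i" "leaves (forget (G i)) = i" if "i \<in> C" for i
    proof -
      have "i \<in> set (leaf_list A)" "i \<in> set (leaf_list B)" using that CM setA setB by auto
      then show "leaves (forget (F i)) = i" "leaves (forget (G i)) = i" using F_set G_set by simp_all
    qed
    have U_F: "U = (\<Union>i\<in>C. leaves (forget (F i)))"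
      using SUP_cong[OF refl leaves_C(1), of C "\<lambda>x. x"] by (simp add: U_def)
    have U_G: "U = (\<Union>i\<in>C. leaves (forget (G i)))"
      using SUP_cong[OF refl leaves_C(2), of C "\<lambda>x. x"] by (simp add: U_def)
    have U: "U \<in> clusters (forget P)" "U \<in> clusters (forget Q)"
      unfolding A(1) B(1) forget_subst_ptree clusters_subst
      using C U_F U_G by (intro UnI2 image_eqI[of _ _ C]; simp)+
    obtain m where m: "m \<in> C" using C clusters_nonempty[of C "forget A"] by blast
    show "C = leaves (forget A) \<or> card C = 1"
    proof (cases "U = {0..<n}")
      case True
      have "m \<in> C" if mM: "m \<in> M" for m
      proof -
        obtain x where x: "x \<in> m" using ne[OF mM] by blast
        then have "x \<in> U" using clusters_subset[OF M(1)[OF mM]] xs True by auto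
        then obtain m' where "m' \<in> C" "x \<in> m'" by (auto simp: U_def)
        then show ?thesis using disj[OF mM, of m'] x CM by blast
      qed
      then show ?thesis using CM setA by auto
    next
      case False
      then have "U \<in> common_clusters (matched P Q)" using U xs by (simp add: matched_def)
      moreover have "m \<subseteq> U" using m by (auto simp: U_def)
      moreover have "m \<in> parts (matched P Q)" using m CM by (auto simp: M_def)
      ultimately have "U = m" by (simp add: parts_def maximal_sets_def)
      have "m' = m" if "m' \<in> C" for m'
      proof (rule ccontr)
        assume "m' \<noteq> m"
        moreover have "m' \<subseteq> m" using that \<open>U = m\<close> by (auto simp: U_def)
        ultimately show False using disj[of m' m] ne[of m'] that m CM by blast
      qed
      then have "C = {m}" using m by blast
      then show ?thesis by simp
    qed
  qed
  define X where "X = (\<lambda>i. (shape (F (leaf_list A ! i)), shape (G (leaf_list A ! i))))"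
  define a where "a = (\<lambda>i. length (leaf_list (F (leaf_list A ! i))))"
  have valid: "(shape A, shape B) \<in> valid_layouts k"
    using AB by (simp add: valid_layouts_def k_def)
  have validX: "X i \<in> valid_layouts (a i)" if "i < k" for i
    using FG[OF nth_M[OF that]] by (simp add: X_def a_def valid_layouts_def)
  have irr: "irreducible (layout_tgram (shape A, shape B))"
  proof -
    have "irreducible (matched A B)"
      using irreducible_matched_iff[OF distA AB] k pair by (simp add: k_def)
    moreover have "tsize (layout_tgram (shape A, shape B)) \<ge> 2" using tsize_layout_tgram[OF valid] k by simp
    ultimately show ?thesis
      using irreducible_iso[OF is_tanglegram_layout_tgram[OF valid] matched_iso_layout_tgram(2)[OF distA AB]] by blast
  qed
  \<comment> \<open>The leaf tagged (i, x) is sent to the x-th leaf of the i-th part. Since F and G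
    list each part in the same order, the one map restores both P and Q.\<close>
  define f where "f = (\<lambda>(i, x). leaf_list (F (leaf_list A ! i)) ! x)"
  have mapA: "map_ptree f (replace_ptree (shape A) (\<lambda>i. fst (X i))) = P"
    unfolding X_def fst_conv A(1) by (rule map_replace_ptree) (simp add: f_def)
  have mapB: "map_ptree f (replace_ptree (shape B) (\<lambda>i. snd (X i))) = Q"
    unfolding X_def snd_conv B(1) AB
    by (rule map_replace_ptree) (use FG nth_M AB in \<open>simp add: f_def k_def\<close>)
  have iso: "iso_tgram (replace_pairs (shape A, shape B) (\<lambda>i. layout_tgram (X i))) (matched P Q)"
    unfolding replace_pairs_layout_tgram
    by (rule matched_isoI[OF mapA mapB]) (use xs replace_layouts(1)[where X = X and a = a, OF valid validX] in simp_all)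
  have tgr: "is_tanglegram (replace_pairs (shape A, shape B) (\<lambda>i. layout_tgram (X i)))"
    by (rule is_tanglegram_replace[where X = X and a = a, OF valid validX])
  show ?thesis
  proof (rule that[OF k valid irr, of X a])
    show "X i \<in> valid_layouts (a i)" if "i < k" for i by (rule validX[OF that])
    have "tsize (matched P Q) = (\<Sum>i<k. a i)"
      using tsize_replace[where X = X and a = a, OF valid validX] tsize_iso[OF iso] by simp
    then show "(\<Sum>i<k. a i) = n" using tsize_layout_tgram[OF assms(1)] by (simp add: T)
    show "layout_class lay = iso_class (replace_pairs (shape A, shape B) (\<lambda>i. layout_tgram (X i)))"
      unfolding layout_class_def T by (rule iso_class_cong[OF tgr iso, symmetric])
  qed
qed

section \<open>Uniform distributions\<close>

lemma pmf_choose_with_prob: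
  assumes "finite A" "\<And>x. x \<in> A \<Longrightarrow> w x \<ge> 0" "sum w A = 1"
  shows "pmf (choose_with_prob A w) x = (if x \<in> A then w x else 0)"
  unfolding choose_with_prob_def
proof (rule pmf_embed_pmf)
  have "(\<integral>\<^sup>+ x. ennreal (if x \<in> A then w x else 0) \<partial>count_space UNIV) =
      (\<Sum>x\<in>A. ennreal (if x \<in> A then w x else 0))"
    using assms(1) by (intro nn_integral_count_space') auto
  also have "\<dots> = ennreal (sum w A)"
    using assms(2) by (subst sum_ennreal) auto
  finally show "(\<integral>\<^sup>+ x. ennreal (if x \<in> A then w x else 0) \<partial>count_space UNIV) = 1"
    using assms(3) by simp
qed (use assms(2) in auto)

text \<open>Choosing a class with probability proportional to its size and then an element uniformly
  is uniform on a disjoint union; this serves both for the choice of k and for that of the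
  composition. An empty class has weight 0, so nothing is demanded of f there,
  \<open>pmf_of_set\<close> being unspecified on the empty set.\<close>

lemma bind_choose_uniform:
  assumes I: "finite I" and fin: "\<And>i. i \<in> I \<Longrightarrow> finite (A i)" and disj: "disjoint_family_on A I"
    and ne: "(\<Union>i\<in>I. A i) \<noteq> {}"
    and f: "\<And>i. i \<in> I \<Longrightarrow> A i \<noteq> {} \<Longrightarrow> f i = pmf_of_set (A i)"
    and w: "\<And>i. i \<in> I \<Longrightarrow> w i = real (card (A i)) / real (card (\<Union>i\<in>I. A i))"
  shows "bind_pmf (choose_with_prob I w) f = pmf_of_set (\<Union>i\<in>I. A i)"
proof (rule pmf_eqI)
  fix x
  let ?U = "\<Union>i\<in>I. A i"
  have finU: "finite ?U" using I fin by blast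
  then have cardU: "card ?U > 0" using ne by (simp add: card_gt_0_iff)
  have "card ?U = (\<Sum>i\<in>I. card (A i))"
    using I fin disj by (intro card_UN_disjoint) (auto simp: disjoint_family_on_def)
  then have "(\<Sum>i\<in>I. real (card (A i))) = real (card ?U)" by simp
  then have sum: "sum w I = 1"
    using cardU w by (simp add: sum_divide_distrib[symmetric])
  have pmf_w: "pmf (choose_with_prob I w) i = (if i \<in> I then w i else 0)" for i
    by (rule pmf_choose_with_prob[OF I _ sum]) (simp add: w)
  have "pmf (bind_pmf (choose_with_prob I w) f) x = (\<Sum>i\<in>I. pmf (f i) x * pmf (choose_with_prob I w) i)"
    unfolding pmf_bind using pmf_w by (intro integral_measure_pmf_real[OF I]) (auto simp: set_pmf_iff split: if_splits)
  also have "\<dots> = (\<Sum>i\<in>I. indicator (A i) x / real (card ?U))"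
  proof (rule sum.cong[OF refl])
    fix i assume i: "i \<in> I"
    show "pmf (f i) x * pmf (choose_with_prob I w) i = indicator (A i) x / real (card ?U)"
    proof (cases "A i = {}")
      case False
      then have "card (A i) > 0" using fin[OF i] by (simp add: card_gt_0_iff)
      then show ?thesis using f[OF i False] fin[OF i] False i by (simp add: pmf_w w)
    qed (simp add: pmf_w w i)
  qed
  also have "\<dots> = indicator ?U x / real (card ?U)"
  proof -
    have "(\<Sum>i\<in>I. indicator (A i) x) = (indicator ?U x :: real)"
      by (rule indicator_UN_disjoint[OF I disj, symmetric])
    then show ?thesis by (simp add: sum_divide_distrib[symmetric])
  qed
  also have "\<dots> = pmf (pmf_of_set ?U) x" using ne finU by simp
  finally show "pmf (bind_pmf (choose_with_prob I w) f) x = pmf (pmf_of_set ?U) x" .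
qed

lemma card_fibres:
  assumes "finite D" "\<And>x. x \<in> D \<Longrightarrow> card {y \<in> D. g y = g x} = m"
  shows "card D = m * card (g ` D)"
proof -
  have "card D = (\<Sum>c\<in>g ` D. \<Sum>x\<in>{x \<in> D. g x = c}. 1)"
    using sum.image_gen[OF assms(1), of "\<lambda>_. 1 :: nat" g] by simp
  also have "\<dots> = (\<Sum>c\<in>g ` D. m)" using assms(2) by (intro sum.cong) auto
  finally show ?thesis by simp
qed

lemma map_pmf_of_set_fibres:
  assumes "finite D" "D \<noteq> {}" "\<And>x. x \<in> D \<Longrightarrow> card {y \<in> D. g y = g x} = m"
  shows "map_pmf g (pmf_of_set D) = pmf_of_set (g ` D)"
proof (rule pmf_eqI)
  fix c
  have card: "card D = m * card (g ` D)" using assms by (intro card_fibres)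
  moreover have "card D > 0" using assms by (simp add: card_gt_0_iff)
  ultimately have m: "m > 0" "card (g ` D) > 0" by (simp_all add: zero_less_mult_iff)
  have "pmf (map_pmf g (pmf_of_set D)) c = card (D \<inter> g -` {c}) / card D"
    unfolding pmf_map by (rule measure_pmf_of_set[OF assms(2,1)])
  also have "D \<inter> g -` {c} = {y \<in> D. g y = c}" by auto
  also have "card {y \<in> D. g y = c} / card D = indicator (g ` D) c / card (g ` D)"
  proof (cases "c \<in> g ` D")
    case True
    then obtain x where "x \<in> D" "c = g x" by auto
    then show ?thesis using assms(3)[of x] m by (simp add: card)
  next
    case False
    then have "{y \<in> D. g y = c} = {}" by auto
    then have "card {y \<in> D. g y = c} = 0" by (simp only: card.empty)
    then show ?thesis using False by simp
  qed
  also have "\<dots> = pmf (pmf_of_set (g ` D)) c" using assms by simp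
  finally show "pmf (map_pmf g (pmf_of_set D)) c = pmf (pmf_of_set (g ` D)) c" .
qed

lemma pair_pmf_of_set:
  fixes A :: "'a set" and B :: "'b set"
  assumes "finite A" "A \<noteq> {}" "finite B" "B \<noteq> {}"
  shows "pair_pmf (pmf_of_set A) (pmf_of_set B) = pmf_of_set (A \<times> B)"
proof (rule pmf_eqI)
  fix p :: "'a \<times> 'b"
  obtain a b where p: "p = (a, b)" by (cases p)
  show "pmf (pair_pmf (pmf_of_set A) (pmf_of_set B)) p = pmf (pmf_of_set (A \<times> B)) p"
    using assms by (simp add: p pmf_pair card_cartesian_product indicator_def)
qed

section \<open>Families of planar tanglegrams\<close>

lemma finite_unit_ptrees: "finite {P :: unit ptree. length (leaf_list P) = n}"
proof (induction n rule: less_induct)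
  case (less n)
  let ?S = "\<lambda>n. {P :: unit ptree. length (leaf_list P) = n}"
  have "?S n \<subseteq> insert (PLeaf ()) ((\<lambda>(l, r). PNode l r) ` ((\<Union>i<n. ?S i) \<times> (\<Union>i<n. ?S i)))"
  proof
    fix P assume P: "P \<in> ?S n"
    show "P \<in> insert (PLeaf ()) ((\<lambda>(l, r). PNode l r) ` ((\<Union>i<n. ?S i) \<times> (\<Union>i<n. ?S i)))"
    proof (cases P)
      case (PNode l r)
      have "length (leaf_list l) > 0" "length (leaf_list r) > 0" by simp_all
      then have "length (leaf_list l) < n" "length (leaf_list r) < n"
        using P by (simp_all add: PNode del: length_greater_0_conv)
      then have "(l, r) \<in> (\<Union>i<n. ?S i) \<times> (\<Union>i<n. ?S i)" by simp
      then show ?thesis unfolding PNode by (intro insertI2 image_eqI[of _ _ "(l, r)"]) simp_all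
    qed simp
  qed
  then show ?case by (rule finite_subset) (use less in auto)
qed

lemma finite_valid_layouts [simp]: "finite (valid_layouts n)"
proof -
  have "valid_layouts n = {P :: unit ptree. length (leaf_list P) = n} \<times> {P :: unit ptree. length (leaf_list P) = n}"
    by (auto simp: valid_layouts_def)
  then show ?thesis using finite_unit_ptrees by simp
qed

lemma finite_planar_tanglegrams [simp]: "finite (planar_tanglegrams n)"
  by (simp add: planar_tanglegrams_eq)

lemma planar_tanglegrams_nonempty:
  assumes "n > 0"
  shows "planar_tanglegrams n \<noteq> {}"
proof -
  \<comment> \<open>Caterpillars; using the same plane tree on both sides gives a layout.\<close>
  have "\<exists>P :: unit ptree. length (leaf_list P) = Suc m" for m
  proof (induction m)
    case 0
    show ?case by (intro exI[of _ "PLeaf ()"]) simp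
  next
    case (Suc m)
    then obtain P :: "unit ptree" where "length (leaf_list P) = Suc m" by blast
    then show ?case by (intro exI[of _ "PNode (PLeaf ()) P"]) simp
  qed
  then obtain P :: "unit ptree" where "length (leaf_list P) = n" using assms by (metis Suc_pred)
  then have "(P, P) \<in> valid_layouts n" by (simp add: valid_layouts_def)
  then show ?thesis by (auto simp: planar_tanglegrams_eq)
qed

lemma planar_tanglegrams_disjoint:
  assumes "c \<in> planar_tanglegrams m" "c \<in> planar_tanglegrams n"
  shows "m = n"
proof -
  obtain lay lay' where lay: "lay \<in> valid_layouts m" "c = layout_class lay" and lay': "lay' \<in> valid_layouts n" "c = layout_class lay'"
    using assms by (auto simp: planar_tanglegrams_eq)
  have "iso_tgram (layout_tgram lay) (layout_tgram lay')"
    using iso_class_eq_iff[OF is_tanglegram_layout_tgram[OF lay(1)] is_tanglegram_layout_tgram[OF lay'(1)]] lay(2) lay'(2)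
    by (simp add: layout_class_def)
  from tsize_iso[OF this] show ?thesis
    using tsize_layout_tgram[OF lay(1)] tsize_layout_tgram[OF lay'(1)] by simp
qed

lemma valid_layouts_1: "valid_layouts 1 = {(PLeaf (), PLeaf ())}"
proof -
  have "length (leaf_list P) = 1 \<longleftrightarrow> P = PLeaf ()" for P :: "unit ptree"
  proof (cases P)
    case (PNode l r)
    have "length (leaf_list l) > 0" "length (leaf_list r) > 0" by simp_all
    then show ?thesis by (simp add: PNode del: length_greater_0_conv)
  qed simp
  then show ?thesis unfolding valid_layouts_def by auto
qed

lemma num_planar_1: "num_planar 1 = 1"
  unfolding num_planar_def planar_tanglegrams_eq valid_layouts_1 by simp

section \<open>Families of planar tanglegrams with given sizes or given total size\<close>

definition families :: "nat list \<Rightarrow> (nat \<Rightarrow> tclass) set" where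
  "families as = PiE_dflt {..<length as} {} (\<lambda>i. planar_tanglegrams (as ! i))"

definition all_families :: "nat \<Rightarrow> nat \<Rightarrow> (nat \<Rightarrow> tclass) set" where
  "all_families n k = (\<Union>as\<in>compositions n k. families as)"

lemma random_tanglegrams_eq:
  assumes "as \<in> compositions n k"
  shows "random_tanglegrams as = pmf_of_set (families as)"
proof -
  have "as ! i > 0" if "i < length as" for i
    using assms nth_mem[OF that] by (auto simp: compositions_def)
  then show ?thesis
    unfolding random_tanglegrams_def families_def
    by (intro Pi_pmf_of_set) (simp_all add: planar_tanglegrams_nonempty)
qed

lemma finite_families [simp]: "finite (families as)"
  unfolding families_def by (intro finite_PiE_dflt) simp_all

lemma card_families: "real (card (families as)) = (\<Prod>a\<leftarrow>as. real (num_planar a))"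
proof -
  have "card (families as) = (\<Prod>i<length as. num_planar (as ! i))"
    unfolding families_def num_planar_def by (intro card_PiE_dflt) simp_all
  then show ?thesis
    by (simp add: prod.list_conv_set_nth atLeast0LessThan)
qed

lemma finite_compositions [simp]: "finite (compositions n k)"
proof (rule finite_subset)
  show "compositions n k \<subseteq> {xs. set xs \<subseteq> {..n} \<and> length xs = k}"
    using member_le_sum_list by (auto simp: compositions_def)
qed (simp add: finite_lists_length_eq)

lemma finite_all_families [simp]: "finite (all_families n k)"
  by (simp add: all_families_def)

text \<open>An isomorphism class determines its size, so the composition can be recovered from the
  family.\<close>

lemma disjoint_families: "disjoint_family_on families (compositions n k)"
  unfolding disjoint_family_on_def
proof (intro ballI impI equals0I)
  fix as bs Ts
  assume *: "as \<in> compositions n k" "bs \<in> compositions n k" "as \<noteq> bs" and Ts: "Ts \<in> families as \<inter> families bs"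
  have "as = bs"
  proof (rule nth_equalityI)
    show len: "length as = length bs" using * by (simp add: compositions_def)
    fix i assume "i < length as"
    then have "Ts i \<in> planar_tanglegrams (as ! i)" "Ts i \<in> planar_tanglegrams (bs ! i)"
      using Ts len by (auto simp: families_def PiE_dflt_def)
    then show "as ! i = bs ! i" by (rule planar_tanglegrams_disjoint)
  qed
  with *(3) show False ..
qed

lemma card_all_families:
  "real (card (all_families n k)) = (\<Sum>as\<in>compositions n k. \<Prod>a\<leftarrow>as. real (num_planar a))"
proof -
  have "card (all_families n k) = (\<Sum>as\<in>compositions n k. card (families as))"
    unfolding all_families_def using disjoint_families
    by (intro card_UN_disjoint) (auto simp: disjoint_family_on_def)
  then show ?thesis by (simp add: card_families)
qed

lemma choose_composition:
  assumes "all_families n k \<noteq> {}"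
    and "\<And>as. as \<in> compositions n k \<Longrightarrow> w as = (\<Prod>a\<leftarrow>as. real (num_planar a)) / real (card (all_families n k))"
  shows "bind_pmf (choose_with_prob (compositions n k) w) random_tanglegrams = pmf_of_set (all_families n k)"
  unfolding all_families_def
  by (rule bind_choose_uniform)
     (use assms disjoint_families in \<open>simp_all add: random_tanglegrams_eq card_families all_families_def\<close>)

lemma all_familiesE:
  assumes "Ts \<in> all_families n k"
  obtains X a where "\<And>i. i < k \<Longrightarrow> X i \<in> valid_layouts (a i)" "\<And>i. i < k \<Longrightarrow> Ts i = layout_class (X i)"
    "\<And>i. i \<ge> k \<Longrightarrow> Ts i = {}" "(\<Sum>i<k. a i) = n"
proof -
  obtain as where as: "as \<in> compositions n k" "Ts \<in> families as" using assms by (auto simp: all_families_def)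
  have len: "length as = k" using as by (simp add: compositions_def)
  have "Ts i \<in> layout_class ` valid_layouts (as ! i)" if "i < k" for i
    using as(2) len that by (simp add: families_def PiE_dflt_def planar_tanglegrams_eq)
  then have "\<exists>lay. i < k \<longrightarrow> lay \<in> valid_layouts (as ! i) \<and> Ts i = layout_class lay" for i
    by blast
  then obtain X where "\<And>i. i < k \<longrightarrow> X i \<in> valid_layouts (as ! i) \<and> Ts i = layout_class (X i)" by metis
  moreover have "Ts i = {}" if "i \<ge> k" for i
    using as(2) len that by (auto simp: families_def PiE_dflt_def)
  moreover have "(\<Sum>i<k. as ! i) = n"
    using as(1) len by (simp add: compositions_def sum_list_sum_nth atLeast0LessThan)
  ultimately show ?thesis by (intro that[of X "(!) as"]) simp_all
qed

lemma all_familiesI: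
  assumes "\<And>i. i < k \<Longrightarrow> X i \<in> valid_layouts (a i)" "\<And>i. i < k \<Longrightarrow> Ts i = layout_class (X i)"
    "\<And>i. i \<ge> k \<Longrightarrow> Ts i = {}" "(\<Sum>i<k. a i) = n"
  shows "Ts \<in> all_families n k"
proof -
  have "a i > 0" if "i < k" for i using leaf_list_pos[OF assms(1)[OF that]] .
  then have "map a [0..<k] \<in> compositions n k"
    using assms(4) by (auto simp: compositions_def interv_sum_list_conv_sum_set_nat atLeast0LessThan)
  moreover have "Ts \<in> families (map a [0..<k])"
    using assms(1-3) by (auto simp: families_def PiE_dflt_def planar_tanglegrams_eq)
  ultimately show ?thesis by (auto simp: all_families_def)
qed

lemma compositions_self: "compositions k k = {replicate k 1}"
proof (intro equalityI subsetI)
  fix as assume as: "as \<in> compositions k k"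
  have "sum_list as = length as \<Longrightarrow> \<forall>a\<in>set as. 0 < a \<Longrightarrow> as = replicate (length as) 1" for as :: "nat list"
  proof (induction as)
    case (Cons a as)
    have "length as \<le> sum_list as"
      using Cons.prems(2) sum_list_mono[of as "\<lambda>_. 1" "\<lambda>a. a"] by (simp add: sum_list_triv Suc_leI)
    then have "a = 1" "sum_list as = length as" using Cons.prems by auto
    with Cons show ?case by simp
  qed simp
  with as show "as \<in> {replicate k 1}" by (auto simp: compositions_def)
qed (auto simp: compositions_def sum_list_replicate)

text \<open>The only family has single leaf pairs at all positions. Through it
  \<open>num_irreducible k\<close> is obtained from the same fibre count as
  \<open>num_planar_irr n k\<close>.\<close>

lemma card_all_families_self: "card (all_families k k) = 1"
proof -
  have "real (card (all_families k k)) = 1"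
    unfolding card_all_families compositions_self by (simp add: prod_list_replicate map_replicate num_planar_1[unfolded One_nat_def])
  then show ?thesis by simp
qed

section \<open>The fibres of the assembly map\<close>

lemma irreducible_layout_tgram_mirror:
  assumes "lay \<in> valid_layouts k" "k \<ge> 2"
  shows "irreducible (layout_tgram (mirror_layout lay)) \<longleftrightarrow> irreducible (layout_tgram lay)"
proof -
  obtain A B where lay: "lay = (A, B)" by (cases lay)
  have len: "length (leaf_list A) = k" "length (leaf_list B) = k"
    using assms(1) by (simp_all add: lay valid_layouts_def)
  define r :: "nat \<Rightarrow> nat" where "r = (\<lambda>i. k - 1 - i)"
  have "iso_tgram (layout_tgram lay) (layout_tgram (mirror_layout lay))"
    unfolding layout_tgram_def matched_def iso_tgram.simps lay mirror_layout_def fst_conv snd_conv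
  proof (intro exI[of _ r] conjI)
    show "map_btree r (forget (number_leaves 0 A)) = forget (number_leaves 0 (mirror A))"
         "map_btree r (forget (number_leaves 0 B)) = forget (number_leaves 0 (mirror B))"
      unfolding number_leaves_mirror[OF len(1)] number_leaves_mirror[OF len(2)] r_def forget_map_ptree forget_mirror by (rule refl)+
  qed (use len in \<open>auto simp: inj_on_def r_def\<close>)
  then show ?thesis
    using irreducible_iso[OF is_tanglegram_layout_tgram[OF assms(1)]] tsize_layout_tgram[OF assms(1)] assms(2) by simp
qed

text \<open>The parts form a partition of the k leaves into nonempty sets. There are k of them
  exactly if all are singletons, which leaves no room for a larger common cluster. This reconciles
  the two descriptions of the irreducible planar tanglegrams of size k.\<close>

lemma card_parts_eq_iff_irreducible:
  assumes "lay \<in> valid_layouts k" "k \<ge> 2"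
  shows "card (parts (layout_tgram lay)) = k \<longleftrightarrow> irreducible (layout_tgram lay)"
proof -
  let ?T = "layout_tgram lay"
  have tg: "is_tanglegram ?T" and size: "tsize ?T \<ge> 2"
    using is_tanglegram_layout_tgram[OF assms(1)] tsize_layout_tgram[OF assms(1)] assms(2) by simp_all
  have lv: "leaves (left_tree ?T) = {..<k}"
    using assms(1) by (auto simp: layout_tgram_def matched_def valid_layouts_def)
  have sub: "C \<subseteq> {..<k}" if "C \<in> common_clusters ?T" for C
    using common_clusters_subset[OF that] lv by simp
  have sing: "{a} \<in> common_clusters ?T" if "a < k" for a
    using singleton_in_common_clusters[OF tg size, of a] that lv by simp
  have ne: "C \<noteq> {}" if "C \<in> common_clusters ?T" for C
  proof -
    obtain L R \<sigma> where T: "?T = (L, R, \<sigma>)" by (cases ?T)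
    then have "C \<in> clusters L" using that by simp
    then show ?thesis by (rule clusters_nonempty)
  qed
  have parts_CC: "C \<in> common_clusters ?T" if "C \<in> parts ?T" for C
    using that by (simp add: parts_def maximal_sets_def)
  have fin: "finite (parts ?T)" using finite_subset[OF _ finite_common_clusters[of ?T]] parts_CC by blast
  show ?thesis
  proof
    assume irr: "irreducible ?T"
    have card1: "card C = 1" if "C \<in> common_clusters ?T" for C
      using irr irreducible_iff_common_clusters[OF tg size] that by blast
    have "parts ?T = (\<lambda>a. {a}) ` {..<k}"
    proof (intro equalityI subsetI)
      fix C assume "C \<in> parts ?T"
      then have C: "C \<in> common_clusters ?T" by (rule parts_CC)
      obtain a where "C = {a}" using card1[OF C] by (rule card_1_singletonE)
      then show "C \<in> (\<lambda>a. {a}) ` {..<k}" using sub[OF C] by auto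
    next
      fix C assume "C \<in> (\<lambda>a. {a}) ` {..<k}"
      then obtain a where a: "a < k" "C = {a}" by auto
      have max: "D = C" if D: "D \<in> common_clusters ?T" "C \<subseteq> D" for D
      proof -
        obtain b where "D = {b}" using card1[OF D(1)] by (rule card_1_singletonE)
        then show ?thesis using D(2) a(2) by auto
      qed
      have "C \<in> common_clusters ?T" using sing[OF a(1)] a(2) by simp
      then show "C \<in> parts ?T"
        unfolding parts_def maximal_sets_def by (intro CollectI conjI ballI impI max)
    qed
    then show "card (parts ?T) = k" by (simp add: card_image)
  next
    assume k: "card (parts ?T) = k"
    have "\<Union>(parts ?T) = {..<k}"
    proof (intro equalityI subsetI)
      fix a assume "a \<in> \<Union>(parts ?T)"
      then obtain m where "m \<in> parts ?T" "a \<in> m" by blast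
      then show "a \<in> {..<k}" using sub[OF parts_CC[of m]] by auto
    next
      fix a assume "a \<in> {..<k}"
      then have "a \<in> leaves (left_tree ?T)" using lv by simp
      then obtain m where "m \<in> parts ?T" "a \<in> m" by (rule parts_cover[OF tg size])
      then show "a \<in> \<Union>(parts ?T)" by blast
    qed
    moreover have finC: "finite C" if "C \<in> parts ?T" for C
      using sub[OF parts_CC[OF that]] by (rule finite_subset) simp
    moreover have "pairwise disjnt (parts ?T)"
      unfolding pairwise_def disjnt_def by (intro ballI impI disjoint_parts[OF tg])
    ultimately have sum: "(\<Sum>C\<in>parts ?T. card C) = (\<Sum>C\<in>parts ?T. 1)"
      using card_Union_disjoint[of "parts ?T"] k by simp
    have ge1: "1 \<le> card C" if "C \<in> parts ?T" for C
      using finC[OF that] ne[OF parts_CC[OF that]] by (simp add: Suc_le_eq card_gt_0_iff)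
    have parts1: "card C = 1" if "C \<in> parts ?T" for C
      using sum_mono_inv[OF sum[symmetric] ge1 that fin] by simp
    have "card C = 1" if C: "C \<in> common_clusters ?T" for C
    proof -
      obtain D where D: "D \<in> parts ?T" "C \<subseteq> D"
        unfolding parts_def by (rule maximal_sets_above[OF finite_common_clusters C])
      have "card C \<le> 1" using card_mono[OF finC[OF D(1)] D(2)] parts1[OF D(1)] by simp
      moreover have "card C \<noteq> 0" using ne[OF C] finite_subset[OF D(2) finC[OF D(1)]] by simp
      ultimately show ?thesis by linarith
    qed
    then show "irreducible ?T" using irreducible_iff_common_clusters[OF tg size] by blast
  qed
qed

lemma num_irreducible_eq:
  assumes "k \<ge> 2"
  shows "num_irreducible k = card (planar_irr_classes k k)"
proof -
  have "{iso_class T | T :: nat tgram. is_tanglegram T \<and> planar T \<and> tsize T = k \<and> irreducible T} = planar_irr_classes k k"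
  proof (intro equalityI subsetI)
    fix c assume "c \<in> {iso_class T | T :: nat tgram. is_tanglegram T \<and> planar T \<and> tsize T = k \<and> irreducible T}"
    then obtain T :: "nat tgram" where T: "c = iso_class T" "is_tanglegram T" "planar T" "tsize T = k" "irreducible T"
      by blast
    obtain lay where lay: "lay \<in> valid_layouts k" "iso_tgram (layout_tgram lay) T" "iso_class T = layout_class lay"
      using planar_imp_layout_class[OF T(2,3)] T(4) by metis
    have "irreducible (layout_tgram lay)"
      using irreducible_iso[OF is_tanglegram_layout_tgram[OF lay(1)] lay(2)] tsize_layout_tgram[OF lay(1)] T(5) assms by simp
    then have "card (parts (layout_tgram lay)) = k" using card_parts_eq_iff_irreducible[OF lay(1) assms] by simp
    then show "c \<in> planar_irr_classes k k" unfolding planar_irr_classes_def using lay T(1) by blast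
  next
    fix c assume "c \<in> planar_irr_classes k k"
    then obtain lay where lay: "c = layout_class lay" "lay \<in> valid_layouts k" "card (parts (layout_tgram lay)) = k"
      unfolding planar_irr_classes_def by blast
    then have "irreducible (layout_tgram lay)" using card_parts_eq_iff_irreducible[OF lay(2) assms] by simp
    then show "c \<in> {iso_class T | T :: nat tgram. is_tanglegram T \<and> planar T \<and> tsize T = k \<and> irreducible T}"
      unfolding lay(1) layout_class_def
      using is_tanglegram_layout_tgram[OF lay(2)] planar_layout_tgram[OF lay(2)] tsize_layout_tgram[OF lay(2)]
      by blast
  qed
  then show ?thesis by (simp add: num_irreducible_def)
qed

lemma num_planar_irr_eq: "n \<ge> 2 \<Longrightarrow> num_planar_irr n k = card (planar_irr_classes n k)"
  unfolding num_planar_irr_def by (simp only: planar_irr_classes_eq)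

section \<open>Configurations, their assembly and their reflection\<close>

definition configurations :: "nat \<Rightarrow> nat \<Rightarrow> (layout \<times> (nat \<Rightarrow> tclass)) set" where
  "configurations n k = irreducible_layouts k \<times> all_families n k"

definition assemble :: "layout \<times> (nat \<Rightarrow> tclass) \<Rightarrow> tclass" where
  "assemble x = replace_class (fst x) (snd x)"

definition reflect :: "nat \<Rightarrow> layout \<times> (nat \<Rightarrow> tclass) \<Rightarrow> layout \<times> (nat \<Rightarrow> tclass)" where
  "reflect k x = (mirror_layout (fst x), rev_family k (snd x))"

lemma finite_irreducible_layouts: "k \<ge> 2 \<Longrightarrow> finite (irreducible_layouts k)"
  by (simp add: irreducible_layouts_eq)

lemma finite_configurations: "k \<ge> 2 \<Longrightarrow> finite (configurations n k)"
  by (simp add: configurations_def finite_irreducible_layouts)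

lemma configurationsE:
  assumes "x \<in> configurations n k" "k \<ge> 2"
  obtains lay Ts X a where "x = (lay, Ts)" "lay \<in> valid_layouts k" "irreducible (layout_tgram lay)"
    "\<And>i. i < k \<Longrightarrow> X i \<in> valid_layouts (a i)" "\<And>i. i < k \<Longrightarrow> Ts i = layout_class (X i)"
    "\<And>i. i \<ge> k \<Longrightarrow> Ts i = {}" "(\<Sum>i<k. a i) = n"
proof -
  obtain lay Ts where x: "x = (lay, Ts)" "lay \<in> irreducible_layouts k" "Ts \<in> all_families n k"
    using assms(1) by (auto simp: configurations_def)
  obtain X a where X: "\<And>i. i < k \<Longrightarrow> X i \<in> valid_layouts (a i)" "\<And>i. i < k \<Longrightarrow> Ts i = layout_class (X i)"
    "\<And>i. i \<ge> k \<Longrightarrow> Ts i = {}" "(\<Sum>i<k. a i) = n"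
    by (rule all_familiesE[OF x(3)]) blast
  have "lay \<in> valid_layouts k" "irreducible (layout_tgram lay)"
    using x(2) assms(2) by (simp_all add: irreducible_layouts_eq)
  from that[OF x(1) this X] show ?thesis .
qed

lemma assemble_image:
  assumes "k \<ge> 2" "n \<ge> 2"
  shows "assemble ` configurations n k = planar_irr_classes n k"
proof (intro equalityI subsetI)
  fix c assume "c \<in> assemble ` configurations n k"
  then obtain x where x: "x \<in> configurations n k" "c = assemble x" by blast
  obtain lay Ts X a where *: "x = (lay, Ts)" "lay \<in> valid_layouts k" "irreducible (layout_tgram lay)"
    "\<And>i. i < k \<Longrightarrow> X i \<in> valid_layouts (a i)" "\<And>i. i < k \<Longrightarrow> Ts i = layout_class (X i)"
    "\<And>i. i \<ge> k \<Longrightarrow> Ts i = {}" "(\<Sum>i<k. a i) = n"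
    by (rule configurationsE[OF x(1) assms(1)]) blast
  have "replace_class lay Ts \<in> planar_irr_classes (\<Sum>i<k. a i) k"
    by (rule replace_class_in_planar_irr_classes[where X = X and a = a, OF *(2,3) assms(1) *(4,5)])
  then show "c \<in> planar_irr_classes n k" by (simp add: x(2) *(1,7) assemble_def)
next
  fix c assume c: "c \<in> planar_irr_classes n k"
  then obtain lay where lay: "lay \<in> valid_layouts n" "c = layout_class lay" unfolding planar_irr_classes_def by blast
  obtain k' lay' X a where *: "k' \<ge> 2" "lay' \<in> valid_layouts k'" "irreducible (layout_tgram lay')"
    "\<And>i. i < k' \<Longrightarrow> X i \<in> valid_layouts (a i)" "(\<Sum>i<k'. a i) = n"
    "layout_class lay = iso_class (replace_pairs lay' (\<lambda>i. layout_tgram (X i)))"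
    by (rule decomposition[OF lay(1) assms(2)]) blast
  define Ts where "Ts = (\<lambda>i. if i < k' then layout_class (X i) else {})"
  have Ts: "Ts i = layout_class (X i)" if "i < k'" for i using that by (simp add: Ts_def)
  have Ts_dummy: "Ts i = {}" if "i \<ge> k'" for i using that by (simp add: Ts_def)
  have c_eq: "c = replace_class lay' Ts"
    using replace_class_eq[where X = X and a = a, OF *(2,4) Ts] lay(2) *(6) by simp
  have "replace_class lay' Ts \<in> planar_irr_classes (\<Sum>i<k'. a i) k'"
    by (rule replace_class_in_planar_irr_classes[where X = X and a = a, OF *(2,3,1,4) Ts])
  \<comment> \<open>The decomposition comes with a size of its own; it is the number of parts, which
    is an invariant of the class c.\<close>
  then have k: "k' = k" using planar_irr_classes_disjoint[of c n k' k] c c_eq *(5) by simp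
  have "Ts \<in> all_families n k'"
    using *(4) Ts Ts_dummy *(5) by (rule all_familiesI)
  then have "(lay', Ts) \<in> configurations n k"
    using *(2,3) k assms(1) by (simp add: configurations_def irreducible_layouts_eq)
  then show "c \<in> assemble ` configurations n k"
    using c_eq by (intro image_eqI[of _ _ "(lay', Ts)"]) (simp_all add: assemble_def)
qed

lemma reflect_configuration:
  assumes "x \<in> configurations n k" "k \<ge> 2"
  shows "reflect k x \<in> configurations n k" "assemble (reflect k x) = assemble x"
proof -
  obtain lay Ts X a where *: "x = (lay, Ts)" "lay \<in> valid_layouts k" "irreducible (layout_tgram lay)"
    "\<And>i. i < k \<Longrightarrow> X i \<in> valid_layouts (a i)" "\<And>i. i < k \<Longrightarrow> Ts i = layout_class (X i)"
    "\<And>i. i \<ge> k \<Longrightarrow> Ts i = {}" "(\<Sum>i<k. a i) = n"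
    by (rule configurationsE[OF assms]) blast
  have "(\<Sum>i<k. a (k - 1 - i)) = n"
    using *(7) sum.nat_diff_reindex[of a k] by simp
  then have "rev_family k Ts \<in> all_families n k"
    using *(4-6) by (intro all_familiesI[of k "\<lambda>i. X (k - 1 - i)" "\<lambda>i. a (k - 1 - i)"]) (simp_all add: rev_family_def)
  moreover have "mirror_layout lay \<in> irreducible_layouts k"
    using *(2,3) assms(2) irreducible_layout_tgram_mirror[OF *(2)] by (simp add: irreducible_layouts_eq)
  ultimately show "reflect k x \<in> configurations n k"
    by (simp add: *(1) reflect_def configurations_def)
  show "assemble (reflect k x) = assemble x"
    using replace_class_mirror[where X = X and a = a, OF *(2,4,5)] by (simp add: *(1) reflect_def assemble_def)
qed

text \<open>This combines \<open>replace_inject\<close> with \<open>reflect_configuration\<close>.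
  Outside the first k positions all families have the dummy entry, so agreement on these positions
  is equality.\<close>

lemma assemble_fibre:
  assumes "x \<in> configurations n k" "k \<ge> 2"
  shows "{y \<in> configurations n k. assemble y = assemble x} = {x, reflect k x}"
proof (intro equalityI subsetI)
  fix y assume "y \<in> {x, reflect k x}"
  then show "y \<in> {y \<in> configurations n k. assemble y = assemble x}"
    using reflect_configuration[OF assms] assms(1) by auto
next
  fix y assume y: "y \<in> {y \<in> configurations n k. assemble y = assemble x}"
  obtain A B where AB: "fst x = (A, B)" by (cases "fst x")
  obtain A' B' where AB': "fst y = (A', B')" by (cases "fst y")
  obtain lay Ts X a where *: "x = (lay, Ts)" "lay \<in> valid_layouts k" "irreducible (layout_tgram lay)"
    "\<And>i. i < k \<Longrightarrow> X i \<in> valid_layouts (a i)" "\<And>i. i < k \<Longrightarrow> Ts i = layout_class (X i)"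
    "\<And>i. i \<ge> k \<Longrightarrow> Ts i = {}" "(\<Sum>i<k. a i) = n"
    by (rule configurationsE[OF assms]) blast
  have "y \<in> configurations n k" using y by simp
  then obtain lay' Ts' X' a' where **: "y = (lay', Ts')" "lay' \<in> valid_layouts k" "irreducible (layout_tgram lay')"
    "\<And>i. i < k \<Longrightarrow> X' i \<in> valid_layouts (a' i)" "\<And>i. i < k \<Longrightarrow> Ts' i = layout_class (X' i)"
    "\<And>i. i \<ge> k \<Longrightarrow> Ts' i = {}" "(\<Sum>i<k. a' i) = n"
    by (rule configurationsE[OF _ assms(2)]) blast
  have lay: "lay = (A, B)" "lay' = (A', B')" using AB AB' by (simp_all add: *(1) **(1))
  have "iso_class (replace_pairs lay (\<lambda>i. layout_tgram (X i))) = iso_class (replace_pairs lay' (\<lambda>i. layout_tgram (X' i)))"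
    using y replace_class_eq[where X = X and a = a, OF *(2,4,5)] replace_class_eq[where X = X' and a = a', OF **(2,4,5)]
    by (simp add: *(1) **(1) assemble_def)
  then have iso: "iso_tgram (replace_pairs (A, B) (\<lambda>i. layout_tgram (X i))) (replace_pairs (A', B') (\<lambda>i. layout_tgram (X' i)))"
    using iso_class_eq_iff[OF is_tanglegram_replace[where X = X and a = a, OF *(2,4)]
        is_tanglegram_replace[where X = X' and a = a', OF **(2,4)]] unfolding lay by blast
  have "(A', B') = (A, B) \<and> (\<forall>i<k. layout_class (X' i) = layout_class (X i)) \<or>
         (A', B') = mirror_layout (A, B) \<and> (\<forall>i<k. layout_class (X' i) = layout_class (X (k - 1 - i)))"
    by (rule replace_inject[where a = a and a' = a'])
       (use *(2-4) **(2-4) assms(2) iso in \<open>simp_all only: lay\<close>)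
  then show "y \<in> {x, reflect k x}"
  proof
    assume eq: "(A', B') = (A, B) \<and> (\<forall>i<k. layout_class (X' i) = layout_class (X i))"
    have "Ts' = Ts"
    proof
      fix i show "Ts' i = Ts i" using eq *(5,6) **(5,6) by (cases "i < k") simp_all
    qed
    then show ?thesis using eq by (simp add: *(1) **(1) lay)
  next
    assume eq: "(A', B') = mirror_layout (A, B) \<and> (\<forall>i<k. layout_class (X' i) = layout_class (X (k - 1 - i)))"
    have "Ts' = rev_family k Ts"
    proof
      fix i show "Ts' i = rev_family k Ts i" using eq *(5,6) **(5,6) by (cases "i < k") (simp_all add: rev_family_def)
    qed
    then have "y = reflect k x" using eq by (simp only: *(1) **(1) lay reflect_def fst_conv snd_conv)
    then show ?thesis by simp
  qed
qed

lemma mirror_layout_neq: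
  assumes "lay \<in> irreducible_layouts k" "k \<ge> 3"
  shows "mirror_layout lay \<noteq> lay"
proof
  assume eq: "mirror_layout lay = lay"
  obtain A B where lay: "lay = (A, B)" by (cases lay)
  have v: "(A, B) \<in> valid_layouts k" "irreducible (layout_tgram (A, B))"
    using assms by (simp_all add: irreducible_layouts_eq lay)
  \<comment> \<open>The children of the root of a symmetric tree have equally many leaves, so their
    number h = k / 2 is the same for A and B. For k \<ge> 3 the set {0..<h} is neither a singleton
    nor the full leaf set.\<close>
  have half: "\<exists>h. k = 2 * h \<and> {0..<h} \<in> clusters (forget (number_leaves 0 C))"
    if C: "length (leaf_list C) = k" "mirror C = C" for C :: "unit ptree"
  proof (cases C)
    case (PLeaf a)
    then show ?thesis using C assms(2) by simp
  next
    case (PNode l r)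
    have "r = mirror l" using C(2) unfolding PNode by (metis mirror.simps(2) ptree.inject(2))
    then have "k = 2 * length (leaf_list l)" using C(1) by (simp add: PNode)
    moreover have "{0..<length (leaf_list l)} \<in> clusters (forget (number_leaves 0 C))"
      using leaves_in_clusters[of "forget (number_leaves 0 l)"] by (simp add: PNode)
    ultimately show ?thesis by blast
  qed
  have "mirror A = A" "mirror B = B" using eq by (simp_all add: lay mirror_layout_def)
  moreover have "length (leaf_list A) = k" "length (leaf_list B) = k" using v(1) by (simp_all add: valid_layouts_def)
  ultimately obtain h h' where "k = 2 * h" "{0..<h} \<in> clusters (forget (number_leaves 0 A))"
      "k = 2 * h'" "{0..<h'} \<in> clusters (forget (number_leaves 0 B))"
    using half by blast
  then have h: "k = 2 * h" "{0..<h} \<in> clusters (forget (number_leaves 0 A)) \<inter> clusters (forget (number_leaves 0 B))"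
    by auto
  have "irreducible_pair (forget (number_leaves 0 A)) (forget (number_leaves 0 B))"
    using irreducible_layout_tgram_iff[OF v(1)] v(2) assms(2) by simp
  then have "{0..<h} = leaves (forget (number_leaves 0 A)) \<or> card {0..<h} = 1"
    using h(2) unfolding irreducible_pair_def by blast
  moreover have "leaves (forget (number_leaves 0 A)) = {0..<2 * h}" using v(1) h(1) by (simp add: valid_layouts_def)
  ultimately show False using h(1) assms(2) by auto
qed

text \<open>For k \<ge> 3 the layout itself changes. For k = 2 it does not, but a fixed
  configuration would have two equal tanglegrams, hence equal sizes and an even n.\<close>

lemma reflect_neq:
  assumes x: "x \<in> configurations n k" and k: "k \<ge> 3 \<or> k = 2 \<and> odd n"
  shows "reflect k x \<noteq> x"
  using k
proof
  assume "k \<ge> 3"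
  moreover have "fst x \<in> irreducible_layouts k" using x by (auto simp: configurations_def)
  ultimately have "mirror_layout (fst x) \<noteq> fst x" by (intro mirror_layout_neq)
  then show ?thesis by (metis fst_conv reflect_def)
next
  assume k2: "k = 2 \<and> odd n"
  obtain lay Ts X a where *: "x = (lay, Ts)" "lay \<in> valid_layouts k" "irreducible (layout_tgram lay)"
    "\<And>i. i < k \<Longrightarrow> X i \<in> valid_layouts (a i)" "\<And>i. i < k \<Longrightarrow> Ts i = layout_class (X i)"
    "\<And>i. i \<ge> k \<Longrightarrow> Ts i = {}" "(\<Sum>i<k. a i) = n"
    by (rule configurationsE[OF x]) (use k2 in simp, blast)
  show ?thesis
  proof
    assume "reflect k x = x"
    then have "rev_family 2 Ts 0 = Ts 0" using k2 by (simp add: reflect_def *(1))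
    then have "Ts 1 = Ts 0" by (simp add: rev_family_def)
    moreover have "Ts 0 \<in> planar_tanglegrams (a 0)" "Ts 1 \<in> planar_tanglegrams (a 1)"
      using *(4,5)[of 0] *(4,5)[of 1] k2 by (simp_all add: planar_tanglegrams_eq)
    ultimately have "a 0 = a 1" using planar_tanglegrams_disjoint[of "Ts 0" "a 0" "a 1"] by simp
    then have "n = 2 * a 0" using *(7) k2 by (simp add: numeral_2_eq_2)
    then show False using k2 by simp
  qed
qed

lemma card_fibre:
  assumes "x \<in> configurations n k" "k \<ge> 3 \<or> k = 2 \<and> odd n"
  shows "card {y \<in> configurations n k. assemble y = assemble x} = 2"
proof -
  have "k \<ge> 2" using assms(2) by auto
  then show ?thesis
    using reflect_neq[OF assms] by (simp add: assemble_fibre[OF assms(1)])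
qed

text \<open>Counting configurations by the two-element fibres of the assembly map; it is applied
  both to n and to the special case n = k.\<close>

lemma card_configurations:
  assumes "n \<ge> 2" "k \<ge> 3 \<or> k = 2 \<and> odd n"
  shows "card (irreducible_layouts k) * card (all_families n k) = 2 * card (planar_irr_classes n k)"
proof -
  have k: "k \<ge> 2" using assms(2) by auto
  have "card (configurations n k) = 2 * card (assemble ` configurations n k)"
    by (rule card_fibres[OF finite_configurations[OF k]]) (rule card_fibre[OF _ assms(2)])
  then show ?thesis
    unfolding assemble_image[OF k assms(1)] by (simp add: configurations_def card_cartesian_product)
qed

section \<open>The unique layout of size 2 and the normalising constants\<close>

lemma cherry_layouts: "valid_layouts 2 = {(PNode (PLeaf ()) (PLeaf ()), PNode (PLeaf ()) (PLeaf ()))}"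
proof -
  have 1: "length (leaf_list P) = 1 \<longleftrightarrow> P = PLeaf ()" for P :: "unit ptree"
    using valid_layouts_1 by (auto simp: valid_layouts_def)
  have "length (leaf_list P) = 2 \<longleftrightarrow> P = PNode (PLeaf ()) (PLeaf ())" for P :: "unit ptree"
  proof (cases P)
    case (PNode l r)
    have "length (leaf_list l) > 0" "length (leaf_list r) > 0" by simp_all
    then have "length (leaf_list P) = 2 \<longleftrightarrow> length (leaf_list l) = 1 \<and> length (leaf_list r) = 1"
      unfolding PNode leaf_list.simps length_append by linarith
    then show ?thesis unfolding 1 by (simp add: PNode)
  qed simp
  then show ?thesis unfolding valid_layouts_def by auto
qed

definition cherry :: layout where
  "cherry = (PNode (PLeaf ()) (PLeaf ()), PNode (PLeaf ()) (PLeaf ()))"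

lemma irreducible_layouts_2: "irreducible_layouts 2 = {cherry}"
proof -
  have v: "cherry \<in> valid_layouts 2" by (simp add: cherry_layouts cherry_def)
  have "irreducible (layout_tgram cherry)"
    using irreducible_layout_tgram_iff[OF v[unfolded cherry_def]]
    by (auto simp: cherry_def irreducible_pair_def)
  then show ?thesis
    using v by (auto simp: irreducible_layouts_eq cherry_layouts cherry_def)
qed

lemma mirror_cherry [simp]: "mirror_layout cherry = cherry"
  by (simp add: cherry_def mirror_layout_def)

lemma planar_irr_classes_empty_iff:
  assumes "n \<ge> 2" "k \<ge> 2"
  shows "planar_irr_classes n k = {} \<longleftrightarrow> irreducible_layouts k = {} \<or> all_families n k = {}"
  unfolding assemble_image[OF assms(2,1), symmetric] by (auto simp: configurations_def)

lemma num_irreducible_2: "num_irreducible 2 = 1"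
proof -
  obtain Ts where "all_families 2 2 = {Ts}"
    using card_all_families_self[of 2] by (rule card_1_singletonE)
  then have "configurations 2 2 = {(cherry, Ts)}" by (simp add: configurations_def irreducible_layouts_2)
  then have "planar_irr_classes 2 2 = {assemble (cherry, Ts)}"
    using assemble_image[of 2 2] by simp
  then show ?thesis by (simp add: num_irreducible_eq)
qed

lemma coeff_c_2: "n \<ge> 2 \<Longrightarrow> coeff_c n 2 = card (planar_irr_classes n 2)"
  by (simp add: coeff_c_def num_irreducible_2 num_planar_irr_eq)

text \<open>Dividing the count of configurations for n by the one for n = k cancels the number of
  layouts and the factor 2. Without irreducible layouts of size k the quotient
  \<open>coeff_c n k\<close> would be 0 by the convention for division by 0, hence the last
  assumption.\<close>

lemma coeff_c_eq:
  assumes "n \<ge> 2" "k \<ge> 3" "irreducible_layouts k \<noteq> {}"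
  shows "coeff_c n k = card (all_families n k)"
proof -
  have k2: "k \<ge> 2" using assms(2) by simp
  have irr: "card (irreducible_layouts k) > 0"
    using assms(3) finite_irreducible_layouts[OF k2] by (simp add: card_gt_0_iff)
  have "card (irreducible_layouts k) = 2 * card (planar_irr_classes k k)"
    using card_configurations[of k k] k2 assms(2) by (simp add: card_all_families_self)
  moreover have "card (irreducible_layouts k) * card (all_families n k) = 2 * card (planar_irr_classes n k)"
    using card_configurations[of n k] assms by simp
  ultimately have "card (planar_irr_classes k k) * card (all_families n k) = card (planar_irr_classes n k)"
      "card (planar_irr_classes k k) > 0"
    using irr by simp_all
  moreover from this(1) have "real (card (planar_irr_classes n k)) =
      real (card (planar_irr_classes k k)) * real (card (all_families n k))"
    by (metis of_nat_mult)
  ultimately show ?thesis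
    unfolding coeff_c_def num_planar_irr_eq[OF assms(1)] num_irreducible_eq[OF k2] by simp
qed

lemma assemble_uniform:
  assumes "n \<ge> 2" "k \<ge> 3 \<or> k = 2 \<and> odd n" "planar_irr_classes n k \<noteq> {}"
    and parts: "random_parts n k = pmf_of_set (all_families n k)"
  shows "bind_pmf (pmf_of_set (irreducible_layouts k))
           (\<lambda>lay. bind_pmf (random_parts n k) (\<lambda>Ts. return_pmf (replace_class lay Ts))) =
         pmf_of_set (planar_irr_classes n k)"
proof -
  have k: "k \<ge> 2" using assms(2) by auto
  have ne: "irreducible_layouts k \<noteq> {}" "all_families n k \<noteq> {}"
    using assms(3) planar_irr_classes_empty_iff[OF assms(1) k] by simp_all
  have "bind_pmf (pmf_of_set (irreducible_layouts k))
           (\<lambda>lay. bind_pmf (random_parts n k) (\<lambda>Ts. return_pmf (replace_class lay Ts))) =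
        map_pmf assemble (pair_pmf (pmf_of_set (irreducible_layouts k)) (pmf_of_set (all_families n k)))"
    by (simp add: parts pair_pmf_def map_bind_pmf assemble_def)
  also have "\<dots> = map_pmf assemble (pmf_of_set (configurations n k))"
    using ne finite_irreducible_layouts[OF k] by (simp add: pair_pmf_of_set configurations_def)
  also have "\<dots> = pmf_of_set (assemble ` configurations n k)"
  proof (rule map_pmf_of_set_fibres)
    show "configurations n k \<noteq> {}" using ne by (simp add: configurations_def)
  qed (fact finite_configurations[OF k], rule card_fibre[OF _ assms(2)])
  finally show ?thesis by (simp add: assemble_image[OF k assms(1)])
qed

lemma random_parts_uniform:
  assumes "n \<ge> 2" "k \<ge> 3 \<or> k = 2 \<and> odd n" "planar_irr_classes n k \<noteq> {}"
  shows "random_parts n k = pmf_of_set (all_families n k)"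
proof -
  have k: "k \<ge> 2" using assms(2) by auto
  have ne: "irreducible_layouts k \<noteq> {}" "all_families n k \<noteq> {}"
    using assms(3) planar_irr_classes_empty_iff[OF assms(1) k] by simp_all
  show ?thesis
    using assms(2)
  proof
    assume k3: "k \<ge> 3"
    have "bind_pmf (choose_with_prob (compositions n k) (\<lambda>as. (\<Prod>a\<leftarrow>as. real (num_planar a)) / coeff_c n k)) random_tanglegrams =
        pmf_of_set (all_families n k)"
      by (rule choose_composition[OF ne(2)]) (simp add: coeff_c_eq[OF assms(1) k3 ne(1)])
    then show ?thesis using k3 by (simp add: random_parts_def)
  next
    assume k2: "k = 2 \<and> odd n"
    then have k_eq: "k = 2" by simp
    have "card (all_families n 2) = 2 * card (planar_irr_classes n 2)"
      using card_configurations[of n 2] k2 assms(1) by (simp add: irreducible_layouts_2)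
    then have two_c: "2 * coeff_c n 2 = card (all_families n 2)" using assms(1) by (simp add: coeff_c_2)
    have "bind_pmf (choose_with_prob (compositions n 2) (\<lambda>as. (\<Prod>a\<leftarrow>as. real (num_planar a)) / (2 * coeff_c n 2))) random_tanglegrams =
        pmf_of_set (all_families n 2)"
      by (rule choose_composition[OF ne(2)[unfolded k_eq]]) (simp add: two_c)
    then show ?thesis unfolding k_eq using k2 by (simp add: random_parts_def)
  qed
qed

lemma compositions_2:
  assumes "n \<ge> 1"
  shows "compositions n 2 = (\<lambda>i. [i, n - i]) ` {1..n - 1}"
proof (intro equalityI subsetI)
  fix as assume as: "as \<in> compositions n 2"
  then obtain a b where "as = [a, b]" by (auto simp: compositions_def numeral_2_eq_2 length_Suc_conv)
  with as show "as \<in> (\<lambda>i. [i, n - i]) ` {1..n - 1}"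
    by (intro image_eqI[of _ _ a]) (auto simp: compositions_def)
qed (use assms in \<open>auto simp: compositions_def\<close>)

lemma card_all_families_2:
  assumes "n \<ge> 1"
  shows "real (card (all_families n 2)) = (\<Sum>i=1..n-1. real (num_planar i) * real (num_planar (n - i)))"
  unfolding card_all_families compositions_2[OF assms]
  by (subst sum.reindex) (auto simp: inj_on_def)

lemma fibre_2:
  assumes "Ts \<in> all_families n 2"
  shows "{Ts' \<in> all_families n 2. replace_class cherry Ts' = replace_class cherry Ts} = {Ts, rev_family 2 Ts}"
proof -
  have "(cherry, Ts) \<in> configurations n 2" using assms by (simp add: configurations_def irreducible_layouts_2)
  from assemble_fibre[OF this]
  have "snd ` {y \<in> configurations n 2. assemble y = assemble (cherry, Ts)} = {Ts, rev_family 2 Ts}"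
    by (simp add: reflect_def)
  moreover have "snd ` {y \<in> configurations n 2. assemble y = assemble (cherry, Ts)} =
      {Ts' \<in> all_families n 2. replace_class cherry Ts' = replace_class cherry Ts}"
    by (force simp: configurations_def irreducible_layouts_2 assemble_def)
  ultimately show ?thesis by simp
qed

lemma replace_cherry_image:
  assumes "n \<ge> 2"
  shows "replace_class cherry ` all_families n 2 = planar_irr_classes n 2"
  unfolding assemble_image[OF order_refl assms, symmetric] configurations_def irreducible_layouts_2
  by (force simp: assemble_def)

lemma pmf_map_pmf_of_set:
  assumes "finite S" "S \<noteq> {}"
  shows "pmf (map_pmf g (pmf_of_set S)) c = card {x \<in> S. g x = c} / card S"
proof -
  have "S \<inter> g -` {c} = {x \<in> S. g x = c}" by auto
  then show ?thesis unfolding pmf_map using measure_pmf_of_set[OF assms(2,1)] by metis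
qed

text \<open>The first alternative of step (2c) returns the function that is T everywhere, which is
  not a member of \<open>all_families\<close> because of the dummy entries. Only the first two
  values enter the assembly, so this truncated version can replace it.\<close>

definition constant_pair :: "tclass \<Rightarrow> nat \<Rightarrow> tclass" where
  "constant_pair T i = (if i < 2 then T else {})"

lemma inj_constant_pair: "inj constant_pair"
proof (rule injI)
  fix S T assume "constant_pair S = constant_pair T"
  then have "constant_pair S 0 = constant_pair T 0" by simp
  then show "S = T" by (simp add: constant_pair_def)
qed

lemma symmetric_families:
  assumes "even n"
  shows "{Ts \<in> all_families n 2. rev_family 2 Ts = Ts} = constant_pair ` planar_tanglegrams (n div 2)"
proof (intro equalityI subsetI)
  fix Ts assume Ts: "Ts \<in> {Ts \<in> all_families n 2. rev_family 2 Ts = Ts}"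
  then have "Ts \<in> all_families n 2" by simp
  then obtain X a where X: "\<And>i. i < 2 \<Longrightarrow> X i \<in> valid_layouts (a i)" "\<And>i. i < 2 \<Longrightarrow> Ts i = layout_class (X i)"
    "\<And>i. i \<ge> 2 \<Longrightarrow> Ts i = {}" "(\<Sum>i<2. a i) = n"
    by (rule all_familiesE) blast
  have "rev_family 2 Ts 0 = Ts 0" using Ts by simp
  then have eq: "Ts 1 = Ts 0" by (simp add: rev_family_def)
  have mem: "Ts 0 \<in> planar_tanglegrams (a 0)" "Ts 1 \<in> planar_tanglegrams (a 1)"
    using X(1,2)[of 0] X(1,2)[of 1] by (simp_all add: planar_tanglegrams_eq)
  then have "a 0 = a 1" using planar_tanglegrams_disjoint[of "Ts 0" "a 0" "a 1"] eq by simp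
  moreover have "(\<Sum>i<2. a i) = a 0 + a 1" by (simp add: numeral_2_eq_2)
  ultimately have "n div 2 = a 0" using X(4) by simp
  then have "Ts 0 \<in> planar_tanglegrams (n div 2)" using mem(1) by simp
  moreover have "Ts = constant_pair (Ts 0)"
  proof
    fix i :: nat
    consider "i = 0" | "i = 1" | "i \<ge> 2" by linarith
    then show "Ts i = constant_pair (Ts 0) i" by cases (use eq X(3) in \<open>simp_all add: constant_pair_def\<close>)
  qed
  ultimately show "Ts \<in> constant_pair ` planar_tanglegrams (n div 2)" by (rule rev_image_eqI)
next
  fix Ts assume "Ts \<in> constant_pair ` planar_tanglegrams (n div 2)"
  then obtain lay where lay: "lay \<in> valid_layouts (n div 2)" "Ts = constant_pair (layout_class lay)"
    by (auto simp: planar_tanglegrams_eq)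
  have "Ts \<in> all_families n 2"
  proof (rule all_familiesI)
    show "lay \<in> valid_layouts (n div 2)" by (rule lay(1))
    show "Ts i = layout_class lay" if "i < 2" for i using that by (simp add: lay(2) constant_pair_def)
    show "Ts i = {}" if "i \<ge> 2" for i using that by (simp add: lay(2) constant_pair_def)
    show "(\<Sum>i<(2::nat). n div 2) = n" using assms by simp
  qed
  moreover have "rev_family 2 Ts = Ts"
  proof
    fix i :: nat
    have "2 - 1 - i < (2 :: nat)" by simp
    then show "rev_family 2 Ts i = Ts i"
      unfolding lay(2) rev_family_def constant_pair_def by (simp only: if_True split: if_split) simp
  qed
  ultimately show "Ts \<in> {Ts \<in> all_families n 2. rev_family 2 Ts = Ts}" by simp
qed

lemma replace_constant:
  assumes "T \<in> planar_tanglegrams m"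
  shows "replace_class cherry (\<lambda>_. T) = replace_class cherry (constant_pair T)"
proof -
  obtain lay where lay: "lay \<in> valid_layouts m" "T = layout_class lay" using assms by (auto simp: planar_tanglegrams_eq)
  have v: "cherry \<in> valid_layouts 2" by (simp add: cherry_layouts cherry_def)
  have *: "replace_class cherry Ts = iso_class (replace_pairs cherry (\<lambda>_. layout_tgram lay))"
    if "\<And>i. i < 2 \<Longrightarrow> Ts i = T" for Ts
    by (rule replace_class_eq[where X = "\<lambda>_. lay" and a = "\<lambda>_. m", OF v]) (simp_all add: lay(1) that flip: lay(2))
  show ?thesis
    unfolding *[of "\<lambda>_. T", OF refl] by (rule *[symmetric]) (simp add: constant_pair_def)
qed

text \<open>Let S be the set of all pairs and F that of the pairs with equal entries. As F is chosen
  with probability |F| / (|F| + |S|), the mixture is the image of the uniform distribution on the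
  disjoint union of F and S. On this union every fibre of the assembly has two elements.\<close>

lemma assemble_uniform_even:
  assumes n: "n \<ge> 2" and even: "even n"
  shows "bind_pmf (pmf_of_set (irreducible_layouts 2))
           (\<lambda>lay. bind_pmf (random_parts n 2) (\<lambda>Ts. return_pmf (replace_class lay Ts))) =
         pmf_of_set (planar_irr_classes n 2)"
proof -
  let ?g = "replace_class cherry"
  define S where "S = all_families n 2"
  define F where "F = {Ts \<in> S. rev_family 2 Ts = Ts}"
  define C where "C = planar_irr_classes n 2"
  have g_S: "?g ` S = C" unfolding S_def C_def by (rule replace_cherry_image[OF n])
  have fin: "finite S" "finite F" "finite C" using g_S by (auto simp: S_def F_def)
  have F_eq: "F = constant_pair ` planar_tanglegrams (n div 2)"
    unfolding F_def S_def by (rule symmetric_families[OF even])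
  have planar_ne: "planar_tanglegrams (n div 2) \<noteq> {}" using n by (intro planar_tanglegrams_nonempty) simp
  have card_F: "card F = num_planar (n div 2)"
    unfolding F_eq num_planar_def by (rule card_image[OF inj_on_subset[OF inj_constant_pair subset_UNIV]])
  have "F \<noteq> {}" using planar_ne by (simp add: F_eq)
  moreover have "F \<subseteq> S" by (auto simp: F_def)
  ultimately have ne: "F \<noteq> {}" "S \<noteq> {}" "C \<noteq> {}" unfolding g_S[symmetric] by auto
  have pos: "card F > 0" "card S > 0" "card C > 0" using ne fin by (simp_all add: card_gt_0_iff)
  \<comment> \<open>If reversal moves the pair, the fibre has two elements in S and none in F; if it
    fixes the pair, one in each.\<close>
  have fibre: "card {Ts \<in> F. ?g Ts = c} + card {Ts \<in> S. ?g Ts = c} = 2" if c: "c \<in> C" for c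
  proof -
    obtain Ts where Ts: "Ts \<in> S" "c = ?g Ts" using c g_S by blast
    have S_fib: "{Ts' \<in> S. ?g Ts' = c} = {Ts, rev_family 2 Ts}"
      using fibre_2[of Ts n] Ts by (simp add: S_def)
    have "{Ts' \<in> F. ?g Ts' = c} = {Ts' \<in> {Ts' \<in> S. ?g Ts' = c}. rev_family 2 Ts' = Ts'}"
      by (auto simp: F_def)
    then have F_fib: "{Ts' \<in> F. ?g Ts' = c} = {Ts' \<in> {Ts, rev_family 2 Ts}. rev_family 2 Ts' = Ts'}"
      by (simp only: S_fib)
    show ?thesis
    proof (cases "rev_family 2 Ts = Ts")
      case True
      then have "{Ts' \<in> {Ts, rev_family 2 Ts}. rev_family 2 Ts' = Ts'} = {Ts}" by auto
      then show ?thesis unfolding S_fib F_fib using True by simp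
    next
      case False
      then have "{Ts' \<in> {Ts, rev_family 2 Ts}. rev_family 2 Ts' = Ts'} = {}"
        using rev_family_rev_family[of 2 Ts] by auto
      then have "card {Ts' \<in> {Ts, rev_family 2 Ts}. rev_family 2 Ts' = Ts'} = 0" by (simp only: card.empty)
      then show ?thesis unfolding S_fib F_fib using False by simp
    qed
  qed
  have "(\<Sum>c\<in>C. card {Ts \<in> F. ?g Ts = c}) = card F" "(\<Sum>c\<in>C. card {Ts \<in> S. ?g Ts = c}) = card S"
    using sum.group[OF fin(2,3), of ?g "\<lambda>_. 1 :: nat"] sum.group[OF fin(1,3), of ?g "\<lambda>_. 1 :: nat"] g_S
    by (auto simp: F_def)
  moreover have "(\<Sum>c\<in>C. card {Ts \<in> F. ?g Ts = c} + card {Ts \<in> S. ?g Ts = c}) = (\<Sum>c\<in>C. 2)"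
    by (rule sum.cong[OF refl fibre])
  ultimately have total: "card F + card S = 2 * card C"
    unfolding sum.distrib by simp
  define p where "p = real (num_planar (n div 2)) / (2 * coeff_c n 2)"
  have two_c: "2 * coeff_c n 2 = real (card F) + real (card S)"
    using total coeff_c_2[OF n] by (simp add: C_def flip: of_nat_add)
  have p: "p = card F / (card F + card S)" "1 - p = card S / (card F + card S)"
    using pos by (simp_all add: p_def two_c card_F[symmetric] field_simps)
  have "0 \<le> 1 - p" by (subst p(2)) simp
  moreover have "0 \<le> p" by (subst p(1)) simp
  ultimately have p01: "0 \<le> p" "p \<le> 1" by simp_all
  have comp: "bind_pmf (choose_with_prob (compositions n 2)
        (\<lambda>as. (\<Prod>a\<leftarrow>as. real (num_planar a)) / (\<Sum>i=1..n-1. real (num_planar i) * real (num_planar (n - i))))) random_tanglegrams =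
      pmf_of_set S"
    unfolding S_def
    by (rule choose_composition) (use ne n in \<open>simp_all add: S_def card_all_families_2\<close>)
  have same: "map_pmf ?g (bind_pmf (pmf_of_set (planar_tanglegrams (n div 2))) (\<lambda>T. return_pmf (\<lambda>_. T))) =
      map_pmf ?g (pmf_of_set F)"
  proof -
    have "map_pmf ?g (bind_pmf (pmf_of_set (planar_tanglegrams (n div 2))) (\<lambda>T. return_pmf (\<lambda>_. T))) =
        map_pmf (\<lambda>T. ?g (\<lambda>_. T)) (pmf_of_set (planar_tanglegrams (n div 2)))"
      by (simp add: map_pmf_def bind_assoc_pmf bind_return_pmf)
    also have "\<dots> = map_pmf (\<lambda>T. ?g (constant_pair T)) (pmf_of_set (planar_tanglegrams (n div 2)))"
    proof (rule map_pmf_cong[OF refl])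
      fix T assume "T \<in> set_pmf (pmf_of_set (planar_tanglegrams (n div 2)))"
      then have "T \<in> planar_tanglegrams (n div 2)" using planar_ne by simp
      then show "?g (\<lambda>_. T) = ?g (constant_pair T)" by (rule replace_constant)
    qed
    also have "\<dots> = map_pmf ?g (map_pmf constant_pair (pmf_of_set (planar_tanglegrams (n div 2))))"
      by (simp add: pmf.map_comp comp_def)
    also have "map_pmf constant_pair (pmf_of_set (planar_tanglegrams (n div 2))) = pmf_of_set F"
      unfolding F_eq using planar_ne
      by (intro map_pmf_of_set_inj inj_on_subset[OF inj_constant_pair subset_UNIV]) simp_all
    finally show ?thesis .
  qed
  have "bind_pmf (pmf_of_set (irreducible_layouts 2))
           (\<lambda>lay. bind_pmf (random_parts n 2) (\<lambda>Ts. return_pmf (replace_class lay Ts))) =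
        map_pmf ?g (random_parts n 2)"
    by (simp add: irreducible_layouts_2 pmf_of_set_singleton bind_return_pmf map_pmf_def)
  also have "\<dots> = bind_pmf (bernoulli_pmf p) (\<lambda>b. if b then map_pmf ?g (pmf_of_set F) else map_pmf ?g (pmf_of_set S))"
    using even unfolding random_parts_def comp p_def[symmetric] same[symmetric]
    by (simp add: map_bind_pmf if_distrib[where f = "map_pmf ?g"])
  also have "\<dots> = pmf_of_set C"
  proof (rule pmf_eqI)
    fix c
    have "pmf (bind_pmf (bernoulli_pmf p) (\<lambda>b. if b then map_pmf ?g (pmf_of_set F) else map_pmf ?g (pmf_of_set S))) c =
        pmf (map_pmf ?g (pmf_of_set F)) c * p + pmf (map_pmf ?g (pmf_of_set S)) c * (1 - p)"
      unfolding pmf_bind by (simp add: integral_bernoulli_pmf p01)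
    also have "\<dots> = card {Ts \<in> F. ?g Ts = c} / (card F + card S) + card {Ts \<in> S. ?g Ts = c} / (card F + card S)"
      using pos unfolding p(2) unfolding p(1) by (simp add: pmf_map_pmf_of_set fin ne)
    also have "\<dots> = (card {Ts \<in> F. ?g Ts = c} + card {Ts \<in> S. ?g Ts = c}) / (2 * card C)"
      unfolding total[symmetric] by (simp add: add_divide_distrib)
    also have "\<dots> = pmf (pmf_of_set C) c"
    proof (cases "c \<in> C")
      case True
      then show ?thesis using fibre[OF True] pos fin ne by simp
    next
      case False
      then have "{Ts \<in> F. ?g Ts = c} = {}" "{Ts \<in> S. ?g Ts = c} = {}" using g_S by (auto simp: F_def)
      then have zero: "card {Ts \<in> F. ?g Ts = c} = 0" "card {Ts \<in> S. ?g Ts = c} = 0" by (simp_all only: card.empty)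
      show ?thesis unfolding zero using False fin ne by simp
    qed
    finally show "pmf (bind_pmf (bernoulli_pmf p) (\<lambda>b. if b then map_pmf ?g (pmf_of_set F) else map_pmf ?g (pmf_of_set S))) c =
        pmf (pmf_of_set C) c" .
  qed
  finally show ?thesis by (simp add: C_def)
qed

section \<open>Summation over the size of the irreducible layout\<close>

lemma planar_tanglegrams_decompose:
  assumes "n \<ge> 2"
  shows "planar_tanglegrams n = (\<Union>k\<in>{2..n}. planar_irr_classes n k)"
proof (intro equalityI subsetI)
  fix c assume "c \<in> planar_tanglegrams n"
  then obtain lay where lay: "lay \<in> valid_layouts n" "c = layout_class lay" by (auto simp: planar_tanglegrams_eq)
  obtain k lay' X a where *: "k \<ge> 2" "lay' \<in> valid_layouts k" "irreducible (layout_tgram lay')"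
    "\<And>i. i < k \<Longrightarrow> X i \<in> valid_layouts (a i)" "(\<Sum>i<k. a i) = n"
    "layout_class lay = iso_class (replace_pairs lay' (\<lambda>i. layout_tgram (X i)))"
    by (rule decomposition[OF lay(1) assms]) blast
  have "c = replace_class lay' (\<lambda>i. layout_class (X i))"
    using replace_class_eq[where X = X and a = a, OF *(2,4) refl] lay(2) *(6) by simp
  moreover have "replace_class lay' (\<lambda>i. layout_class (X i)) \<in> planar_irr_classes (\<Sum>i<k. a i) k"
    by (rule replace_class_in_planar_irr_classes[where X = X and a = a, OF *(2,3,1,4) refl])
  moreover have "k \<le> n"
  proof -
    have "(\<Sum>i<k. 1) \<le> (\<Sum>i<k. a i)"
      using leaf_list_pos[OF *(4)] by (intro sum_mono) (simp add: Suc_leI)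
    then show ?thesis using *(5) by simp
  qed
  ultimately show "c \<in> (\<Union>k\<in>{2..n}. planar_irr_classes n k)" using *(1,5) by auto
next
  fix c assume "c \<in> (\<Union>k\<in>{2..n}. planar_irr_classes n k)"
  then show "c \<in> planar_tanglegrams n" by (auto simp: planar_irr_classes_def planar_tanglegrams_eq)
qed

lemma finite_planar_irr_classes [simp]: "finite (planar_irr_classes n k)"
proof -
  have "planar_irr_classes n k \<subseteq> planar_tanglegrams n"
    by (auto simp: planar_irr_classes_def planar_tanglegrams_eq)
  then show ?thesis by (rule finite_subset) simp
qed

text \<open>Cancelling \<open>num_irreducible k\<close> is immediate unless it is 0. In that case
  the left side vanishes, and there are no irreducible layouts of size k from which a class could be
  assembled.\<close>

lemma size_weight:
  assumes "n \<ge> 2" "k \<ge> 2"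
  shows "real (num_irreducible k) * coeff_c n k = card (planar_irr_classes n k)"
proof (cases "num_irreducible k = 0")
  case True
  then have "planar_irr_classes k k = {}" by (simp add: num_irreducible_eq[OF assms(2)])
  moreover have "all_families k k \<noteq> {}" using card_all_families_self[of k] by auto
  ultimately have "irreducible_layouts k = {}" using planar_irr_classes_empty_iff[OF assms(2,2)] by simp
  then have "planar_irr_classes n k = {}" using planar_irr_classes_empty_iff[OF assms] by simp
  then show ?thesis using True by simp
next
  case False
  then show ?thesis by (simp add: coeff_c_def num_planar_irr_eq[OF assms(1)])
qed

theorem theorem3p2:
  fixes n :: nat
  assumes "n \<ge> 3"
  shows "set_pmf (random_planar_tanglegram n) \<subseteq> planar_tanglegrams n \<and>
         random_planar_tanglegram n = pmf_of_set (planar_tanglegrams n)"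
proof -
  have n: "n \<ge> 2" using assms by simp
  have ne: "planar_tanglegrams n \<noteq> {}" using assms by (intro planar_tanglegrams_nonempty) simp
  have "random_planar_tanglegram n = pmf_of_set (\<Union>k\<in>{2..n}. planar_irr_classes n k)"
    unfolding random_planar_tanglegram_def
  proof (rule bind_choose_uniform)
    show "disjoint_family_on (planar_irr_classes n) {2..n}"
      unfolding disjoint_family_on_def
    proof (intro ballI impI equals0I)
      fix k k' c assume "k \<noteq> k'" "c \<in> planar_irr_classes n k \<inter> planar_irr_classes n k'"
      then show False using planar_irr_classes_disjoint[of c n k k'] by blast
    qed
    show "(\<Union>k\<in>{2..n}. planar_irr_classes n k) \<noteq> {}"
      using ne unfolding planar_tanglegrams_decompose[OF n] .
    fix k assume k: "k \<in> {2..n}"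
    show "real (num_irreducible k) * coeff_c n k / real (num_planar n) =
        real (card (planar_irr_classes n k)) / real (card (\<Union>k\<in>{2..n}. planar_irr_classes n k))"
      unfolding num_planar_def planar_tanglegrams_decompose[OF n, symmetric]
      using size_weight[OF n, of k] k by simp
    \<comment> \<open>Sizes k without any class have weight 0; for them neither the uniform layout
      nor the uniform parts need to be defined.\<close>
    assume C: "planar_irr_classes n k \<noteq> {}"
    show "bind_pmf (pmf_of_set (irreducible_layouts k))
        (\<lambda>lay. bind_pmf (random_parts n k) (\<lambda>Ts. return_pmf (replace_class lay Ts))) = pmf_of_set (planar_irr_classes n k)"
    proof (cases "k \<ge> 3 \<or> k = 2 \<and> odd n")
      case True
      show ?thesis by (rule assemble_uniform[OF n True C random_parts_uniform[OF n True C]])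
    next
      case False
      then have "k = 2" "even n" using k by auto
      then show ?thesis using assemble_uniform_even[OF n] by simp
    qed
  qed simp_all
  then have "random_planar_tanglegram n = pmf_of_set (planar_tanglegrams n)"
    unfolding planar_tanglegrams_decompose[OF n] .
  moreover have "set_pmf (pmf_of_set (planar_tanglegrams n)) = planar_tanglegrams n"
    by (rule set_pmf_of_set[OF ne finite_planar_tanglegrams])
  ultimately show ?thesis by (simp only: subset_refl)
qed

end
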